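(* Let $u\in L^2([0,T]\times\mathbb{T}^3_L)$ be a vector field with $\langle |u_q|^3\rangle<\infty$ for all $q\ge 0$, let $A_q$ ($q\ge 0$) be its active regions, $V_q$ its active volumes and $D$ its intermittency dimension, and let $$A=\limsup_{q\to\infty}A_q=\bigcap_{p=1}^\infty\bigcup_{q>p}A_q .$$ Then there is an absolute constant $c>0$ such that, for all $q\ge 0$, $$|A_q|\le c\,\sigma_q^{-3}V_qT,$$ $$(1-c\sigma_q)\int_{\Omega_T}|u_q|^3\,dx\,dt\le\int_{A_q}|u_q|^3\,dx\,dt\le\int_{\Omega_T}|u_q|^3\,dx\,dt,$$ and $$\dim_{\mathcal H}A(t)\le D\quad\text{for a.e. }t\in[0,T],$$ where $A(t)=\{x\in\mathbb{T}^3_L:(t,x)\in A\}$. In particular, if $D<0$ then $A(t)=\emptyset$ for a.e. $t$.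
   Context: **Setting.** $L,T>0$; $\mathbb{T}^3_L$ is the three-dimensional torus of side length $L$; $\Omega_T=[0,T]\times\mathbb{T}^3_L$; $\langle f\rangle=\frac{1}{TL^3}\int_{\Omega_T}f\,dx\,dt$; $|\cdot|$ of a set is Lebesgue measure; $\dim_{\mathcal H}$ is Hausdorff dimension, with the convention $\dim_{\mathcal H}\emptyset=-\infty$. **Littlewood-Paley decomposition.** Fix a nonnegative radial $\chi\in C_0^\infty(B(0,1))$ on $\mathbb{R}^3$ with $\chi(\xi)=1$ for $|\xi|\le 1/2$, and $\phi(\xi)=\chi(\xi/2)-\chi(\xi)$. Let $\varphi_{-1}(\xi)=\chi(L\xi)$, $\varphi_q(\xi)=\phi(L\xi/2^q)$ for $q\ge 0$. With Fourier coefficients $\mathcal F(u)(k)=L^{-3}\int_{\mathbb{T}^3_L}u(x)e^{-2\pi i k\cdot x}dx$, $k\in\frac1L\mathbb{Z}^3$, set $u_q=\sum_{k\in\frac1L\mathbb{Z}^3}\varphi_q(k)\mathcal F(u)(k)e^{2\pi i k\cdot x}$ (acting in the space variable), so $u=\sum_{q\ge-1}u_q$. Put $\lambda_q=2^q/L$, $\ell_q=L/2^q$. **Atomic decomposition.** For $q\ge 0$, $k\in[0,2^q-1]^3\cap\mathbb{Z}^3$ let $Q_{qk}=[0,\ell_q)^3+\ell_qk\subset\mathbb{T}^3_L$ and $Q^*_{qk}=\bigcup_{|k'-k|<3}Q_{qk'}$ (indices understood periodically). Fix an integer $M>1$ and a smooth nonnegative kernel $\eta$ supported in the unit ball with $\int\eta=1$.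 Let $\chi_{qk}$ be the characteristic function of $Q_{qk}$, $\chi'_{qk}$ its mollification at scale $\ell_q$: $\chi'_{qk}(x)=\frac1{L^3}\int\chi_{qk}(x-y)\eta_q(y)\,dy$, with $\eta_q(y)=2^{3q}\eta(\lambda_qy)$. Put $b_{qk}=u_q\chi'_{qk}$ and $$s_{qk}(t)=\max_{|\beta|\le M}\lambda_q^{-|\beta|}\|\partial_x^\beta b_{qk}(t,\cdot)\|_\infty,\qquad a_{qk}=b_{qk}/s_{qk},$$ so that $u_q=\sum_k s_{qk}a_{qk}$. The objects $\chi,\eta,M$ are fixed once and for all; "absolute constant" means independent of $u,q,L,T$ (and of the sequence $\sigma_q$ below). **Active volumes and dimension.** $V_q=L^3\dfrac{\langle|u_q|^2\rangle^3}{\langle|u_q|^3\rangle^2}$ for $q\ge0$; $D_q=3-\dfrac{\log_2(L^3/V_q)}{q}$ for $q\ge1$; $D=\limsup_{q\to\infty}D_q$. **Active regions.** Fix a positive decreasing sequence of numbers $\sigma_q\to0$ with $\lim_{q\to\infty}\frac{\log\sigma_q}{q}=0$. Set $$A_q(t)=\bigcup\Big\{Q^*_{qk}:\ |s_{qk}(t)|>\sigma_q\frac{\langle|u_q|^3\rangle}{\langle|u_q|^2\rangle}\Big\},\qquad A_q=\{(t,x)\in\Omega_T:x\in A_q(t)\}.$$ Convention: if $u_q=0$ a.e., then $V_q=0$, $D_q=-\infty$ and $A_q=\emptyset$. *)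

theory Defs
  imports "HOL-Analysis.Analysis"
begin

section \<open>The torus of side length \<open>L\<close>\<close>

text \<open>The torus is represented by its fundamental cell \<open>[0,L)^3\<close>, so a function on the torus
  is a function whose values outside the cell are never used, or an \<open>L\<close>-periodic function
  on \<open>real ^ 3\<close>.  The metric is the quotient metric, not the Euclidean metric of the cell.\<close>

definition torus :: "real \<Rightarrow> (real ^ 3) set" where
  "torus L = {x. \<forall>i. 0 \<le> x $ i \<and> x $ i < L}"

definition torus_proj :: "real \<Rightarrow> real ^ 3 \<Rightarrow> real ^ 3" where
  "torus_proj L x = (\<chi> i. x $ i - L * of_int \<lfloor>x $ i / L\<rfloor>)"

definition torus_dist :: "real \<Rightarrow> real ^ 3 \<Rightarrow> real ^ 3 \<Rightarrow> real" where
  "torus_dist L x y = (INF m :: int ^ 3. norm (x - y + L *\<^sub>R (\<chi> i. of_int (m $ i))))"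

definition Omega :: "real \<Rightarrow> real \<Rightarrow> (real \<times> (real ^ 3)) set" where
  "Omega L T = {0..T} \<times> torus L"

definition avg :: "real \<Rightarrow> real \<Rightarrow> (real \<times> (real ^ 3) \<Rightarrow> real) \<Rightarrow> real" where
  "avg L T f = 1 / (T * L ^ 3) * (LINT z : Omega L T | lebesgue. f z)"


section \<open>Hausdorff dimension with respect to a distance function\<close>

definition diam_wrt :: "('a \<Rightarrow> 'a \<Rightarrow> real) \<Rightarrow> 'a set \<Rightarrow> real" where
  "diam_wrt d U = (if U = {} then 0 else (SUP (x, y) \<in> U \<times> U. d x y))"

text \<open>\<open>(diam U)^s\<close>.  The case distinction is needed because \<open>0 powr 0 = 0\<close>, whereas a
  nonempty set has to count as \<open>1\<close> for \<open>s = 0\<close>.\<close>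

definition diam_pow :: "('a \<Rightarrow> 'a \<Rightarrow> real) \<Rightarrow> real \<Rightarrow> 'a set \<Rightarrow> real" where
  "diam_pow d s U = (if U = {} then 0 else if s = 0 then 1 else diam_wrt d U powr s)"

definition hausdorff_premeasure ::
  "('a \<Rightarrow> 'a \<Rightarrow> real) \<Rightarrow> real \<Rightarrow> real \<Rightarrow> 'a set \<Rightarrow> ennreal" where
  "hausdorff_premeasure d s \<delta> S =
     (INF U \<in> {U :: nat \<Rightarrow> 'a set. S \<subseteq> (\<Union>i. U i) \<and> (\<forall>i. \<forall>x\<in>U i. \<forall>y\<in>U i. d x y \<le> \<delta>)}.
        \<Sum>i. ennreal (diam_pow d s (U i)))"

definition hausdorff_measure :: "('a \<Rightarrow> 'a \<Rightarrow> real) \<Rightarrow> real \<Rightarrow> 'a set \<Rightarrow> ennreal" where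
  "hausdorff_measure d s S = (SUP \<delta> \<in> {0<..}. hausdorff_premeasure d s \<delta> S)"

definition hausdorff_dim :: "('a \<Rightarrow> 'a \<Rightarrow> real) \<Rightarrow> 'a set \<Rightarrow> ereal" where
  "hausdorff_dim d S =
     (if S = {} then -\<infinity> else Inf (ereal ` {s. 0 \<le> s \<and> hausdorff_measure d s S = 0}))"


section \<open>Partial derivatives and smooth functions\<close>

definition partial_deriv ::
  "3 \<Rightarrow> (real ^ 3 \<Rightarrow> 'b::real_normed_vector) \<Rightarrow> real ^ 3 \<Rightarrow> 'b" where
  "partial_deriv i f x = vector_derivative (\<lambda>h. f (x + h *\<^sub>R axis i 1)) (at 0)"

definition smooth :: "(real ^ 3 \<Rightarrow> 'b::real_normed_vector) \<Rightarrow> bool" where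
  "smooth f \<longleftrightarrow> (\<forall>is. foldr partial_deriv is f differentiable_on UNIV)"

definition mi_order :: "nat ^ 3 \<Rightarrow> nat" where
  "mi_order \<beta> = (\<Sum>i\<in>UNIV. \<beta> $ i)"

definition multi_deriv ::
  "nat ^ 3 \<Rightarrow> (real ^ 3 \<Rightarrow> 'b::real_normed_vector) \<Rightarrow> real ^ 3 \<Rightarrow> 'b" where
  "multi_deriv \<beta> f =
     (partial_deriv 1 ^^ (\<beta> $ 1)) ((partial_deriv 2 ^^ (\<beta> $ 2)) ((partial_deriv 3 ^^ (\<beta> $ 3)) f))"


section \<open>Littlewood-Paley decomposition\<close>

definition lp_cutoff :: "(real ^ 3 \<Rightarrow> real) \<Rightarrow> bool" where
  "lp_cutoff chi \<longleftrightarrow>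
     smooth chi \<and> closure {\<xi>. chi \<xi> \<noteq> 0} \<subseteq> ball 0 1 \<and>
     (\<forall>\<xi>. 0 \<le> chi \<xi>) \<and> (\<forall>\<xi> \<zeta>. norm \<xi> = norm \<zeta> \<longrightarrow> chi \<xi> = chi \<zeta>) \<and>
     (\<forall>\<xi>. norm \<xi> \<le> 1 / 2 \<longrightarrow> chi \<xi> = 1)"

text \<open>Only the blocks with \<open>q \<ge> 0\<close> are needed; the low-frequency block \<open>q = -1\<close> does not enter
  the active volumes and regions.\<close>

definition lp_symbol :: "(real ^ 3 \<Rightarrow> real) \<Rightarrow> real \<Rightarrow> nat \<Rightarrow> real ^ 3 \<Rightarrow> real" where
  "lp_symbol chi L q \<xi> =
     (let \<phi> = (\<lambda>\<zeta>. chi ((1 / 2) *\<^sub>R \<zeta>) - chi \<zeta>) in \<phi> ((L / 2 ^ q) *\<^sub>R \<xi>))"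

definition freq_lattice :: "real \<Rightarrow> (real ^ 3) set" where
  "freq_lattice L = {k. \<forall>i. L * k $ i \<in> \<int>}"

definition fourier_coeff :: "real \<Rightarrow> (real ^ 3 \<Rightarrow> real ^ 3) \<Rightarrow> real ^ 3 \<Rightarrow> complex ^ 3" where
  "fourier_coeff L v k =
     (\<chi> i. complex_of_real (1 / L ^ 3) *
        (LINT x : torus L | lebesgue.
           complex_of_real (v x $ i) * exp (- 2 * pi * \<i> * complex_of_real (k \<bullet> x))))"

text \<open>The sum has only finitely many nonzero terms.  The block of a real field is real; it is kept
  in \<open>complex ^ 3\<close> as the Fourier series delivers it, and it is defined as an \<open>L\<close>-periodic
  function on all of \<open>real ^ 3\<close>.\<close>

definition lp_block ::
  "(real ^ 3 \<Rightarrow> real) \<Rightarrow> real \<Rightarrow> nat \<Rightarrow> (real ^ 3 \<Rightarrow> real ^ 3) \<Rightarrow> real ^ 3 \<Rightarrow> complex ^ 3" where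
  "lp_block chi L q v x =
     (\<Sum>\<^sub>\<infinity>k \<in> freq_lattice L.
        (complex_of_real (lp_symbol chi L q k) * exp (2 * pi * \<i> * complex_of_real (k \<bullet> x)))
          *s fourier_coeff L v k)"

definition lam :: "real \<Rightarrow> nat \<Rightarrow> real" where "lam L q = 2 ^ q / L"

definition ell :: "real \<Rightarrow> nat \<Rightarrow> real" where "ell L q = L / 2 ^ q"


section \<open>Atomic decomposition\<close>

definition mollifier :: "(real ^ 3 \<Rightarrow> real) \<Rightarrow> bool" where
  "mollifier \<eta> \<longleftrightarrow>
     smooth \<eta> \<and> (\<forall>y. 0 \<le> \<eta> y) \<and> (\<forall>y. norm y > 1 \<longrightarrow> \<eta> y = 0) \<and> (LINT y | lebesgue. \<eta> y) = 1"

text \<open>Dyadic cubes in the torus, defined for all \<open>k\<close> in \<open>int ^ 3\<close> and \<open>2^q\<close>-periodic in \<open>k\<close>.\<close>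

definition dcube :: "real \<Rightarrow> nat \<Rightarrow> int ^ 3 \<Rightarrow> (real ^ 3) set" where
  "dcube L q k =
     torus_proj L ` {x. \<forall>i. ell L q * of_int (k $ i) \<le> x $ i \<and> x $ i < ell L q * (of_int (k $ i) + 1)}"

definition dcube_star :: "real \<Rightarrow> nat \<Rightarrow> int ^ 3 \<Rightarrow> (real ^ 3) set" where
  "dcube_star L q k =
     (\<Union>k' \<in> {k' :: int ^ 3. norm ((\<chi> i. of_int (k' $ i - k $ i)) :: real ^ 3) < 3}. dcube L q k')"

definition cube_index :: "nat \<Rightarrow> (int ^ 3) set" where
  "cube_index q = {k. \<forall>i. 0 \<le> k $ i \<and> k $ i \<le> 2 ^ q - 1}"

text \<open>The characteristic function of the cube is extended periodically and convolved over the whole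
  space: for \<open>q = 0\<close> the kernel has radius \<open>L\<close> and need not fit into a single period.\<close>

definition cube_cutoff ::
  "(real ^ 3 \<Rightarrow> real) \<Rightarrow> real \<Rightarrow> nat \<Rightarrow> int ^ 3 \<Rightarrow> real ^ 3 \<Rightarrow> real" where
  "cube_cutoff \<eta> L q k x =
     1 / L ^ 3 * (LINT y | lebesgue.
        indicator (dcube L q k) (torus_proj L (x - y)) * (2 ^ (3 * q) * \<eta> (lam L q *\<^sub>R y)))"

definition atom_b ::
  "(real ^ 3 \<Rightarrow> real) \<Rightarrow> (real ^ 3 \<Rightarrow> real) \<Rightarrow> real \<Rightarrow> (real \<Rightarrow> real ^ 3 \<Rightarrow> real ^ 3) \<Rightarrow>
     nat \<Rightarrow> int ^ 3 \<Rightarrow> real \<Rightarrow> real ^ 3 \<Rightarrow> complex ^ 3" where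
  "atom_b chi \<eta> L u q k t x = cube_cutoff \<eta> L q k x *\<^sub>R lp_block chi L q (u t) x"

definition sup_norm :: "real \<Rightarrow> (real ^ 3 \<Rightarrow> 'b::real_normed_vector) \<Rightarrow> real" where
  "sup_norm L f = (SUP x \<in> torus L. norm (f x))"

definition atom_s ::
  "(real ^ 3 \<Rightarrow> real) \<Rightarrow> (real ^ 3 \<Rightarrow> real) \<Rightarrow> nat \<Rightarrow> real \<Rightarrow> (real \<Rightarrow> real ^ 3 \<Rightarrow> real ^ 3) \<Rightarrow>
     nat \<Rightarrow> int ^ 3 \<Rightarrow> real \<Rightarrow> real" where
  "atom_s chi \<eta> M L u q k t =
     Max ((\<lambda>\<beta>. sup_norm L (multi_deriv \<beta> (atom_b chi \<eta> L u q k t)) / lam L q ^ mi_order \<beta>)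
            ` {\<beta>. mi_order \<beta> \<le> M})"


section \<open>Active volumes, active regions and the intermittency dimension\<close>

definition L2_field :: "real \<Rightarrow> real \<Rightarrow> (real \<Rightarrow> real ^ 3 \<Rightarrow> real ^ 3) \<Rightarrow> bool" where
  "L2_field L T u \<longleftrightarrow>
     (\<lambda>(t, x). u t x) \<in> borel_measurable (lebesgue_on (Omega L T)) \<and>
     integrable (lebesgue_on (Omega L T)) (\<lambda>(t, x). (norm (u t x)) ^ 2)"

definition lp_norm_pow ::
  "(real ^ 3 \<Rightarrow> real) \<Rightarrow> real \<Rightarrow> (real \<Rightarrow> real ^ 3 \<Rightarrow> real ^ 3) \<Rightarrow> nat \<Rightarrow> nat \<Rightarrow>
     real \<times> (real ^ 3) \<Rightarrow> real" where
  "lp_norm_pow chi L u q p = (\<lambda>(t, x). (norm (lp_block chi L q (u t) x)) ^ p)"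

definition lp_vanishes ::
  "(real ^ 3 \<Rightarrow> real) \<Rightarrow> real \<Rightarrow> real \<Rightarrow> (real \<Rightarrow> real ^ 3 \<Rightarrow> real ^ 3) \<Rightarrow> nat \<Rightarrow> bool" where
  "lp_vanishes chi L T u q \<longleftrightarrow>
     (AE z in lebesgue_on (Omega L T). lp_block chi L q (u (fst z)) (snd z) = 0)"

definition active_volume ::
  "(real ^ 3 \<Rightarrow> real) \<Rightarrow> real \<Rightarrow> real \<Rightarrow> (real \<Rightarrow> real ^ 3 \<Rightarrow> real ^ 3) \<Rightarrow> nat \<Rightarrow> real" where
  "active_volume chi L T u q =
     (if lp_vanishes chi L T u q then 0
      else L ^ 3 * (avg L T (lp_norm_pow chi L u q 2)) ^ 3 / (avg L T (lp_norm_pow chi L u q 3)) ^ 2)"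

definition dim_q ::
  "(real ^ 3 \<Rightarrow> real) \<Rightarrow> real \<Rightarrow> real \<Rightarrow> (real \<Rightarrow> real ^ 3 \<Rightarrow> real ^ 3) \<Rightarrow> nat \<Rightarrow> ereal" where
  "dim_q chi L T u q =
     (if lp_vanishes chi L T u q then -\<infinity>
      else ereal (3 - log 2 (L ^ 3 / active_volume chi L T u q) / real q))"

text \<open>The value of \<open>dim_q\<close> at \<open>q = 0\<close> is irrelevant.\<close>

definition intermittency_dim ::
  "(real ^ 3 \<Rightarrow> real) \<Rightarrow> real \<Rightarrow> real \<Rightarrow> (real \<Rightarrow> real ^ 3 \<Rightarrow> real ^ 3) \<Rightarrow> ereal" where
  "intermittency_dim chi L T u = limsup (dim_q chi L T u)"

definition threshold_seq :: "(nat \<Rightarrow> real) \<Rightarrow> bool" where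
  "threshold_seq \<sigma> \<longleftrightarrow>
     (\<forall>q. 0 < \<sigma> q) \<and> decseq \<sigma> \<and> \<sigma> \<longlonglongrightarrow> 0 \<and> (\<lambda>q. ln (\<sigma> q) / real q) \<longlonglongrightarrow> 0"

definition active_slice ::
  "(real ^ 3 \<Rightarrow> real) \<Rightarrow> (real ^ 3 \<Rightarrow> real) \<Rightarrow> nat \<Rightarrow> real \<Rightarrow> real \<Rightarrow> (nat \<Rightarrow> real) \<Rightarrow>
     (real \<Rightarrow> real ^ 3 \<Rightarrow> real ^ 3) \<Rightarrow> nat \<Rightarrow> real \<Rightarrow> (real ^ 3) set" where
  "active_slice chi \<eta> M L T \<sigma> u q t =
     (if lp_vanishes chi L T u q then {}
      else \<Union> (dcube_star L q ` {k \<in> cube_index q.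
             \<bar>atom_s chi \<eta> M L u q k t\<bar> >
               \<sigma> q * avg L T (lp_norm_pow chi L u q 3) / avg L T (lp_norm_pow chi L u q 2)}))"

definition active_region ::
  "(real ^ 3 \<Rightarrow> real) \<Rightarrow> (real ^ 3 \<Rightarrow> real) \<Rightarrow> nat \<Rightarrow> real \<Rightarrow> real \<Rightarrow> (nat \<Rightarrow> real) \<Rightarrow>
     (real \<Rightarrow> real ^ 3 \<Rightarrow> real ^ 3) \<Rightarrow> nat \<Rightarrow> (real \<times> (real ^ 3)) set" where
  "active_region chi \<eta> M L T \<sigma> u q =
     {(t, x) \<in> Omega L T. x \<in> active_slice chi \<eta> M L T \<sigma> u q t}"

definition limsup_region ::
  "(real ^ 3 \<Rightarrow> real) \<Rightarrow> (real ^ 3 \<Rightarrow> real) \<Rightarrow> nat \<Rightarrow> real \<Rightarrow> real \<Rightarrow> (nat \<Rightarrow> real) \<Rightarrow>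
     (real \<Rightarrow> real ^ 3 \<Rightarrow> real ^ 3) \<Rightarrow> (real \<times> (real ^ 3)) set" where
  "limsup_region chi \<eta> M L T \<sigma> u = (\<Inter>p\<in>{1..}. \<Union>q\<in>{p<..}. active_region chi \<eta> M L T \<sigma> u q)"

definition limsup_slice ::
  "(real ^ 3 \<Rightarrow> real) \<Rightarrow> (real ^ 3 \<Rightarrow> real) \<Rightarrow> nat \<Rightarrow> real \<Rightarrow> real \<Rightarrow> (nat \<Rightarrow> real) \<Rightarrow>
     (real \<Rightarrow> real ^ 3 \<Rightarrow> real ^ 3) \<Rightarrow> real \<Rightarrow> (real ^ 3) set" where
  "limsup_slice chi \<eta> M L T \<sigma> u t =
     {x \<in> torus L. (t, x) \<in> limsup_region chi \<eta> M L T \<sigma> u}"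

end

theory Submission
  imports Defs
begin

text \<open>For fixed \<open>q\<close> write \<open>\<lambda> = 2^q / L\<close> and \<open>\<theta> = \<sigma>\<^sub>q \<langle>|u\<^sub>q|^3\<rangle> / \<langle>|u\<^sub>q|^2\<rangle>\<close>, so that a cube is
active at time \<open>t\<close> when its atom has size \<open>s\<^sub>q\<^sub>k(t) > \<theta>\<close>.  All three conclusions follow from one
inequality at a single time, \<open>sum_atom_size_cubes\<close>:

  \<open>\<Sum>\<^sub>k s\<^sub>q\<^sub>k(t)^3 \<le> C \<lambda>^3 \<integral> |u\<^sub>q(t,x)|^3 dx\<close>,  \<open>C\<close> absolute.

\<^item> \<^emph>\<open>Volume.\<close>  Chebyshev's inequality in \<open>t\<close> bounds the sum over \<open>k\<close> of the lengths of the sets of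
  active times by \<open>C \<lambda>^3 \<theta>^{-3} \<integral> |u\<^sub>q|^3\<close>.  The definition of \<open>\<theta>\<close> turns this into
  \<open>C \<lambda>^3 \<sigma>\<^sub>q^{-3} V\<^sub>q T\<close>, and each cube \<open>Q^*\<close> has volume at most a constant times \<open>\<lambda>^{-3}\<close>.

\<^item> \<^emph>\<open>Concentration.\<close>  The mollified cutoffs are a partition of unity of bounded overlap.  Off the
  active region every atom that is seen at \<open>x\<close> has size at most \<open>\<theta>\<close>, hence \<open>|u\<^sub>q| \<le> C \<theta>\<close> there, and
  \<open>\<integral> |u\<^sub>q|^3\<close> over the complement is at most \<open>C \<theta> \<integral> |u\<^sub>q|^2 = C \<sigma>\<^sub>q \<integral> |u\<^sub>q|^3\<close>.

\<^item> \<^emph>\<open>Dimension.\<close>  Let \<open>N\<^sub>q(t)\<close> be the number of active cubes and let \<open>s > s' > D\<close>.  For large \<open>q\<close> one has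
  \<open>V\<^sub>q \<le> L^3 2^{-q(3-s')}\<close>, so by the length bound \<open>\<integral> \<Sum>\<^sub>q N\<^sub>q(t) \<ell>\<^sub>q^s dt\<close> is dominated by
  \<open>\<Sum>\<^sub>q \<sigma>\<^sub>q^{-3} 2^{-q(s-s')}\<close> up to a constant; this converges because \<open>\<sigma>\<^sub>q\<close> decays subexponentially.
  For almost every \<open>t\<close> the tails of \<open>\<Sum>\<^sub>q N\<^sub>q(t) \<ell>\<^sub>q^s\<close> therefore tend to \<open>0\<close>, and since the active
  cubes of frequency beyond \<open>p\<close> cover the upper limit set, its \<open>s\<close>-dimensional measure vanishes.
  If \<open>D < 0\<close>, the choice \<open>s = 0\<close> makes \<open>\<Sum>\<^sub>q N\<^sub>q(t)\<close> a convergent series of integers: no cube is active for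
  large \<open>q\<close>, and the upper limit set is empty.

The inequality itself is a Bernstein and a Plancherel-Polya estimate for the block \<open>u\<^sub>q(t)\<close>, which is
a trigonometric polynomial of degree at most \<open>n = 2^{q+1}\<close> in each coordinate.  A discrete Fejer
kernel writes its partial derivatives as combinations of translates along a regular grid, with total
weight at most \<open>2n\<close> (\<open>discrete_derivative_weights\<close>).  The sum over all grid cells of the cube of the
supremum on the cell does not change under these translations, so it obeys a Bernstein inequality
(\<open>bernstein_cell_cubes\<close>).  On a fine grid the mean value theorem compares the supremum on a cell with
any single value, the gradient being absorbed with the help of that Bernstein inequality; averaging
over the cells gives \<open>cell_cubes_le_integral\<close>.  Derivatives of the cutoffs cost a factor \<open>\<lambda>\<close> each, and
the Leibniz rule combines the two.

Measurability in \<open>t\<close> is a matter of finite dimension: off a null set of times the Fourier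
coefficients agree with Borel functions of \<open>t\<close>, and the size of an atom is a Lipschitz function of
finitely many of them.\<close>

section \<open>Differentiation weights from a discrete Fejer kernel\<close>

text \<open>The characters of the cyclic group of order \<open>N\<close>.\<close>

definition root_char :: "nat \<Rightarrow> int \<Rightarrow> nat \<Rightarrow> complex" where
  "root_char N b m = cis (2 * pi * of_int b * real m / real N)"

lemma root_char_add: "root_char N (a + b) m = root_char N a m * root_char N b m"
  by (simp add: root_char_def cis_mult field_simps add_divide_distrib)

lemma cnj_root_char: "cnj (root_char N a m) = root_char N (- a) m"
  by (simp add: root_char_def cis_cnj)

lemma norm_root_char [simp]: "norm (root_char N a m) = 1"
  by (simp add: root_char_def)

lemma sum_root_char:
  assumes "\<bar>b\<bar> < int N"
  shows "(\<Sum>m<N. root_char N b m) = (if b = 0 then of_nat N else 0)"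
proof (cases "b = 0")
  case False
  have N: "N > 0" using assms by auto
  let ?z = "cis (2 * pi * of_int b / real N)"
  have pw: "root_char N b m = ?z ^ m" for m
    unfolding root_char_def Complex.DeMoivre by (rule arg_cong[where f = cis]) (simp add: mult_ac)
  have "?z \<noteq> 1"
  proof
    assume "?z = 1"
    then have "cos (2 * pi * of_int b / real N) = 1"
      by (simp add: complex_eq_iff)
    then obtain k :: int where "2 * pi * of_int b / real N = of_int k * 2 * pi"
      by (auto simp: cos_one_2pi_int)
    then have "real_of_int b = of_int k * real N" using N by (simp add: field_simps)
    then have "b = k * int N" by (metis of_int_eq_iff of_int_mult of_int_of_nat_eq)
    moreover from this have "k \<noteq> 0" using False by auto
    ultimately have "\<bar>b\<bar> \<ge> int N"
      using mult_right_mono[of 1 "\<bar>k\<bar>" "int N"] by (simp add: abs_mult)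
    then show False using assms by simp
  qed
  moreover have "?z ^ N = 1"
    using N cis_multiple_2pi[of "of_int b"] by (simp add: Complex.DeMoivre)
  ultimately show ?thesis
    using False by (simp add: pw geometric_sum)
qed (simp add: root_char_def)

text \<open>These are the coefficients of the unnormalised Fejer kernel.\<close>

lemma count_differences:
  fixes d :: int
  shows "(\<Sum>j<n. \<Sum>j'<n. if int j - int j' = d then 1 else (0::complex)) = of_int (max 0 (int n - \<bar>d\<bar>))"
proof -
  have "(\<Sum>j<n. \<Sum>j'<n. if int j - int j' = d then 1 else (0::complex))
      = (\<Sum>j<n. if 0 \<le> int j - d \<and> int j - d < int n then 1 else 0)"
  proof (rule sum.cong[OF refl])
    fix j
    have "(\<Sum>j'<n. if int j - int j' = d then 1 else (0::complex))
        = (\<Sum>j'<n. if j' = nat (int j - d) then (if 0 \<le> int j - d then 1 else 0) else 0)"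
      by (intro sum.cong) auto
    then show "(\<Sum>j'<n. if int j - int j' = d then 1 else (0::complex))
        = (if 0 \<le> int j - d \<and> int j - d < int n then 1 else 0)"
      by (auto simp: nat_less_iff)
  qed
  also have "\<dots> = of_nat (card {j. j < n \<and> 0 \<le> int j - d \<and> int j - d < int n})"
    by (simp add: sum.If_cases Int_def)
  also have "{j. j < n \<and> 0 \<le> int j - d \<and> int j - d < int n} = {nat (max 0 d)..<nat (min (int n) (int n + d))}"
    by auto
  also have "of_nat (card \<dots>) = (of_int (max 0 (int n - \<bar>d\<bar>)) :: complex)"
  proof -
    have "int (nat (min (int n) (int n + d)) - nat (max 0 d)) = max 0 (int n - \<bar>d\<bar>)" by linarith
    then show ?thesis by (metis card_atLeastLessThan of_int_of_nat_eq)
  qed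
  finally show ?thesis .
qed

text \<open>Differentiation of trigonometric polynomials of degree \<open>n\<close> is convolution with
\<open>i n (e^{inx} - e^{-inx}) F(x)\<close>, where \<open>F\<close> is the Fejer kernel of order \<open>n\<close>: the two modulations of the triangle
\<open>n - |a|\<close> differ exactly by \<open>a\<close> on \<open>[-n, n]\<close>.  Since \<open>F\<close> is nonnegative with mean one, the kernel has
norm at most \<open>2n\<close>.  The product of the kernel with a polynomial has frequencies below \<open>3n\<close>, so \<open>N > 3n\<close>
equidistant nodes replace the integral without error.\<close>

lemma discrete_derivative_weights:
  assumes N: "3 * n < N"
  obtains w :: "nat \<Rightarrow> complex"
  where "(\<Sum>m<N. norm (w m)) \<le> 2 * real n"
    and "\<And>a::int. \<bar>a\<bar> \<le> int n \<Longrightarrow> (\<Sum>m<N. w m * root_char N (- a) m) = \<i> * of_int a"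
proof
  have N0: "N > 0" using N by auto
  define G where "G m = (\<Sum>j<n. root_char N (int j) m)" for m
  \<comment> \<open>The modulated Fejer kernel at the nodes; the square of the modulus of \<open>G\<close> is \<open>n\<close> times the kernel.\<close>
  define w where "w m = \<i> / of_nat N * (root_char N (int n) m - root_char N (- int n) m) * (G m * cnj (G m))" for m
  have GG: "G m * cnj (G m) = (\<Sum>j<n. \<Sum>j'<n. root_char N (int j - int j') m)" for m
    by (simp add: G_def sum_product cnj_root_char flip: root_char_add)
  have "(\<Sum>m<N. G m * cnj (G m)) = (\<Sum>j<n. \<Sum>j'<n. \<Sum>m<N. root_char N (int j - int j') m)"
    by (simp add: GG sum.swap[of _ _ "{..<N}"])
  also have "\<dots> = (\<Sum>j<n. \<Sum>j'<n. if j = j' then of_nat N else 0)"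
    using N by (intro sum.cong refl, subst sum_root_char) auto
  also have "\<dots> = of_nat n * of_nat N" by simp
  finally have GGs: "(\<Sum>m<N. G m * cnj (G m)) = of_nat n * of_nat N" .
  have "(\<Sum>m<N. (norm (G m))\<^sup>2) = Re (\<Sum>m<N. G m * cnj (G m))"
    by (simp add: complex_mult_cnj cmod_power2 flip: complex_norm_square)
  then have Gs: "(\<Sum>m<N. (norm (G m))\<^sup>2) = real n * real N" unfolding GGs by simp
  have "norm (w m) \<le> 2 / real N * (norm (G m))\<^sup>2" for m
  proof -
    have "norm (root_char N (int n) m - root_char N (- int n) m) \<le> 2"
      using norm_triangle_ineq4[of "root_char N (int n) m" "root_char N (- int n) m"] by simp
    then show ?thesis
      by (simp add: w_def norm_mult norm_divide power2_eq_square divide_right_mono mult_right_mono)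
  qed
  then have "(\<Sum>m<N. norm (w m)) \<le> (\<Sum>m<N. 2 / real N * (norm (G m))\<^sup>2)" by (intro sum_mono)
  also have "\<dots> = 2 / real N * (real n * real N)" by (simp only: Gs flip: sum_distrib_left)
  also have "\<dots> = 2 * real n" using N0 by simp
  finally show "(\<Sum>m<N. norm (w m)) \<le> 2 * real n" .
  fix a :: int assume a: "\<bar>a\<bar> \<le> int n"
  let ?D = "\<lambda>j j' m. root_char N (int j - int j' + (int n - a)) m - root_char N (int j - int j' + (- int n - a)) m"
  have "w m * root_char N (- a) m = \<i> / of_nat N * (\<Sum>j<n. \<Sum>j'<n.
      ?D j j' m)" for m
  proof -
    have "w m * root_char N (- a) m = \<i> / of_nat N *
      ((\<Sum>j<n. \<Sum>j'<n. root_char N (int j - int j') m) * (root_char N (int n - a) m - root_char N (- int n - a) m))"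
      unfolding w_def GG diff_conv_add_uminus[of _ a] root_char_add by (simp add: algebra_simps)
    then show ?thesis
      by (simp add: sum_distrib_right right_diff_distrib sum_subtractf root_char_add)
  qed
  then have "(\<Sum>m<N. w m * root_char N (- a) m) = \<i> / of_nat N * (\<Sum>m<N. \<Sum>j<n. \<Sum>j'<n.
      ?D j j' m)"
    by (simp add: sum_distrib_left)
  also have "(\<Sum>m<N. \<Sum>j<n. \<Sum>j'<n.
      ?D j j' m)
    = (\<Sum>j<n. \<Sum>j'<n. \<Sum>m<N.
      ?D j j' m)"
    by (subst sum.swap, rule sum.cong[OF refl], subst sum.swap) simp
  also have "\<dots> = (\<Sum>j<n. \<Sum>j'<n. of_nat N * ((if int j - int j' = a - int n then 1 else 0)
      - (if int j - int j' = a + int n then 1 else 0)))"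
    using N a by (intro sum.cong refl, subst sum_subtractf, subst sum_root_char, force, subst sum_root_char) auto
  also have "\<dots> = of_nat N * (of_int (max 0 (int n - \<bar>a - int n\<bar>)) - of_int (max 0 (int n - \<bar>a + int n\<bar>)))"
    by (simp only: sum_subtractf count_differences flip: sum_distrib_left)
  also have "(of_int (max 0 (int n - \<bar>a - int n\<bar>)) - of_int (max 0 (int n - \<bar>a + int n\<bar>)) :: complex) = of_int a"
  proof -
    have "max 0 (int n - \<bar>a - int n\<bar>) - max 0 (int n - \<bar>a + int n\<bar>) = a" using a by linarith
    then show ?thesis by (metis of_int_diff)
  qed
  finally show "(\<Sum>m<N. w m * root_char N (- a) m) = \<i> * of_int a" using N0 by simp
qed

section \<open>Cubes of sums\<close>

text \<open>Jensen's inequality for \<open>r^3\<close> with unnormalised weights, obtained by summing the tangent line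
inequality at the mean \<open>y\<close>.\<close>

lemma weighted_cube_mean:
  fixes a b :: "'i \<Rightarrow> real"
  assumes "finite I" "\<And>i. i \<in> I \<Longrightarrow> 0 \<le> a i" "\<And>i. i \<in> I \<Longrightarrow> 0 \<le> b i"
  shows "(\<Sum>i\<in>I. a i * b i) ^ 3 \<le> (\<Sum>i\<in>I. a i)\<^sup>2 * (\<Sum>i\<in>I. a i * b i ^ 3)"
proof (cases "(\<Sum>i\<in>I. a i) = 0")
  case True
  then have "\<forall>i\<in>I. a i = 0" using assms by (simp add: sum_nonneg_eq_0_iff)
  then show ?thesis by simp
next
  case False
  define A where "A = (\<Sum>i\<in>I. a i)"
  define y where "y = (\<Sum>i\<in>I. a i * b i) / A"
  have A: "A > 0" using False assms(2) by (simp add: A_def less_le sum_nonneg)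
  have Ay: "(\<Sum>i\<in>I. a i * b i) = A * y" using A by (simp add: y_def)
  have y: "y \<ge> 0" unfolding y_def using A assms by (intro divide_nonneg_pos sum_nonneg mult_nonneg_nonneg) auto
  \<comment> \<open>The difference of the two sides is \<open>(r - y)^2 (r + 2 y)\<close>.\<close>
  have tangent: "3 * y\<^sup>2 * r - 2 * y ^ 3 \<le> r ^ 3" if "r \<ge> 0" for r :: real
  proof -
    have "r ^ 3 - (3 * y\<^sup>2 * r - 2 * y ^ 3) = (r - y)\<^sup>2 * (r + 2 * y)" by algebra
    then show ?thesis using y that by (smt (verit) mult_nonneg_nonneg zero_le_power2)
  qed
  have "A * y ^ 3 = 3 * y\<^sup>2 * (A * y) - 2 * y ^ 3 * A" by (simp add: power2_eq_square power3_eq_cube)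
  also have "\<dots> = (\<Sum>i\<in>I. a i * (3 * y\<^sup>2 * b i - 2 * y ^ 3))"
  proof -
    have "3 * y\<^sup>2 * (\<Sum>i\<in>I. a i * b i) - 2 * y ^ 3 * (\<Sum>i\<in>I. a i) = (\<Sum>i\<in>I. a i * (3 * y\<^sup>2 * b i - 2 * y ^ 3))"
      unfolding sum_distrib_left sum_subtractf[symmetric] by (intro sum.cong refl) (simp add: algebra_simps)
    then show ?thesis by (simp only: Ay A_def)
  qed
  also have "\<dots> \<le> (\<Sum>i\<in>I. a i * b i ^ 3)"
    using assms tangent by (intro sum_mono mult_left_mono) auto
  finally have "A\<^sup>2 * (A * y ^ 3) \<le> A\<^sup>2 * (\<Sum>i\<in>I. a i * b i ^ 3)" by (intro mult_left_mono) auto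
  then show ?thesis unfolding Ay A_def[symmetric] by (simp add: power2_eq_square power3_eq_cube algebra_simps)
qed

lemma cube_of_sum_of_four:
  fixes a b c d :: real
  assumes "0 \<le> a" "0 \<le> b" "0 \<le> c" "0 \<le> d"
  shows "(a + b + c + d) ^ 3 \<le> 16 * (a ^ 3 + b ^ 3 + c ^ 3 + d ^ 3)"
proof -
  have two: "(p + q) ^ 3 \<le> 4 * (p ^ 3 + q ^ 3)" if "0 \<le> p" "0 \<le> q" for p q :: real
  proof -
    have "4 * (p ^ 3 + q ^ 3) - (p + q) ^ 3 = 3 * (p + q) * (p - q)\<^sup>2" by algebra
    then show ?thesis using that by (smt (verit) mult_nonneg_nonneg zero_le_power2)
  qed
  show ?thesis using two[of "a + b" "c + d"] two[of a b] two[of c d] assms by (simp add: add.assoc)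
qed

section \<open>Half-open boxes and lattice boxes\<close>

definition half_box :: "real ^ 3 \<Rightarrow> real \<Rightarrow> (real ^ 3) set" where
  "half_box a l = {x. \<forall>i. a $ i \<le> x $ i \<and> x $ i < a $ i + l}"

lemma half_box_borel [measurable]: "half_box a l \<in> sets borel"
proof -
  have "half_box a l = (\<Inter>i. {x. a $ i \<le> x $ i} \<inter> {x. x $ i < a $ i + l})"
    by (auto simp: half_box_def)
  moreover have "{x :: real ^ 3. c \<le> x $ i} \<in> sets borel" "{x :: real ^ 3. x $ i < c} \<in> sets borel" for i c
    by (auto intro!: borel_closed borel_open closed_halfspace_component_ge_cart open_halfspace_component_lt_cart)
  ultimately show ?thesis by auto
qed

lemma emeasure_half_box:
  assumes "l \<ge> 0"
  shows "emeasure lborel (half_box a l) = ennreal (l ^ 3)"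
proof -
  define b where "b = (\<chi> i. a $ i + l :: real ^ 3)"
  have le: "a \<bullet> j \<le> b \<bullet> j" if "j \<in> Basis" for j
    using that assms by (auto simp: b_def Basis_vec_def inner_axis)
  have pr: "(\<Prod>j\<in>Basis. (b - a) \<bullet> j) = l ^ 3"
  proof -
    have "(\<Prod>j\<in>Basis. (b - a) \<bullet> j) = (\<Prod>j\<in>(Basis :: (real ^ 3) set). l)"
      by (intro prod.cong) (auto simp: b_def Basis_vec_def inner_axis)
    then show ?thesis by simp
  qed
  have "box a b \<subseteq> half_box a l" "half_box a l \<subseteq> cbox a b"
    by (auto simp: half_box_def b_def mem_box_cart less_eq_real_def)
  then have "emeasure lborel (box a b) \<le> emeasure lborel (half_box a l)"
    "emeasure lborel (half_box a l) \<le> emeasure lborel (cbox a b)"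
    by (auto intro!: emeasure_mono)
  then show ?thesis using le by (simp add: emeasure_lborel_box_eq emeasure_lborel_cbox_eq pr)
qed

lemma measure_half_box: "l \<ge> 0 \<Longrightarrow> measure lborel (half_box a l) = l ^ 3"
  by (simp add: measure_def emeasure_half_box)

lemma torus_eq_half_box: "torus L = half_box 0 L"
  by (auto simp: torus_def half_box_def)

lemma set_integrable_torus:
  assumes "continuous_on UNIV f"
  shows "set_integrable lborel (torus L) (f :: real ^ 3 \<Rightarrow> real)"
proof (rule set_integrable_subset)
  show "set_integrable lborel (cbox 0 (\<chi> i. L)) f"
    by (intro borel_integrable_compact[folded set_integrable_def] continuous_on_subset[OF assms]) auto
  show "torus L \<subseteq> cbox 0 (\<chi> i. L)" by (auto simp: torus_def mem_box_cart less_imp_le)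
qed (simp add: torus_eq_half_box)

definition index_box :: "nat \<Rightarrow> (int ^ 3) set" where
  "index_box N = {k. \<forall>i. 0 \<le> k $ i \<and> k $ i < int N}"

definition index_mod :: "nat \<Rightarrow> int ^ 3 \<Rightarrow> int ^ 3" where
  "index_mod N k = (\<chi> i. k $ i mod int N)"

lemma finite_vec_componentwise:
  assumes "finite A"
  shows "finite {k :: 'a ^ 'n :: finite. \<forall>i. k $ i \<in> A}"
proof -
  have "{k :: 'a ^ 'n. \<forall>i. k $ i \<in> A} \<subseteq> vec_lambda ` (UNIV \<rightarrow>\<^sub>E A)"
    by (auto intro!: image_eqI[where x = "vec_nth k" for k :: "'a ^ 'n"])
  moreover have "finite (vec_lambda ` (UNIV \<rightarrow>\<^sub>E A) :: ('a ^ 'n) set)"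
    using assms by (intro finite_imageI finite_PiE) auto
  ultimately show ?thesis by (rule finite_subset)
qed

lemma finite_index_box [simp]: "finite (index_box N)"
  using finite_vec_componentwise[of "{0..<int N}"] by (simp add: index_box_def)

lemma index_mod_in_box: "N > 0 \<Longrightarrow> index_mod N k \<in> index_box N"
  by (simp add: index_mod_def index_box_def)

text \<open>A shift permutes the residue classes modulo \<open>N\<close>, and \<open>f\<close> depends on these alone.\<close>

lemma sum_index_box_shift:
  fixes f :: "int ^ 3 \<Rightarrow> 'a :: comm_monoid_add"
  assumes N: "N > 0" and per: "\<And>k. f (index_mod N k) = f k"
  shows "(\<Sum>k\<in>index_box N. f (k + v)) = (\<Sum>k\<in>index_box N. f k)"
proof (rule sum.reindex_bij_witness[where j = "\<lambda>k. index_mod N (k + v)" and i = "\<lambda>k. index_mod N (k - v)"])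
  show "index_mod N (index_mod N (k + v) - v) = k" if "k \<in> index_box N" for k
    using that by (simp add: index_mod_def index_box_def vec_eq_iff mod_diff_left_eq)
  show "index_mod N (index_mod N (k - v) + v) = k" if "k \<in> index_box N" for k
    using that by (simp add: index_mod_def index_box_def vec_eq_iff mod_add_left_eq)
qed (use N per in \<open>auto simp: index_mod_in_box\<close>)

section \<open>Trigonometric polynomials on the torus\<close>

abbreviation int_vec :: "int ^ 3 \<Rightarrow> real ^ 3" where
  "int_vec m \<equiv> (\<chi> i. of_int (m $ i))"

text \<open>The frequencies of \<open>L\<close>-periodic trigonometric polynomials whose degree is at most \<open>n\<close> in each
coordinate.\<close>

definition torus_freqs :: "real \<Rightarrow> nat \<Rightarrow> (real ^ 3) set" where
  "torus_freqs L n = {k. \<forall>i. \<exists>a::int. L * k $ i = of_int a \<and> \<bar>a\<bar> \<le> int n}"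

definition trig_poly :: "(real ^ 3) set \<Rightarrow> (real ^ 3 \<Rightarrow> complex ^ 3) \<Rightarrow> real ^ 3 \<Rightarrow> complex ^ 3" where
  "trig_poly F c x = (\<Sum>k\<in>F. cis (2 * pi * (k \<bullet> x)) *s c k)"

definition deriv_coef :: "3 \<Rightarrow> (real ^ 3 \<Rightarrow> complex ^ 3) \<Rightarrow> real ^ 3 \<Rightarrow> complex ^ 3" where
  "deriv_coef i c k = (2 * pi * \<i> * of_real (k $ i)) *s c k"

lemma finite_torus_freqs:
  assumes "L > 0"
  shows "finite (torus_freqs L n)"
proof (rule finite_subset)
  show "torus_freqs L n \<subseteq> {k. \<forall>i. k $ i \<in> (\<lambda>a. of_int a / L) ` {- int n..int n}}"
  proof (safe)
    fix k i assume "k \<in> torus_freqs L n"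
    then obtain a where "L * k $ i = of_int a" "\<bar>a\<bar> \<le> int n" by (auto simp: torus_freqs_def)
    then show "k $ i \<in> (\<lambda>a. of_int a / L) ` {- int n..int n}"
      using assms by (intro image_eqI[of _ _ a]) (auto simp: field_simps)
  qed
qed (simp add: finite_vec_componentwise)

lemma norm_vector_scalar_mult:
  fixes v :: "complex ^ 3"
  shows "norm (a *s v) = norm a * norm v"
  by (simp add: norm_vec_def vector_scalar_mult_def norm_mult L2_set_right_distrib)

lemma bounded_linear_vector_scalar_mult:
  "bounded_linear (\<lambda>a. a *s (v :: complex ^ 3))"
proof (rule bounded_linear_intro[where K = "norm v"])
  show "(r *\<^sub>R x) *s v = r *\<^sub>R (x *s v)" for r x
    by (simp add: vec_eq_iff)
qed (simp_all add: norm_vector_scalar_mult vector_sadd_rdistrib)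

lemma scalar_mult_sum_left: "(\<Sum>i\<in>I. a i) *s (v :: complex ^ 3) = (\<Sum>i\<in>I. a i *s v)"
  by (simp add: vec_eq_iff sum_distrib_right)

lemma scalar_mult_sum_right: "a *s (\<Sum>i\<in>I. v i :: complex ^ 3) = (\<Sum>i\<in>I. a *s v i)"
  by (simp add: vec_eq_iff sum_distrib_left)

lemma cis_affine_derivative:
  "((\<lambda>s. cis (a + s * b)) has_vector_derivative (\<i> * of_real b * cis (a + s * b))) (at s within A)"
  by (auto simp: has_vector_derivative_def scaleR_conv_of_real algebra_simps intro!: derivative_eq_intros)

lemma trig_poly_directional_derivative:
  "((\<lambda>s. trig_poly F c (x + s *\<^sub>R v)) has_vector_derivative
     (\<Sum>i\<in>UNIV. v $ i *\<^sub>R trig_poly F (deriv_coef i c) (x + s *\<^sub>R v))) (at s within A)"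
proof -
  have 1: "((\<lambda>s. cis (2 * pi * (k \<bullet> (x + s *\<^sub>R v))) *s c k) has_vector_derivative
    (2 * pi * \<i> * (k \<bullet> v) * cis (2 * pi * (k \<bullet> (x + s *\<^sub>R v)))) *s c k) (at s within A)" for k
  proof -
    have "2 * pi * (k \<bullet> (x + s *\<^sub>R v)) = 2 * pi * (k \<bullet> x) + s * (2 * pi * (k \<bullet> v))" for s
      by (simp add: inner_add_right algebra_simps)
    then have "((\<lambda>s. cis (2 * pi * (k \<bullet> (x + s *\<^sub>R v)))) has_vector_derivative
      (2 * pi * \<i> * (k \<bullet> v) * cis (2 * pi * (k \<bullet> (x + s *\<^sub>R v))))) (at s within A)"
      using cis_affine_derivative[of "2 * pi * (k \<bullet> x)" "2 * pi * (k \<bullet> v)" s A] by (simp add: mult_ac)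
    then show ?thesis
      by (rule bounded_linear.has_vector_derivative[OF bounded_linear_vector_scalar_mult])
  qed
  have "(2 * pi * \<i> * (k \<bullet> v) * cis (2 * pi * (k \<bullet> y))) *s c k
      = (\<Sum>i\<in>UNIV. v $ i *\<^sub>R (cis (2 * pi * (k \<bullet> y)) *s deriv_coef i c k))" for k y
    by (simp add: vec_eq_iff deriv_coef_def inner_vec_def scaleR_conv_of_real[where 'a=complex] sum_distrib_left sum_distrib_right mult_ac)
  then have "(\<Sum>i\<in>UNIV. v $ i *\<^sub>R trig_poly F (deriv_coef i c) (x + s *\<^sub>R v))
     = (\<Sum>k\<in>F. (2 * pi * \<i> * (k \<bullet> v) * cis (2 * pi * (k \<bullet> (x + s *\<^sub>R v)))) *s c k)"
    unfolding trig_poly_def by (simp add: scaleR_right.sum sum.swap[of _ F])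
  moreover have "((\<lambda>s. trig_poly F c (x + s *\<^sub>R v)) has_vector_derivative
     (\<Sum>k\<in>F. (2 * pi * \<i> * (k \<bullet> v) * cis (2 * pi * (k \<bullet> (x + s *\<^sub>R v)))) *s c k)) (at s within A)"
    unfolding trig_poly_def by (rule has_vector_derivative_sum[OF 1])
  ultimately show ?thesis by simp
qed

lemma trig_poly_has_partial_deriv:
  "((\<lambda>h. trig_poly F c (x + h *\<^sub>R axis i 1)) has_vector_derivative trig_poly F (deriv_coef i c) x) (at 0)"
proof -
  have "(\<Sum>j\<in>UNIV. (axis i 1 :: real ^ 3) $ j *\<^sub>R trig_poly F (deriv_coef j c) y) = trig_poly F (deriv_coef i c) y" for y
    by (simp add: axis_def if_distrib[of "\<lambda>r. r *\<^sub>R _"] cong: if_cong)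
  then show ?thesis
    using trig_poly_directional_derivative[of F c x "axis i 1" 0 UNIV] by simp
qed

lemma partial_deriv_trig_poly: "partial_deriv i (trig_poly F c) = trig_poly F (deriv_coef i c)"
  using trig_poly_has_partial_deriv by (auto simp: partial_deriv_def fun_eq_iff intro!: vector_derivative_at)

lemma foldr_partial_deriv_trig_poly:
  "foldr partial_deriv is (trig_poly F c) = trig_poly F (foldr deriv_coef is c)"
  by (induction "is") (simp_all add: partial_deriv_trig_poly)

lemma continuous_on_trig_poly [continuous_intros]: "continuous_on A (trig_poly F c)"
proof -
  have "continuous_on A (\<lambda>x. cis (2 * pi * (k \<bullet> x)) *s c k)" for k
    by (rule bounded_linear.continuous_on[OF bounded_linear_vector_scalar_mult])
       (auto intro!: continuous_intros simp: cis_conv_exp)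
  then show ?thesis unfolding trig_poly_def by (intro continuous_on_sum)
qed

lemma trig_poly_translate_grid:
  assumes L: "L > 0" and N: "N > 0" and k: "k \<in> torus_freqs L n" "L * k $ i = of_int a"
  shows "cis (2 * pi * (k \<bullet> (x - (L * real m / real N) *\<^sub>R axis i 1))) = cis (2 * pi * (k \<bullet> x)) * root_char N (- a) m"
proof -
  have "k \<bullet> (x - (L * real m / real N) *\<^sub>R axis i 1) = k \<bullet> x - of_int a * m / N"
    using N by (simp add: inner_diff_right cart_eq_inner_axis[symmetric] k(2)[symmetric])
  then show ?thesis by (simp only:) (simp add: root_char_def cis_mult algebra_simps)
qed

lemma trig_poly_periodic:
  assumes L: "L > 0" and F: "F \<subseteq> torus_freqs L n"
  shows "trig_poly F c (x + L *\<^sub>R int_vec m) = trig_poly F c x"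
proof -
  have "cis (2 * pi * (k \<bullet> (x + L *\<^sub>R int_vec m))) = cis (2 * pi * (k \<bullet> x))" if "k \<in> F" for k
  proof -
    have "\<forall>i. \<exists>a::int. L * k $ i = of_int a" using that F by (auto simp: torus_freqs_def)
    then obtain a :: "3 \<Rightarrow> int" where a: "\<And>i. L * k $ i = of_int (a i)" by metis
    have "L * (k \<bullet> int_vec m) = (\<Sum>i\<in>UNIV. (L * k $ i) * of_int (m $ i))"
      by (simp add: inner_vec_def sum_distrib_left mult_ac)
    also have "\<dots> = of_int (\<Sum>i\<in>UNIV. a i * m $ i)" by (simp add: a)
    finally have "2 * pi * (k \<bullet> (x + L *\<^sub>R int_vec m)) = 2 * pi * (k \<bullet> x) + 2 * pi * of_int (\<Sum>i\<in>UNIV. a i * m $ i)"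
      by (simp add: inner_add_right distrib_left)
    then show ?thesis by (simp only: cis_mult[symmetric] cis_multiple_2pi[OF Ints_of_int] mult_1_right)
  qed
  then show ?thesis by (simp add: trig_poly_def cong: sum.cong)
qed

section \<open>Bernstein inequality for suprema over grid cells\<close>

text \<open>The grid of mesh \<open>L / N\<close>; the last argument is the position inside the cell \<open>g\<close>, measured in units
of the mesh.\<close>

definition cell_point :: "real \<Rightarrow> nat \<Rightarrow> int ^ 3 \<Rightarrow> real ^ 3 \<Rightarrow> real ^ 3" where
  "cell_point L N g h = (L / real N) *\<^sub>R (int_vec g + h)"

definition cell_sup :: "real \<Rightarrow> nat \<Rightarrow> (real ^ 3 \<Rightarrow> complex ^ 3) \<Rightarrow> int ^ 3 \<Rightarrow> real" where
  "cell_sup L N f g = (SUP h\<in>cbox 0 1. norm (f (cell_point L N g h)))"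

lemma cell_sup_upper:
  assumes "continuous_on UNIV f" "h \<in> cbox 0 1"
  shows "norm (f (cell_point L N g h)) \<le> cell_sup L N f g"
proof -
  have "continuous_on (cbox 0 1) (\<lambda>h. norm (f (cell_point L N g h)))"
    unfolding cell_point_def by (intro continuous_intros continuous_on_compose2[OF assms(1)]) auto
  then have "compact ((\<lambda>h. norm (f (cell_point L N g h))) ` cbox 0 1)"
    by (intro compact_continuous_image) auto
  then show ?thesis
    unfolding cell_sup_def using assms by (intro cSUP_upper bounded_imp_bdd_above compact_imp_bounded) auto
qed

lemma unit_cube_nonempty: "(0 :: real ^ 3) \<in> cbox 0 1"
  by (simp add: mem_box_cart)

lemma cell_sup_least:
  assumes "\<And>h. h \<in> cbox 0 1 \<Longrightarrow> norm (f (cell_point L N g h)) \<le> B"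
  shows "cell_sup L N f g \<le> B"
  unfolding cell_sup_def using assms unit_cube_nonempty by (intro cSUP_least) auto

lemma cell_sup_nonneg: "continuous_on UNIV f \<Longrightarrow> 0 \<le> cell_sup L N f g"
  using cell_sup_upper[OF _ unit_cube_nonempty] norm_ge_zero order_trans by blast

lemma cell_sup_periodic:
  assumes "L > 0" "N > 0" "F \<subseteq> torus_freqs L n"
  shows "cell_sup L N (trig_poly F c) (index_mod N g) = cell_sup L N (trig_poly F c) g"
proof -
  have "trig_poly F c (cell_point L N g h) = trig_poly F c (cell_point L N (index_mod N g) h)" for h
  proof -
    have "real_of_int (g $ i) = of_int (g $ i mod int N) + real N * of_int (g $ i div int N)" for i
      by (metis mod_mult_div_eq of_int_add of_int_mult of_int_of_nat_eq)
    then have "cell_point L N g h = cell_point L N (index_mod N g) h + L *\<^sub>R (\<chi> i. of_int ((\<chi> i. g $ i div int N) $ i))"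
      using assms(1,2) by (simp add: vec_eq_iff cell_point_def index_mod_def field_simps)
    then show ?thesis by (simp only: trig_poly_periodic[OF assms(1,3)])
  qed
  then show ?thesis by (simp add: cell_sup_def)
qed

text \<open>A discrete substitute for \<open>(N / L)^3 \<integral> |f|^3\<close> that controls suprema and is exactly invariant under
translations of periodic functions along the grid.\<close>

definition cell_cubes :: "real \<Rightarrow> nat \<Rightarrow> (real ^ 3 \<Rightarrow> complex ^ 3) \<Rightarrow> real" where
  "cell_cubes L N f = (\<Sum>g\<in>index_box N. cell_sup L N f g ^ 3)"

text \<open>The derivative is a combination of grid translates of total weight at most \<open>4 \<pi> n / L\<close>.  Each translate
permutes the cells of the torus, so convexity of the cube gives the claim.\<close>

lemma bernstein_cell_cubes:
  assumes L: "L > 0" and N: "3 * n < N" and F: "F \<subseteq> torus_freqs L n"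
  shows "cell_cubes L N (trig_poly F (deriv_coef i c)) \<le> (4 * pi * real n / L) ^ 3 * cell_cubes L N (trig_poly F c)"
proof -
  have N0: "N > 0" using N by auto
  obtain w where w: "(\<Sum>m<N. norm (w m)) \<le> 2 * real n"
    "\<And>a::int. \<bar>a\<bar> \<le> int n \<Longrightarrow> (\<Sum>m<N. w m * root_char N (- a) m) = \<i> * of_int a"
    using discrete_derivative_weights[OF N] by blast
  let ?P = "trig_poly F c"
  let ?S = "cell_sup L N ?P"
  define sh where "sh m = (- (axis i (int m)) :: int ^ 3)" for m
  \<comment> \<open>Translations act diagonally on frequencies, so the identity for the weights applies termwise.\<close>
  have repr: "trig_poly F (deriv_coef i c) x = (\<Sum>m<N. (of_real (2 * pi / L) * w m) *s ?P (x - (L * real m / real N) *\<^sub>R axis i 1))" for x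
  proof -
    have "cis (2 * pi * (k \<bullet> x)) *s deriv_coef i c k
        = (\<Sum>m<N. (of_real (2 * pi / L) * w m * cis (2 * pi * (k \<bullet> (x - (L * real m / real N) *\<^sub>R axis i 1)))) *s c k)" if k: "k \<in> F" for k
    proof -
      obtain a :: int where a: "L * k $ i = of_int a" "\<bar>a\<bar> \<le> int n" using k F by (auto simp: torus_freqs_def)
      have "(\<Sum>m<N. of_real (2 * pi / L) * w m * cis (2 * pi * (k \<bullet> (x - (L * real m / real N) *\<^sub>R axis i 1))))
          = of_real (2 * pi / L) * cis (2 * pi * (k \<bullet> x)) * (\<Sum>m<N. w m * root_char N (- a) m)"
        unfolding trig_poly_translate_grid[OF L N0 subsetD[OF F k] a(1)] sum_distrib_left by (simp add: mult_ac)
      also have "\<dots> = cis (2 * pi * (k \<bullet> x)) * (2 * pi * \<i> * of_real (k $ i))"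
      proof -
        have "k $ i = of_int a / L" using a(1) L by (simp add: field_simps)
        then show ?thesis using w(2)[OF a(2)] L by simp
      qed
      finally show ?thesis
        by (simp add: deriv_coef_def flip: scalar_mult_sum_left)
    qed
    then have "trig_poly F (deriv_coef i c) x = (\<Sum>k\<in>F. \<Sum>m<N. (of_real (2 * pi / L) * w m * cis (2 * pi * (k \<bullet> (x - (L * real m / real N) *\<^sub>R axis i 1)))) *s c k)"
      unfolding trig_poly_def by (rule sum.cong[OF refl])
    also have "\<dots> = (\<Sum>m<N. (of_real (2 * pi / L) * w m) *s ?P (x - (L * real m / real N) *\<^sub>R axis i 1))"
      unfolding trig_poly_def scalar_mult_sum_right by (subst sum.swap) (simp add: vec_eq_iff mult_ac)
    finally show ?thesis .
  qed
  have ptw: "cell_sup L N (trig_poly F (deriv_coef i c)) g \<le> (\<Sum>m<N. (2 * pi / L * norm (w m)) * ?S (g + sh m))" for g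
  proof (rule cell_sup_least)
    fix h :: "real ^ 3" assume h: "h \<in> cbox 0 1"
    have "cell_point L N g h - (L * real m / real N) *\<^sub>R axis i 1 = cell_point L N (g + sh m) h" for m
      using N0 by (simp add: cell_point_def sh_def vec_eq_iff axis_def field_simps)
    then have "norm (trig_poly F (deriv_coef i c) (cell_point L N g h))
        \<le> (\<Sum>m<N. norm ((of_real (2 * pi / L) * w m) *s ?P (cell_point L N (g + sh m) h)))"
      unfolding repr by (simp only: norm_sum)
    also have "\<dots> \<le> (\<Sum>m<N. (2 * pi / L * norm (w m)) * ?S (g + sh m))"
      unfolding norm_vector_scalar_mult norm_mult using L h
      by (intro sum_mono mult_mono cell_sup_upper continuous_on_trig_poly) (auto simp: norm_divide norm_mult)
    finally show "norm (trig_poly F (deriv_coef i c) (cell_point L N g h)) \<le> (\<Sum>m<N. (2 * pi / L * norm (w m)) * ?S (g + sh m))" .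
  qed
  define a where "a m = 2 * pi / L * norm (w m)" for m
  have a0: "a m \<ge> 0" for m using L by (simp add: a_def)
  have S0: "?S g \<ge> 0" for g by (intro cell_sup_nonneg continuous_on_trig_poly)
  have as: "(\<Sum>m<N. a m) \<le> 4 * pi * real n / L"
    using mult_left_mono[OF w(1), of "2 * pi / L"] L unfolding a_def sum_distrib_left[symmetric] by (simp add: mult_ac)
  have "cell_sup L N (trig_poly F (deriv_coef i c)) g ^ 3 \<le> (\<Sum>m<N. a m)\<^sup>2 * (\<Sum>m<N. a m * ?S (g + sh m) ^ 3)" for g
  proof -
    have "cell_sup L N (trig_poly F (deriv_coef i c)) g ^ 3 \<le> (\<Sum>m<N. a m * ?S (g + sh m)) ^ 3"
      using ptw by (intro power_mono cell_sup_nonneg continuous_on_trig_poly) (simp add: a_def)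
    also have "\<dots> \<le> (\<Sum>m<N. a m)\<^sup>2 * (\<Sum>m<N. a m * ?S (g + sh m) ^ 3)"
      by (rule weighted_cube_mean) (auto simp: a0 S0)
    finally show ?thesis .
  qed
  then have "cell_cubes L N (trig_poly F (deriv_coef i c)) \<le> (\<Sum>g\<in>index_box N. (\<Sum>m<N. a m)\<^sup>2 * (\<Sum>m<N. a m * ?S (g + sh m) ^ 3))"
    unfolding cell_cubes_def by (intro sum_mono)
  also have "\<dots> = (\<Sum>m<N. a m)\<^sup>2 * (\<Sum>m<N. a m * (\<Sum>g\<in>index_box N. ?S (g + sh m) ^ 3))"
    by (simp add: sum_distrib_left sum.swap[of _ "index_box N"])
  also have "\<dots> = (\<Sum>m<N. a m) ^ 3 * cell_cubes L N ?P"
    by (subst sum_index_box_shift[OF N0])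
       (simp_all add: cell_sup_periodic[OF L N0 F] cell_cubes_def power2_eq_square power3_eq_cube flip: sum_distrib_right)
  also have "\<dots> \<le> (4 * pi * real n / L) ^ 3 * cell_cubes L N ?P"
    using as a0 S0 by (intro mult_right_mono power_mono sum_nonneg) (auto simp: cell_cubes_def intro!: sum_nonneg)
  finally show ?thesis .
qed

lemma bernstein_cell_cubes_iterated:
  assumes "L > 0" "3 * n < N" "F \<subseteq> torus_freqs L n"
  shows "cell_cubes L N (trig_poly F (foldr deriv_coef is c))
    \<le> (4 * pi * real n / L) ^ (3 * length is) * cell_cubes L N (trig_poly F c)"
proof (induction "is")
  case (Cons i "is")
  have "cell_cubes L N (trig_poly F (foldr deriv_coef (i # is) c))
    \<le> (4 * pi * real n / L) ^ 3 * cell_cubes L N (trig_poly F (foldr deriv_coef is c))"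
    using bernstein_cell_cubes[OF assms] by simp
  also have "\<dots> \<le> (4 * pi * real n / L) ^ 3 * ((4 * pi * real n / L) ^ (3 * length is) * cell_cubes L N (trig_poly F c))"
    using assms(1) by (intro mult_left_mono Cons.IH) auto
  finally show ?case by (simp add: power_add mult_ac)
qed simp

section \<open>A Plancherel-Polya inequality\<close>

abbreviation "cubes_integral L f \<equiv> (LINT x : torus L | lborel. norm (f x) ^ 3)"

lemma floor_cell:
  assumes "L > 0" "N > 0"
  shows "x \<in> half_box (cell_point L N g 0) (L / real N) \<longleftrightarrow> (\<forall>i. \<lfloor>x $ i * real N / L\<rfloor> = g $ i)"
  using assms by (simp add: half_box_def cell_point_def floor_eq_iff field_simps)

lemma half_box_cell_point:
  assumes "L > 0" "N > 0" "x \<in> half_box (cell_point L N g 0) (L / real N)"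
  obtains h where "h \<in> cbox 0 1" "x = cell_point L N g h"
proof
  show "x = cell_point L N g ((real N / L) *\<^sub>R x - int_vec g)"
    using assms(1,2) by (simp add: cell_point_def vec_eq_iff)
  show "(real N / L) *\<^sub>R x - int_vec g \<in> cbox 0 1"
    using assms by (auto simp: mem_box_cart half_box_def cell_point_def field_simps less_imp_le)
qed

lemma vector_derivative_bound_real:
  fixes f :: "real \<Rightarrow> 'a :: real_normed_vector"
  assumes "\<And>s. s \<in> closed_segment a b \<Longrightarrow> (f has_vector_derivative f' s) (at s within closed_segment a b)"
    and "\<And>s. s \<in> closed_segment a b \<Longrightarrow> norm (f' s) \<le> B"
  shows "norm (f b - f a) \<le> B * norm (b - a)"
proof (rule differentiable_bound[of "closed_segment a b" f "\<lambda>s h. h *\<^sub>R f' s"])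
  show "onorm (\<lambda>h. h *\<^sub>R f' s) \<le> B" if "s \<in> closed_segment a b" for s
    using assms(2)[OF that] by (intro onorm_le) (simp add: mult.commute[of B] mult_left_mono)
qed (use assms(1) in \<open>auto simp: has_vector_derivative_def\<close>)

text \<open>The mean value theorem along the segment between two points of the cell, whose coordinates differ
by at most one mesh width.\<close>

lemma cell_sup_le_value:
  assumes L: "L > 0" and N: "N > 0" and h: "h \<in> cbox 0 1"
  shows "cell_sup L N (trig_poly F c) g
    \<le> norm (trig_poly F c (cell_point L N g h)) + L / real N * (\<Sum>i\<in>UNIV. cell_sup L N (trig_poly F (deriv_coef i c)) g)"
proof (rule cell_sup_least)
  fix h' :: "real ^ 3" assume h': "h' \<in> cbox 0 1"
  let ?x = "cell_point L N g h" and ?v = "cell_point L N g h' - cell_point L N g h"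
  let ?B = "L / real N * (\<Sum>i\<in>UNIV. cell_sup L N (trig_poly F (deriv_coef i c)) g)"
  have v: "\<bar>?v $ i\<bar> \<le> L / real N" for i
  proof -
    have "?v $ i = L / real N * (h' $ i - h $ i)" by (simp add: cell_point_def algebra_simps)
    moreover have "\<bar>h' $ i - h $ i\<bar> \<le> 1" using h h' unfolding mem_box_cart zero_index one_index by (smt (verit))
    ultimately show ?thesis using L mult_left_mono[of "\<bar>h' $ i - h $ i\<bar>" 1 "L / real N"] by (simp add: abs_mult)
  qed
  have "norm (trig_poly F c (?x + 1 *\<^sub>R ?v) - trig_poly F c (?x + 0 *\<^sub>R ?v)) \<le> ?B * norm (1 - 0 :: real)"
  proof (rule vector_derivative_bound_real[OF trig_poly_directional_derivative])
    fix s :: real assume "s \<in> closed_segment 0 1"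
    then have s: "0 \<le> s" "s \<le> 1" by (auto simp: closed_segment_eq_real_ivl)
    have eq: "?x + s *\<^sub>R ?v = cell_point L N g ((1 - s) *\<^sub>R h + s *\<^sub>R h')"
      by (simp add: cell_point_def algebra_simps)
    have in_cube: "(1 - s) *\<^sub>R h + s *\<^sub>R h' \<in> cbox 0 1"
      using convexD_alt[OF convex_box(1) h h' s] .
    have "norm (\<Sum>i\<in>UNIV. ?v $ i *\<^sub>R trig_poly F (deriv_coef i c) (?x + s *\<^sub>R ?v))
        \<le> (\<Sum>i\<in>UNIV. \<bar>?v $ i\<bar> * norm (trig_poly F (deriv_coef i c) (?x + s *\<^sub>R ?v)))"
      by (rule order_trans[OF norm_sum]) simp
    also have "\<dots> \<le> (\<Sum>i\<in>UNIV. L / real N * cell_sup L N (trig_poly F (deriv_coef i c)) g)"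
      unfolding eq using v L in_cube
      by (intro sum_mono mult_mono cell_sup_upper continuous_on_trig_poly) auto
    finally show "norm (\<Sum>i\<in>UNIV. ?v $ i *\<^sub>R trig_poly F (deriv_coef i c) (?x + s *\<^sub>R ?v)) \<le> ?B"
      by (simp add: sum_distrib_left)
  qed
  then have "norm (trig_poly F c (cell_point L N g h') - trig_poly F c ?x) \<le> ?B" by simp
  then show "norm (trig_poly F c (cell_point L N g h')) \<le> norm (trig_poly F c ?x) + ?B"
    by (smt (verit) norm_triangle_sub)
qed

text \<open>By the mean value theorem, \<open>sup |P|^3\<close> on a cell is at most \<open>16 |P(x)|^3\<close> plus a gradient term.
Averaging over \<open>x\<close> in the cell and summing over all cells leaves the gradient term, which the Bernstein
inequality bounds by half of the left-hand side once the mesh is fine compared with the wave length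
\<open>L / n\<close>.\<close>

theorem cell_cubes_le_integral:
  assumes L: "L > 0" and n: "n > 0" and N: "128 * n \<le> N" and F: "F \<subseteq> torus_freqs L n"
  shows "(L / real N) ^ 3 * cell_cubes L N (trig_poly F c)
    \<le> 32 * cubes_integral L (trig_poly F c)"
proof -
  have N0: "N > 0" using n N by auto
  define d where "d = L / real N"
  have d: "d > 0" using L N0 by (simp add: d_def)
  let ?P = "trig_poly F c"
  let ?S = "\<lambda>g. cell_sup L N ?P g"
  let ?D = "\<lambda>i g. cell_sup L N (trig_poly F (deriv_coef i c)) g"
  let ?H = "\<lambda>g. half_box (cell_point L N g 0) d"
  \<comment> \<open>The part of \<open>sup |P|^3\<close> that the mean value theorem bounds by any single value on the cell.\<close>
  define A where "A g = ?S g ^ 3 - 16 * d ^ 3 * (\<Sum>i\<in>UNIV. ?D i g ^ 3)" for g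
  have nonneg: "0 \<le> ?S g" "0 \<le> ?D i g" for g i
    by (intro cell_sup_nonneg continuous_on_trig_poly)+
  have cell: "A g \<le> 16 * norm (?P x) ^ 3" if x: "x \<in> ?H g" for g x
  proof -
    obtain h where h: "h \<in> cbox 0 1" "x = cell_point L N g h"
      using half_box_cell_point[OF L N0] x unfolding d_def by blast
    have "?S g \<le> norm (?P x) + d * (\<Sum>i\<in>UNIV. ?D i g)"
      unfolding h(2) d_def using cell_sup_le_value[OF L N0 h(1)] .
    then have "?S g \<le> norm (?P x) + d * ?D 1 g + d * ?D 2 g + d * ?D 3 g"
      by (simp add: sum_3 distrib_left)
    then have "?S g ^ 3 \<le> (norm (?P x) + d * ?D 1 g + d * ?D 2 g + d * ?D 3 g) ^ 3"
      using nonneg by (intro power_mono)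
    also have "\<dots> \<le> 16 * (norm (?P x) ^ 3 + (d * ?D 1 g) ^ 3 + (d * ?D 2 g) ^ 3 + (d * ?D 3 g) ^ 3)"
      using d nonneg by (intro cube_of_sum_of_four mult_nonneg_nonneg) auto
    finally show ?thesis
      by (simp add: A_def sum_3 power_mult_distrib algebra_simps)
  qed
  have cont: "continuous_on UNIV (\<lambda>x. norm (?P x) ^ 3)"
    by (intro continuous_intros)
  have int: "set_integrable lborel (torus L) (\<lambda>x. norm (?P x) ^ 3)"
    using cont by (rule set_integrable_torus)
  have fin: "emeasure lborel (?H g) < \<infinity>" for g using d by (simp add: emeasure_half_box)
  have "(\<Sum>g\<in>index_box N. d ^ 3 * A g) = (\<Sum>g\<in>index_box N. (LINT x | lborel. indicator (?H g) x * A g))"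
    using d by (simp add: measure_half_box)
  also have "\<dots> = (LINT x | lborel. (\<Sum>g\<in>index_box N. indicator (?H g) x * A g))"
    using fin by (subst Bochner_Integration.integral_sum) auto
  also have "\<dots> \<le> (LINT x | lborel. 16 * (indicator (torus L) x * norm (?P x) ^ 3))"
  proof (rule integral_mono)
    show "integrable lborel (\<lambda>x. \<Sum>g\<in>index_box N. indicator (?H g) x * A g)"
      using fin by (intro Bochner_Integration.integrable_sum integrable_mult_left integrable_real_indicator) auto
    show "integrable lborel (\<lambda>x. 16 * (indicator (torus L) x * norm (?P x) ^ 3))"
      using int by (auto simp: set_integrable_def)
    fix x
    let ?g = "(\<chi> i. \<lfloor>x $ i * real N / L\<rfloor>) :: int ^ 3"
    have mem: "x \<in> ?H g \<longleftrightarrow> g = ?g" for g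
      unfolding d_def floor_cell[OF L N0] by (auto simp: vec_eq_iff)
    have "?g \<in> index_box N \<longleftrightarrow> x \<in> torus L"
      using L N0 by (auto simp: index_box_def torus_def floor_less_iff zero_le_divide_iff zero_le_mult_iff field_simps)
    then have "(\<Sum>g\<in>index_box N. indicator (?H g) x * A g) = indicator (torus L) x * A ?g"
      by (simp add: indicator_def mem if_distrib[of "\<lambda>r. r * _"] cong: if_cong)
    also have "\<dots> \<le> indicator (torus L) x * (16 * norm (?P x) ^ 3)"
      using cell[of x ?g] mem by (intro mult_left_mono) auto
    finally show "(\<Sum>g\<in>index_box N. indicator (?H g) x * A g) \<le> 16 * (indicator (torus L) x * norm (?P x) ^ 3)"
      by (simp add: mult_ac)
  qed
  finally have 1: "d ^ 3 * (\<Sum>g\<in>index_box N. A g) \<le> 16 * cubes_integral L ?P"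
    by (simp add: sum_distrib_left set_lebesgue_integral_def)
  have "16 * d ^ 3 * (\<Sum>g\<in>index_box N. \<Sum>i\<in>UNIV. ?D i g ^ 3)
      = 16 * d ^ 3 * (\<Sum>i\<in>UNIV. cell_cubes L N (trig_poly F (deriv_coef i c)))"
    unfolding cell_cubes_def by (subst sum.swap) simp
  also have "\<dots> \<le> 16 * d ^ 3 * (\<Sum>i\<in>(UNIV :: 3 set). (4 * pi * real n / L) ^ 3 * cell_cubes L N ?P)"
    using d N n by (intro mult_left_mono sum_mono bernstein_cell_cubes[OF L _ F]) auto
  also have "\<dots> = 48 * (d * (4 * pi * real n / L)) ^ 3 * cell_cubes L N ?P"
    unfolding power_mult_distrib[of d] by simp
  \<comment> \<open>The mesh contributes \<open>4 \<pi> n / N \<le> 16 / 128\<close>, which makes the total factor less than one half.\<close>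
  also have "\<dots> \<le> 48 * (1 / 8) ^ 3 * cell_cubes L N ?P"
  proof -
    have "d * (4 * pi * real n / L) = 4 * pi * real n / real N" using L by (simp add: d_def)
    also have "\<dots> \<le> 4 * 4 * real n / (128 * real n)"
      using N n N0 pi_less_4 by (intro frac_le mult_mono) auto
    finally show ?thesis using d L n nonneg
      by (intro mult_right_mono mult_left_mono power_mono) (auto simp: cell_cubes_def intro!: sum_nonneg)
  qed
  also have "\<dots> \<le> cell_cubes L N ?P / 2"
    using nonneg by (simp add: cell_cubes_def power3_eq_cube sum_nonneg)
  finally have "cell_cubes L N ?P / 2 \<le> (\<Sum>g\<in>index_box N. A g)"
    by (simp add: A_def sum_subtractf cell_cubes_def sum_distrib_left)
  then have "d ^ 3 * cell_cubes L N ?P \<le> d ^ 3 * (2 * (\<Sum>g\<in>index_box N. A g))"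
    using d by (intro mult_left_mono) auto
  with 1 show ?thesis unfolding d_def by linarith
qed

section \<open>Dyadic cubes of the torus\<close>

lemma cube_index_eq: "cube_index q = index_box (2 ^ q)"
  by (auto simp: cube_index_def index_box_def)

lemma finite_cube_index [simp]: "finite (cube_index q)"
  by (simp add: cube_index_eq)

lemma torus_proj_add:
  assumes "L > 0"
  shows "torus_proj L (x + L *\<^sub>R int_vec m) = torus_proj L x"
  using assms by (simp add: torus_proj_def vec_eq_iff add_divide_distrib algebra_simps)

lemma torus_proj_torus: "L > 0 \<Longrightarrow> x \<in> torus L \<Longrightarrow> torus_proj L x = x"
  by (simp add: torus_proj_def torus_def vec_eq_iff floor_eq_iff)

lemma torus_proj_in_torus: "L > 0 \<Longrightarrow> torus_proj L x \<in> torus L"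
proof -
  assume L: "L > 0"
  have "0 \<le> x $ i - L * of_int \<lfloor>x $ i / L\<rfloor> \<and> x $ i - L * of_int \<lfloor>x $ i / L\<rfloor> < L" for i
    using floor_divide_lower[OF L, of "x $ i"] floor_divide_upper[OF L, of "x $ i"] by (simp add: algebra_simps)
  then show ?thesis by (simp add: torus_proj_def torus_def)
qed

lemma torus_proj_diff:
  assumes "L > 0"
  obtains m :: "int ^ 3" where "torus_proj L x = x + L *\<^sub>R int_vec m"
  using that[of "\<chi> i. - \<lfloor>x $ i / L\<rfloor>"] by (simp add: torus_proj_def vec_eq_iff)

lemma ell_pos [simp]: "L > 0 \<Longrightarrow> ell L q > 0"
  by (simp add: ell_def)

lemma lam_pos [simp]: "L > 0 \<Longrightarrow> lam L q > 0"
  by (simp add: lam_def)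

lemma floor_ell_shift:
  assumes "L > 0"
  shows "\<lfloor>(x $ i + L * of_int m) / ell L q\<rfloor> = \<lfloor>x $ i / ell L q\<rfloor> + 2 ^ q * m"
proof -
  have "(x $ i + L * of_int m) / ell L q = x $ i / ell L q + of_int (2 ^ q * m)"
    using assms by (simp add: ell_def field_simps)
  then show ?thesis by (simp only: floor_add_int)
qed

text \<open>Membership in a periodised dyadic cube is a congruence for the integer parts; all later counting of
cubes reduces to it.\<close>

lemma proj_in_dcube_iff:
  assumes L: "L > 0"
  shows "torus_proj L z \<in> dcube L q k \<longleftrightarrow> (\<forall>i. 2 ^ q dvd \<lfloor>z $ i / ell L q\<rfloor> - k $ i)"
proof
  assume "torus_proj L z \<in> dcube L q k"
  then obtain x where x: "torus_proj L z = torus_proj L x"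
    "\<And>i. ell L q * of_int (k $ i) \<le> x $ i \<and> x $ i < ell L q * (of_int (k $ i) + 1)"
    by (auto simp: dcube_def)
  have fx: "\<lfloor>x $ i / ell L q\<rfloor> = k $ i" for i
    using x(2)[of i] L by (simp add: floor_eq_iff field_simps)
  obtain m where m: "torus_proj L z = z + L *\<^sub>R int_vec m" using torus_proj_diff[OF L] .
  obtain m' where m': "torus_proj L x = x + L *\<^sub>R int_vec m'" using torus_proj_diff[OF L] .
  show "\<forall>i. 2 ^ q dvd \<lfloor>z $ i / ell L q\<rfloor> - k $ i"
  proof
    fix i
    have "z $ i = x $ i + L * of_int (m' $ i - m $ i)"
      using arg_cong[where f = "\<lambda>v. v $ i", OF trans[OF m[symmetric] trans[OF x(1) m']]] by (simp add: algebra_simps)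
    then show "2 ^ q dvd \<lfloor>z $ i / ell L q\<rfloor> - k $ i" by (simp only: floor_ell_shift[OF L] fx) simp
  qed
next
  assume "\<forall>i. 2 ^ q dvd \<lfloor>z $ i / ell L q\<rfloor> - k $ i"
  then have "\<forall>i. \<exists>m. \<lfloor>z $ i / ell L q\<rfloor> - k $ i = 2 ^ q * m" by (auto simp: dvd_def)
  then obtain m where m: "\<And>i. \<lfloor>z $ i / ell L q\<rfloor> - k $ i = 2 ^ q * m i" by metis
  define x where "x = z + L *\<^sub>R (\<chi> i. of_int ((\<chi> i. - m i) $ i))"
  have "\<lfloor>x $ i / ell L q\<rfloor> = k $ i" for i
    using floor_ell_shift[OF L, of z i "- m i" q] m[of i] by (simp add: x_def)
  then have "of_int (k $ i) \<le> x $ i / ell L q \<and> x $ i / ell L q < of_int (k $ i) + 1" for i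
    by (simp add: floor_eq_iff)
  then have "ell L q * of_int (k $ i) \<le> x $ i \<and> x $ i < ell L q * (of_int (k $ i) + 1)" for i
    using L by (simp add: field_simps)
  moreover have "torus_proj L z = torus_proj L x" unfolding x_def using torus_proj_add[OF L] by metis
  ultimately show "torus_proj L z \<in> dcube L q k" unfolding dcube_def by blast
qed

lemma dcube_iff:
  assumes "L > 0"
  shows "x \<in> dcube L q k \<longleftrightarrow> x \<in> torus L \<and> (\<forall>i. 2 ^ q dvd \<lfloor>x $ i / ell L q\<rfloor> - k $ i)"
proof -
  have "dcube L q k \<subseteq> torus L" using torus_proj_in_torus[OF assms] by (auto simp: dcube_def)
  then show ?thesis using proj_in_dcube_iff[OF assms, of x] torus_proj_torus[OF assms] by auto
qed

lemma vec_nth_measurable [measurable]: "(\<lambda>x :: real ^ 3. x $ i) \<in> borel_measurable borel"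
  by (intro borel_measurable_continuous_onI continuous_intros)

lemma floor_class_borel:
  "{z :: real ^ 3. \<forall>i. P i \<lfloor>z $ i / r\<rfloor>} \<in> sets borel"
proof -
  have "{z :: real ^ 3. P i \<lfloor>z $ i / r\<rfloor>} \<in> sets borel" for i
  proof -
    have [measurable]: "(\<lambda>z :: real ^ 3. \<lfloor>z $ i / r\<rfloor>) \<in> borel \<rightarrow>\<^sub>M count_space UNIV" by measurable
    have "(\<lambda>z :: real ^ 3. \<lfloor>z $ i / r\<rfloor>) -` {a. P i a} \<inter> space borel \<in> sets borel"
      by (rule measurable_sets[where A = "count_space UNIV"]) auto
    then show ?thesis by (simp add: vimage_def)
  qed
  moreover have "{z :: real ^ 3. \<forall>i. P i \<lfloor>z $ i / r\<rfloor>} = (\<Inter>i. {z. P i \<lfloor>z $ i / r\<rfloor>})" by auto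
  ultimately show ?thesis by auto
qed

lemma proj_dcube_borel: "L > 0 \<Longrightarrow> {z. torus_proj L z \<in> dcube L q k} \<in> sets borel"
  unfolding proj_in_dcube_iff by (rule floor_class_borel)

lemma dcube_borel: "L > 0 \<Longrightarrow> dcube L q k \<in> sets borel"
proof -
  assume L: "L > 0"
  have "dcube L q k = half_box 0 L \<inter> {z. torus_proj L z \<in> dcube L q k}"
    unfolding torus_eq_half_box[symmetric] proj_in_dcube_iff[OF L] using dcube_iff[OF L] by blast
  then show ?thesis using proj_dcube_borel[OF L] by (metis half_box_borel sets.Int)
qed

lemma emeasure_dcube_le:
  assumes L: "L > 0"
  shows "emeasure lborel (dcube L q k) \<le> ennreal (ell L q ^ 3)"
proof -
  let ?k = "index_mod (2 ^ q) k"
  have "dcube L q k \<subseteq> half_box (\<chi> i. ell L q * of_int (?k $ i)) (ell L q)"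
  proof
    fix x assume "x \<in> dcube L q k"
    then have x: "x \<in> torus L" "\<And>i. 2 ^ q dvd \<lfloor>x $ i / ell L q\<rfloor> - k $ i" by (auto simp: dcube_iff[OF L])
    have "\<lfloor>x $ i / ell L q\<rfloor> = k $ i mod 2 ^ q" for i
    proof -
      have "0 \<le> \<lfloor>x $ i / ell L q\<rfloor>" "\<lfloor>x $ i / ell L q\<rfloor> < 2 ^ q"
        using x(1) L by (auto simp: torus_def floor_less_iff ell_def field_simps)
      moreover have "\<lfloor>x $ i / ell L q\<rfloor> mod 2 ^ q = k $ i mod 2 ^ q" using x(2) by (simp add: mod_eq_dvd_iff)
      ultimately show ?thesis by simp
    qed
    then have "of_int (k $ i mod 2 ^ q) \<le> x $ i / ell L q \<and> x $ i / ell L q < of_int (k $ i mod 2 ^ q) + 1" for i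
      using floor_correct[of "x $ i / ell L q"] by simp
    then show "x \<in> half_box (\<chi> i. ell L q * of_int (?k $ i)) (ell L q)"
      using L by (simp add: half_box_def index_mod_def field_simps)
  qed
  then have "emeasure lborel (dcube L q k) \<le> emeasure lborel (half_box (\<chi> i. ell L q * of_int (?k $ i)) (ell L q))"
    by (intro emeasure_mono) auto
  then show ?thesis using L by (simp add: emeasure_half_box less_imp_le)
qed

section \<open>Iterated partial derivatives and the Leibniz rule\<close>

text \<open>Derivatives of every order exist along the coordinate axes.  This is all that the iterated partial
derivatives see, and it passes to products without any differentiability in the sense of Frechet.\<close>

definition directionally_smooth :: "(real ^ 3 \<Rightarrow> 'b :: real_normed_vector) \<Rightarrow> bool" where
  "directionally_smooth f \<longleftrightarrow> (\<forall>is i x.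
     ((\<lambda>h. foldr partial_deriv is f (x + h *\<^sub>R axis i 1)) has_vector_derivative foldr partial_deriv (i # is) f x) (at 0))"

text \<open>The ways to distribute an iterated derivative over the two factors of a product, with multiplicity.\<close>

fun splits :: "'a list \<Rightarrow> ('a list \<times> 'a list) list" where
  "splits [] = [([], [])]"
| "splits (i # is) = map (\<lambda>(A, B). (i # A, B)) (splits is) @ map (\<lambda>(A, B). (A, i # B)) (splits is)"

lemma splits_length: "(A, B) \<in> set (splits is) \<Longrightarrow> length A + length B = length is"
  by (induction "is" arbitrary: A B) auto

lemma length_splits: "length (splits is) = 2 ^ length is"
  by (induction "is") auto

lemma has_vector_derivative_sum_list:
  assumes "\<And>p. p \<in> set ps \<Longrightarrow> ((\<lambda>h. f p h) has_vector_derivative f' p) F"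
  shows "((\<lambda>h. \<Sum>p\<leftarrow>ps. f p h) has_vector_derivative (\<Sum>p\<leftarrow>ps. f' p)) F"
  using assms by (induction ps) (auto intro!: has_vector_derivative_add)

lemma partial_deriv_eqI:
  "((\<lambda>h. f (x + h *\<^sub>R axis i 1)) has_vector_derivative d) (at 0) \<Longrightarrow> partial_deriv i f x = d"
  by (simp add: partial_deriv_def vector_derivative_at)

lemma leibniz_rule:
  fixes f :: "real ^ 3 \<Rightarrow> real" and g :: "real ^ 3 \<Rightarrow> 'b :: real_normed_vector"
  assumes f: "directionally_smooth f" and g: "directionally_smooth g"
  shows "foldr partial_deriv is (\<lambda>x. f x *\<^sub>R g x)
    = (\<lambda>x. \<Sum>(A, B)\<leftarrow>splits is. foldr partial_deriv A f x *\<^sub>R foldr partial_deriv B g x)"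
proof (induction "is")
  case (Cons i "is")
  let ?f = "\<lambda>A. foldr partial_deriv A f" and ?g = "\<lambda>B. foldr partial_deriv B g"
  show ?case
  proof
    fix x
    have "((\<lambda>h. \<Sum>(A, B)\<leftarrow>splits is. ?f A (x + h *\<^sub>R axis i 1) *\<^sub>R ?g B (x + h *\<^sub>R axis i 1)) has_vector_derivative
       (\<Sum>(A, B)\<leftarrow>splits is. ?f (i # A) x *\<^sub>R ?g B x + ?f A x *\<^sub>R ?g (i # B) x)) (at 0)"
    proof (rule has_vector_derivative_sum_list)
      fix p assume "p \<in> set (splits is)"
      obtain A B where p: "p = (A, B)" by force
      have 1: "((\<lambda>h. ?f A (x + h *\<^sub>R axis i 1)) has_real_derivative ?f (i # A) x) (at 0)"
        using f unfolding directionally_smooth_def has_real_derivative_iff_has_vector_derivative by blast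
      have 2: "((\<lambda>h. ?g B (x + h *\<^sub>R axis i 1)) has_vector_derivative ?g (i # B) x) (at 0)"
        using g unfolding directionally_smooth_def by blast
      show "((\<lambda>h. case p of (A, B) \<Rightarrow> ?f A (x + h *\<^sub>R axis i 1) *\<^sub>R ?g B (x + h *\<^sub>R axis i 1)) has_vector_derivative
          (case p of (A, B) \<Rightarrow> ?f (i # A) x *\<^sub>R ?g B x + ?f A x *\<^sub>R ?g (i # B) x)) (at 0)"
        using has_vector_derivative_scaleR[OF 1 2] by (simp add: p add.commute)
    qed
    then have "partial_deriv i (\<lambda>x. \<Sum>(A, B)\<leftarrow>splits is. ?f A x *\<^sub>R ?g B x) x
      = (\<Sum>(A, B)\<leftarrow>splits is. ?f (i # A) x *\<^sub>R ?g B x + ?f A x *\<^sub>R ?g (i # B) x)"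
      by (rule partial_deriv_eqI)
    also have "\<dots> = (\<Sum>(A, B)\<leftarrow>splits (i # is). ?f A x *\<^sub>R ?g B x)"
      by (simp add: comp_def case_prod_unfold sum_list_addf)
    finally show "foldr partial_deriv (i # is) (\<lambda>x. f x *\<^sub>R g x) x = (\<Sum>(A, B)\<leftarrow>splits (i # is). ?f A x *\<^sub>R ?g B x)"
      by (simp add: Cons.IH)
  qed
qed simp

lemma directionally_smooth_trig_poly: "directionally_smooth (trig_poly F c)"
  unfolding directionally_smooth_def foldr_partial_deriv_trig_poly foldr.simps comp_def
  by (simp add: partial_deriv_trig_poly trig_poly_has_partial_deriv)

lemma multi_deriv_foldr:
  "multi_deriv \<beta> f = foldr partial_deriv (replicate (\<beta> $ 1) 1 @ replicate (\<beta> $ 2) 2 @ replicate (\<beta> $ 3) 3) f"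
proof -
  have "(partial_deriv i ^^ n) g = foldr partial_deriv (replicate n i) g" for i n and g :: "real ^ 3 \<Rightarrow> 'a"
    by (induction n) auto
  then show ?thesis by (simp add: multi_deriv_def)
qed

lemma multi_deriv_length:
  "length (replicate (\<beta> $ 1) (1::3) @ replicate (\<beta> $ 2) 2 @ replicate (\<beta> $ 3) 3) = mi_order \<beta>"
  by (simp add: mi_order_def sum_3)

section \<open>Compactly supported smooth kernels\<close>

definition bump :: "(real ^ 3 \<Rightarrow> real) \<Rightarrow> bool" where
  "bump \<psi> \<longleftrightarrow> smooth \<psi> \<and> (\<forall>y. norm y > 1 \<longrightarrow> \<psi> y = 0)"

lemma smooth_partial_deriv: "smooth f \<Longrightarrow> smooth (partial_deriv i f)"
  unfolding smooth_def
proof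
  fix "is" assume "\<forall>is. foldr partial_deriv is f differentiable_on UNIV"
  then have "foldr partial_deriv (is @ [i]) f differentiable_on UNIV" by blast
  then show "foldr partial_deriv is (partial_deriv i f) differentiable_on UNIV" by simp
qed

lemma smooth_differentiable: "smooth f \<Longrightarrow> f differentiable (at x)"
  unfolding smooth_def using differentiable_on_def by (metis foldr.simps(1) id_apply iso_tuple_UNIV_I)

lemma smooth_has_partial_deriv:
  assumes "smooth f"
  shows "((\<lambda>h. f (x + h *\<^sub>R axis i 1)) has_vector_derivative partial_deriv i f (x + s *\<^sub>R axis i 1)) (at s)"
proof -
  obtain f' where f': "(f has_derivative f') (at (x + s *\<^sub>R axis i 1))"
    using smooth_differentiable[OF assms] by (auto simp: differentiable_def)
  have gen: "((\<lambda>h. f (y + h *\<^sub>R axis i 1)) has_vector_derivative f' (axis i 1)) (at r)"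
    if "y + r *\<^sub>R axis i 1 = x + s *\<^sub>R axis i 1" for y r
  proof -
    have "((\<lambda>h. y + h *\<^sub>R axis i 1) has_derivative (\<lambda>h. h *\<^sub>R axis i 1)) (at r)"
      by (auto intro!: derivative_eq_intros)
    from has_derivative_compose[OF this, of f f'] f' that
    have "((\<lambda>h. f (y + h *\<^sub>R axis i 1)) has_derivative (\<lambda>h. f' (h *\<^sub>R axis i 1))) (at r)" by simp
    moreover have "f' (h *\<^sub>R axis i 1) = h *\<^sub>R f' (axis i 1)" for h
      using has_derivative_linear[OF f'] by (simp add: linear_cmul)
    ultimately show ?thesis by (simp add: has_vector_derivative_def)
  qed
  have "partial_deriv i f (x + s *\<^sub>R axis i 1) = f' (axis i 1)"
    by (rule partial_deriv_eqI) (rule gen, simp)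
  then show ?thesis using gen[of x s] by simp
qed

lemma smooth_continuous: "smooth f \<Longrightarrow> continuous_on UNIV f"
  using smooth_differentiable differentiable_imp_continuous_within
  by (metis continuous_at_imp_continuous_on)

text \<open>The vanishing persists because the complement of the closed unit ball is open.\<close>

lemma bump_partial_deriv:
  assumes "bump \<psi>"
  shows "bump (partial_deriv i \<psi>)"
proof -
  have "partial_deriv i \<psi> y = 0" if y: "norm y > 1" for y
  proof (rule partial_deriv_eqI)
    have "open {h. 1 < norm (y + h *\<^sub>R axis i 1)}"
      by (intro open_Collect_less continuous_intros)
    then have "((\<lambda>h. \<psi> (y + h *\<^sub>R axis i 1)) has_vector_derivative 0) (at 0) \<longleftrightarrow> ((\<lambda>h. 0) has_vector_derivative (0 :: real)) (at 0)"
      using y assms by (intro has_vector_derivative_cong_ev refl)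
        (auto simp: bump_def eventually_nhds intro!: exI[of _ "{h. 1 < norm (y + h *\<^sub>R axis i 1)}"])
    then show "((\<lambda>h. \<psi> (y + h *\<^sub>R axis i 1)) has_vector_derivative 0) (at 0)" by simp
  qed
  then show ?thesis using assms by (simp add: bump_def smooth_partial_deriv)
qed

lemma bump_bounded:
  assumes "bump \<psi>"
  obtains B where "B > 0" "\<And>y. \<bar>\<psi> y\<bar> \<le> B"
proof -
  have "compact (\<psi> ` cball 0 1)"
    using assms smooth_continuous by (intro compact_continuous_image) (auto simp: bump_def intro: continuous_on_subset)
  then obtain B where B: "\<And>y. y \<in> cball 0 1 \<Longrightarrow> \<bar>\<psi> y\<bar> \<le> B"
    by (metis bounded_iff compact_imp_bounded image_eqI real_norm_def)
  show ?thesis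
  proof (rule that[of "max B 1"])
    show "\<bar>\<psi> y\<bar> \<le> max B 1" for y
      using B[of y] assms by (cases "norm y > 1") (auto simp: bump_def)
  qed simp
qed

lemma bump_borel [measurable_dest]: "bump \<psi> \<Longrightarrow> \<psi> \<in> borel_measurable borel"
  using smooth_continuous by (auto simp: bump_def intro!: borel_measurable_continuous_onI)

lemma bump_foldr_partial_deriv: "bump \<psi> \<Longrightarrow> bump (foldr partial_deriv is \<psi>)"
  by (induction "is") (simp_all add: bump_partial_deriv)

text \<open>A Taylor estimate uniform in the base point: integrated over a set of finite measure, it allows the
mollified cutoffs to be differentiated under the integral sign.\<close>

lemma bump_quadratic_remainder:
  assumes \<psi>: "bump \<psi>" and B: "\<And>y. \<bar>partial_deriv i (partial_deriv i \<psi>) y\<bar> \<le> B"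
  shows "\<bar>\<psi> (w + s *\<^sub>R axis i 1) - \<psi> w - s * partial_deriv i \<psi> w\<bar> \<le> B * s\<^sup>2"
proof -
  let ?D = "partial_deriv i \<psi>"
  have sm: "smooth \<psi>" "smooth ?D" using \<psi> smooth_partial_deriv by (auto simp: bump_def)
  have lip: "norm (?D (w + r *\<^sub>R axis i 1) - ?D (w + 0 *\<^sub>R axis i 1)) \<le> B * norm (r - 0)" for r
    by (rule vector_derivative_bound_real[OF has_vector_derivative_at_within[OF smooth_has_partial_deriv[OF sm(2)]]])
       (use B in auto)
  have B0: "B \<ge> 0" using B abs_ge_zero order_trans by blast
  have "norm ((\<psi> (w + s *\<^sub>R axis i 1) - s *\<^sub>R ?D w) - (\<psi> (w + 0 *\<^sub>R axis i 1) - 0 *\<^sub>R ?D w)) \<le> (B * \<bar>s\<bar>) * norm (s - 0)"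
  proof (rule vector_derivative_bound_real)
    fix r assume r: "r \<in> closed_segment 0 s"
    show "((\<lambda>r. \<psi> (w + r *\<^sub>R axis i 1) - r *\<^sub>R ?D w) has_vector_derivative ?D (w + r *\<^sub>R axis i 1) - ?D w)
        (at r within closed_segment 0 s)"
      by (intro has_vector_derivative_diff has_vector_derivative_at_within[OF smooth_has_partial_deriv[OF sm(1)]])
         (auto intro!: derivative_eq_intros simp: has_vector_derivative_def)
    have "\<bar>r\<bar> \<le> \<bar>s\<bar>" using r by (auto simp: closed_segment_eq_real_ivl split: if_splits)
    then show "norm (?D (w + r *\<^sub>R axis i 1) - ?D w) \<le> B * \<bar>s\<bar>"
      using lip[of r] B0 by (auto intro: order_trans mult_left_mono)
  qed
  then show ?thesis by (simp add: power2_eq_square mult.assoc algebra_simps flip: abs_mult)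
qed

lemma has_vector_derivative_at_0_quadratic:
  fixes f :: "real \<Rightarrow> 'a :: real_normed_vector"
  assumes "\<And>h. \<bar>h\<bar> \<le> 1 \<Longrightarrow> norm (f h - f 0 - h *\<^sub>R d) \<le> C * h\<^sup>2"
  shows "(f has_vector_derivative d) (at 0)"
proof -
  have "((\<lambda>h. norm (f h - f 0 - h *\<^sub>R d) / norm h) \<longlongrightarrow> 0) (at 0)"
  proof (rule Lim_null_comparison)
    show "\<forall>\<^sub>F h in at 0. norm (norm (f h - f 0 - h *\<^sub>R d) / norm h) \<le> C * \<bar>h\<bar>"
      unfolding eventually_at
    proof (intro exI[of _ 1] conjI ballI impI)
      fix h :: real assume "h \<noteq> 0 \<and> dist h 0 < 1"
      then show "norm (norm (f h - f 0 - h *\<^sub>R d) / norm h) \<le> C * \<bar>h\<bar>"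
        using assms[of h] by (simp add: field_simps power2_eq_square)
    qed simp
    show "((\<lambda>h. C * \<bar>h\<bar>) \<longlongrightarrow> 0) (at 0)" by (intro tendsto_mult_right_zero tendsto_rabs_zero tendsto_ident_at)
  qed
  then show ?thesis
    by (simp add: has_vector_derivative_def has_derivative_at bounded_linear_scaleR_left)
qed

section \<open>The mollified cutoffs\<close>

lemma lborel_integral_reflect:
  fixes f :: "'a :: euclidean_space \<Rightarrow> real"
  assumes [measurable]: "f \<in> borel_measurable borel"
  shows "(LINT y | lborel. f (x - y)) = (LINT y | lborel. f y)"
proof -
  have "lborel = density (distr lborel borel (\<lambda>y. x - y)) (\<lambda>_. ennreal 1)"
    using lborel_affine[of "-1" x] by simp
  then have "(LINT y | lborel. f y) = (LINT y | density (distr lborel borel (\<lambda>y. x - y)) (\<lambda>_. ennreal 1). f y)"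
    by (rule arg_cong)
  also have "\<dots> = (LINT y | lborel. f (x - y))"
    by (subst integral_density) (simp_all add: integral_distr)
  finally show ?thesis by simp
qed

lemma lborel_integral_scale:
  fixes f :: "real ^ 3 \<Rightarrow> real"
  assumes [measurable]: "f \<in> borel_measurable borel" and r: "r > 0"
  shows "(LINT y | lborel. f (r *\<^sub>R y)) = (LINT y | lborel. f y) / r ^ 3"
proof -
  have "lborel = density (distr lborel borel (\<lambda>y :: real ^ 3. r *\<^sub>R y)) (\<lambda>_. ennreal (r ^ 3))"
    using lborel_affine[of r "0 :: real ^ 3"] r by simp
  then have "(LINT y | lborel. f y) = (LINT y | density (distr lborel borel (\<lambda>y. r *\<^sub>R y)) (\<lambda>_. ennreal (r ^ 3)). f y)"
    by (rule arg_cong)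
  also have "\<dots> = r ^ 3 * (LINT y | lborel. f (r *\<^sub>R y))"
    using r by (simp add: integral_density integral_distr)
  finally show ?thesis using r by simp
qed

context
  fixes L :: real
  assumes L: "L > 0"
begin

abbreviation "cube_mask q k z \<equiv> indicat_real (dcube L q k) (torus_proj L z)"

lemma cube_mask_borel [measurable]: "(\<lambda>z. cube_mask q k z) \<in> borel_measurable borel"
proof -
  have "(\<lambda>z. cube_mask q k z) = indicator {z. torus_proj L z \<in> dcube L q k}"
    by (auto simp: indicator_def)
  then show ?thesis using proj_dcube_borel[OF L] by simp
qed

abbreviation "cutoff_kernel \<psi> q k x z \<equiv> cube_mask q k z * (2 ^ (3 * q) * \<psi> (lam L q *\<^sub>R (x - z)))"

lemma cube_cutoff_lborel:
  assumes "bump \<psi>"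
  shows "cube_cutoff \<psi> L q k x =
    1 / L ^ 3 * (LINT z | lborel. cutoff_kernel \<psi> q k x z)"
proof -
  note [measurable] = bump_borel[OF assms]
  have "cube_cutoff \<psi> L q k x = 1 / L ^ 3 * (LINT y | lborel. cube_mask q k (x - y) * (2 ^ (3 * q) * \<psi> (lam L q *\<^sub>R y)))"
    unfolding cube_cutoff_def by (subst integral_completion) simp_all
  also have "(LINT y | lborel. cube_mask q k (x - y) * (2 ^ (3 * q) * \<psi> (lam L q *\<^sub>R y)))
    = (LINT z | lborel. cutoff_kernel \<psi> q k x z)"
    by (subst lborel_integral_reflect[of "\<lambda>z. cutoff_kernel \<psi> q k x z" x, symmetric]) simp_all
  finally show ?thesis .
qed

text \<open>The ball of radius \<open>r\<close> lies in a cube of side \<open>2 r\<close>, which explains the factor \<open>8\<close>.\<close>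

lemma bounded_support_integral:
  fixes f :: "real ^ 3 \<Rightarrow> real"
  assumes [measurable]: "f \<in> borel_measurable borel"
    and f: "\<And>z. \<bar>f z\<bar> \<le> B" "\<And>z. norm (x - z) > r \<Longrightarrow> f z = 0" and r: "r \<ge> 0"
  shows "integrable lborel f" "\<bar>LINT z | lborel. f z\<bar> \<le> 8 * B * r ^ 3"
proof -
  define Q where "Q = cbox (x - (\<chi> i. r)) (x + (\<chi> i. r))"
  have fin: "emeasure lborel Q < \<infinity>" unfolding Q_def by (rule emeasure_lborel_cbox_finite)
  have dom: "\<bar>f z\<bar> \<le> B * indicator Q z" for z
  proof (cases "norm (x - z) > r")
    case True
    have "B \<ge> 0" using f(1)[of z] by linarith
    then show ?thesis using True f(2) by simp
  next
    case False
    then have "\<bar>(x - z) $ i\<bar> \<le> r" for i using component_le_norm_cart[of "x - z" i] by linarith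
    then have "z \<in> Q" unfolding Q_def mem_box_cart by (auto simp: abs_le_iff algebra_simps)
    then show ?thesis using f(1) by simp
  qed
  have intB: "integrable lborel (\<lambda>z. B * indicator Q z)"
    using fin by (intro integrable_mult_right integrable_real_indicator) (auto simp: Q_def)
  show int: "integrable lborel f"
    by (rule Bochner_Integration.integrable_bound[OF intB]) (use dom in \<open>auto intro!: AE_I2 order_trans[OF dom]\<close>)
  have "\<bar>LINT z | lborel. f z\<bar> \<le> (LINT z | lborel. \<bar>f z\<bar>)" by (rule integral_abs_bound)
  also have "\<dots> \<le> (LINT z | lborel. B * indicator Q z)"
    using int dom by (intro integral_mono intB integrable_abs)
  also have "\<dots> = B * measure lborel Q" by (simp add: Q_def)
  also have "measure lborel Q = (2 * r) ^ 3"
  proof -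
    have "measure lborel Q = (\<Prod>j\<in>Basis. ((x + (\<chi> i. r)) - (x - (\<chi> i. r))) \<bullet> j)"
      unfolding Q_def using r by (intro measure_lborel_cbox) (auto simp: Basis_vec_def inner_axis)
    also have "\<dots> = (\<Prod>j\<in>(Basis :: (real ^ 3) set). 2 * r)"
      by (intro prod.cong) (auto simp: Basis_vec_def inner_axis)
    finally show ?thesis by simp
  qed
  finally show "\<bar>LINT z | lborel. f z\<bar> \<le> 8 * B * r ^ 3" by (simp add: power_mult_distrib)
qed

lemma ell_lam: "ell L q * lam L q = 1"
  using L by (simp add: ell_def lam_def)

lemma lam_cube: "2 ^ (3 * q) / L ^ 3 = lam L q ^ 3"
  by (simp add: lam_def power_divide power_mult[symmetric] mult.commute)

lemma cutoff_integral:
  fixes q :: nat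
  assumes \<psi>: "bump \<psi>" and B: "\<And>y. \<bar>\<psi> y\<bar> \<le> B"
  defines "f \<equiv> cutoff_kernel \<psi> q"
  shows "integrable lborel (f k x)"
    and "\<bar>LINT z | lborel. f k x z\<bar> \<le> 8 * (2 ^ (3 * q) * B) * ell L q ^ 3"
proof -
  have m: "f k x \<in> borel_measurable borel"
  proof -
    note [measurable] = bump_borel[OF \<psi>]
    show ?thesis unfolding f_def by measurable
  qed
  have "B \<ge> 0" using B[of 0] by linarith
  then have b: "\<bar>f k x z\<bar> \<le> 2 ^ (3 * q) * B" for z
    using B by (auto simp: f_def indicator_def abs_mult)
  have z: "f k x z = 0" if "ell L q < norm (x - z)" for z
  proof -
    have "lam L q * ell L q < lam L q * norm (x - z)" using that L by simp
    then have "norm (lam L q *\<^sub>R (x - z)) > 1" using L ell_lam[of q] by (simp add: mult.commute less_imp_le)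
    then show ?thesis using \<psi> by (simp add: f_def bump_def)
  qed
  have l: "ell L q \<ge> 0" using L by (simp add: less_imp_le)
  show "integrable lborel (f k x)" "\<bar>LINT z | lborel. f k x z\<bar> \<le> 8 * (2 ^ (3 * q) * B) * ell L q ^ 3"
    using bounded_support_integral[OF m b z l] by blast+
qed

lemma cutoff_integrand:
  assumes "bump \<psi>"
  shows "integrable lborel (cutoff_kernel \<psi> q k x)"
proof -
  obtain B where "\<And>y. \<bar>\<psi> y\<bar> \<le> B" using bump_bounded[OF assms] by blast
  from cutoff_integral(1)[OF assms this] show ?thesis .
qed

text \<open>The kernel has height \<open>\<lambda>^3 B\<close> and lives on a ball of radius \<open>1 / \<lambda>\<close>; the scale cancels.\<close>

lemma cube_cutoff_bound:
  assumes \<psi>: "bump \<psi>" and B: "\<And>y. \<bar>\<psi> y\<bar> \<le> B"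
  shows "\<bar>cube_cutoff \<psi> L q k x\<bar> \<le> 8 * B"
proof -
  have "\<bar>cube_cutoff \<psi> L q k x\<bar> \<le> 1 / L ^ 3 * (8 * (2 ^ (3 * q) * B) * ell L q ^ 3)"
    unfolding cube_cutoff_lborel[OF \<psi>] abs_mult using L cutoff_integral(2)[OF \<psi> B] by (intro mult_mono) auto
  also have "\<dots> = 8 * B * (lam L q * ell L q) ^ 3"
    by (simp add: power_mult_distrib flip: lam_cube)
  also have "\<dots> = 8 * B" by (simp add: mult.commute[of "lam L q"] ell_lam)
  finally show ?thesis .
qed

text \<open>The convolution places the variable in the kernel only, so a derivative falls on the kernel and
produces one factor \<open>\<lambda>\<close>.  The quadratic remainder of the kernel, integrated over a set of finite measure, is a
quadratic remainder of the cutoff.\<close>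

lemma cube_cutoff_partial_deriv:
  assumes \<psi>: "bump \<psi>"
  shows "((\<lambda>h. cube_cutoff \<psi> L q k (x + h *\<^sub>R axis i 1)) has_vector_derivative
    lam L q * cube_cutoff (partial_deriv i \<psi>) L q k x) (at 0)"
proof -
  let ?D = "partial_deriv i \<psi>" and ?l = "lam L q"
  have D: "bump ?D" "bump (partial_deriv i ?D)" using \<psi> bump_partial_deriv by auto
  note [measurable] = bump_borel[OF \<psi>] bump_borel[OF D(1)]
  obtain B where B: "B > 0" "\<And>y. \<bar>partial_deriv i ?D y\<bar> \<le> B" using bump_bounded[OF D(2)] by blast
  have l: "?l > 0" using L by simp
  define K where "K \<phi> x z = cutoff_kernel \<phi> q k x z" for \<phi> :: "real ^ 3 \<Rightarrow> real" and x z
  have intK: "integrable lborel (K \<phi> x)" if "bump \<phi>" for \<phi> x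
    unfolding K_def using cutoff_integrand[OF that] .
  have cc: "cube_cutoff \<phi> L q k y = 1 / L ^ 3 * (LINT z | lborel. K \<phi> y z)" if "bump \<phi>" for \<phi> y
    unfolding K_def by (rule cube_cutoff_lborel[OF that])
  define R where "R h z = K \<psi> (x + h *\<^sub>R axis i 1) z - K \<psi> x z - (h * ?l) * K ?D x z" for h z
  have Rb: "\<bar>LINT z | lborel. R h z\<bar> \<le> 8 * (2 ^ (3 * q) * (B * (h * ?l)\<^sup>2)) * (ell L q + 1) ^ 3" if h: "\<bar>h\<bar> \<le> 1" for h
  proof (rule bounded_support_integral(2))
    show "R h \<in> borel_measurable borel" unfolding R_def K_def by measurable
    fix z
    have e: "?l *\<^sub>R (x + h *\<^sub>R axis i 1 - z) = ?l *\<^sub>R (x - z) + (h * ?l) *\<^sub>R axis i 1"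
      by (simp add: algebra_simps)
    have Req: "R h z = cube_mask q k z * (2 ^ (3 * q) * (\<psi> (?l *\<^sub>R (x - z) + (h * ?l) *\<^sub>R axis i 1) - \<psi> (?l *\<^sub>R (x - z)) - (h * ?l) * ?D (?l *\<^sub>R (x - z))))"
      unfolding R_def K_def e by (simp add: algebra_simps)
    show "\<bar>R h z\<bar> \<le> 2 ^ (3 * q) * (B * (h * ?l)\<^sup>2)"
      unfolding Req using bump_quadratic_remainder[OF \<psi> B(2), of "?l *\<^sub>R (x - z)" "h * ?l"] B(1)
      by (auto simp: indicator_def abs_mult intro!: mult_left_mono mult_nonneg_nonneg)
    assume far: "norm (x - z) > ell L q + 1"
    have n1: "norm y > ell L q \<Longrightarrow> norm (?l *\<^sub>R y) > 1" for y :: "real ^ 3"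
      using mult_strict_left_mono[of "ell L q" "norm y" ?l] l ell_lam[of q] by (simp add: mult.commute)
    have "norm (x + h *\<^sub>R axis i 1 - z) \<ge> norm (x - z) - norm (h *\<^sub>R axis i 1 :: real ^ 3)"
      by (metis add_diff_eq diff_add_eq norm_diff_ineq)
    moreover have "norm (h *\<^sub>R axis i 1 :: real ^ 3) \<le> 1" using h by (simp add: norm_eq_sqrt_inner inner_axis_axis)
    ultimately have "norm (x + h *\<^sub>R axis i 1 - z) > ell L q" "norm (x - z) > ell L q" using far by auto
    then have "norm (?l *\<^sub>R (x + h *\<^sub>R axis i 1 - z)) > 1" "norm (?l *\<^sub>R (x - z)) > 1" using n1 by blast+
    then show "R h z = 0" using \<psi> D by (simp add: R_def K_def bump_def)
  qed (use L in \<open>simp add: add_nonneg_nonneg less_imp_le\<close>)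
  show ?thesis
  proof (rule has_vector_derivative_at_0_quadratic[where C = "1 / L ^ 3 * (8 * (2 ^ (3 * q) * (B * ?l\<^sup>2)) * (ell L q + 1) ^ 3)"])
    fix h :: real assume h: "\<bar>h\<bar> \<le> 1"
    have "(LINT z | lborel. R h z) = (LINT z | lborel. K \<psi> (x + h *\<^sub>R axis i 1) z) - (LINT z | lborel. K \<psi> x z) - (h * ?l) * (LINT z | lborel. K ?D x z)"
      unfolding R_def using intK[OF \<psi>] intK[OF D(1)] by simp
    then have "cube_cutoff \<psi> L q k (x + h *\<^sub>R axis i 1) - cube_cutoff \<psi> L q k (x + 0 *\<^sub>R axis i 1) - h *\<^sub>R (?l * cube_cutoff ?D L q k x) = 1 / L ^ 3 * (LINT z | lborel. R h z)"
      unfolding cc[OF \<psi>] cc[OF D(1)] by (simp add: diff_divide_distrib)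
    then have "norm (cube_cutoff \<psi> L q k (x + h *\<^sub>R axis i 1) - cube_cutoff \<psi> L q k (x + 0 *\<^sub>R axis i 1) - h *\<^sub>R (?l * cube_cutoff ?D L q k x)) = 1 / L ^ 3 * \<bar>LINT z | lborel. R h z\<bar>"
      using L by (simp add: abs_mult)
    also have "\<dots> \<le> 1 / L ^ 3 * (8 * (2 ^ (3 * q) * (B * (h * ?l)\<^sup>2)) * (ell L q + 1) ^ 3)"
      using Rb[OF h] L by (intro mult_left_mono) auto
    finally show "norm (cube_cutoff \<psi> L q k (x + h *\<^sub>R axis i 1) - cube_cutoff \<psi> L q k (x + 0 *\<^sub>R axis i 1) - h *\<^sub>R (?l * cube_cutoff ?D L q k x))
       \<le> 1 / L ^ 3 * (8 * (2 ^ (3 * q) * (B * ?l\<^sup>2)) * (ell L q + 1) ^ 3) * h\<^sup>2"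
      by (simp add: power_mult_distrib mult_ac)
  qed
qed

lemma foldr_partial_deriv_cube_cutoff:
  assumes "bump \<psi>"
  shows "foldr partial_deriv is (cube_cutoff \<psi> L q k)
    = (\<lambda>x. lam L q ^ length is * cube_cutoff (foldr partial_deriv is \<psi>) L q k x)"
proof (induction "is")
  case (Cons i "is")
  have "((\<lambda>h. lam L q ^ length is * cube_cutoff (foldr partial_deriv is \<psi>) L q k (x + h *\<^sub>R axis i 1)) has_vector_derivative
    lam L q ^ length is * (lam L q * cube_cutoff (partial_deriv i (foldr partial_deriv is \<psi>)) L q k x)) (at 0)" for x
    by (intro has_vector_derivative_mult_right cube_cutoff_partial_deriv bump_foldr_partial_deriv assms)
  then show ?case
    by (auto simp: Cons.IH fun_eq_iff mult_ac intro!: partial_deriv_eqI)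
qed simp

lemma directionally_smooth_cube_cutoff:
  assumes "bump \<psi>"
  shows "directionally_smooth (cube_cutoff \<psi> L q k)"
  unfolding directionally_smooth_def
proof (intro allI)
  fix "is" i x
  have "((\<lambda>h. lam L q ^ length is * cube_cutoff (foldr partial_deriv is \<psi>) L q k (x + h *\<^sub>R axis i 1)) has_vector_derivative
    lam L q ^ length is * (lam L q * cube_cutoff (partial_deriv i (foldr partial_deriv is \<psi>)) L q k x)) (at 0)"
    by (intro has_vector_derivative_mult_right cube_cutoff_partial_deriv bump_foldr_partial_deriv assms)
  then show "((\<lambda>h. foldr partial_deriv is (cube_cutoff \<psi> L q k) (x + h *\<^sub>R axis i 1)) has_vector_derivative
     foldr partial_deriv (i # is) (cube_cutoff \<psi> L q k) x) (at 0)"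
    unfolding foldr_partial_deriv_cube_cutoff[OF assms] by (simp add: mult_ac)
qed

text \<open>Mollification at the scale of the cube spreads it to the adjacent cubes only.  Being stated for an
arbitrary kernel, this applies to the derivatives of the cutoff as well.\<close>

lemma cube_cutoff_support:
  assumes \<psi>: "bump \<psi>" and nz: "cube_cutoff \<psi> L q k x \<noteq> 0"
  obtains d :: "int ^ 3" where "\<And>i. \<bar>d $ i\<bar> \<le> 1" "\<And>i. 2 ^ q dvd \<lfloor>x $ i / ell L q\<rfloor> - (k $ i + d $ i)"
proof -
  have "\<exists>z. cutoff_kernel \<psi> q k x z \<noteq> 0"
  proof (rule ccontr)
    assume "\<not> ?thesis"
    then have eq: "cutoff_kernel \<psi> q k x z = 0" for z by blast
    show False using nz unfolding cube_cutoff_lborel[OF \<psi>] by (simp only: eq) simp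
  qed
  then obtain z where z: "torus_proj L z \<in> dcube L q k" "\<psi> (lam L q *\<^sub>R (x - z)) \<noteq> 0"
    by (auto simp: indicator_def split: if_splits)
  have "norm (lam L q *\<^sub>R (x - z)) \<le> 1" using z(2) \<psi> by (force simp: bump_def)
  then have n: "\<bar>x $ i / ell L q - z $ i / ell L q\<bar> \<le> 1" for i
  proof -
    have "\<bar>(lam L q *\<^sub>R (x - z)) $ i\<bar> \<le> 1"
      using component_le_norm_cart[of "lam L q *\<^sub>R (x - z)" i] \<open>norm (lam L q *\<^sub>R (x - z)) \<le> 1\<close> by linarith
    moreover have "(lam L q *\<^sub>R (x - z)) $ i = x $ i / ell L q - z $ i / ell L q"
      using L by (simp add: lam_def ell_def field_simps)
    ultimately show ?thesis by simp
  qed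
  show ?thesis
  proof (rule that[of "\<chi> i. \<lfloor>x $ i / ell L q\<rfloor> - \<lfloor>z $ i / ell L q\<rfloor>"])
    show "\<bar>(\<chi> i. \<lfloor>x $ i / ell L q\<rfloor> - \<lfloor>z $ i / ell L q\<rfloor>) $ i\<bar> \<le> 1" for i
      using n[of i] by simp linarith
    show "2 ^ q dvd \<lfloor>x $ i / ell L q\<rfloor> - (k $ i + (\<chi> i. \<lfloor>x $ i / ell L q\<rfloor> - \<lfloor>z $ i / ell L q\<rfloor>) $ i)" for i
      using z(1) unfolding proj_in_dcube_iff[OF L] by (simp add: algebra_simps)
  qed
qed

lemma sum_cube_mask: "(\<Sum>k\<in>cube_index q. cube_mask q k z) = 1"
proof -
  let ?g = "(\<chi> i. \<lfloor>z $ i / ell L q\<rfloor>) :: int ^ 3"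
  have "torus_proj L z \<in> dcube L q k \<longleftrightarrow> k = index_mod (2 ^ q) ?g" if "k \<in> cube_index q" for k
  proof -
    have "2 ^ q dvd ?g $ i - k $ i \<longleftrightarrow> ?g $ i mod 2 ^ q = k $ i" for i
    proof -
      have "k $ i mod 2 ^ q = k $ i" using that by (simp add: cube_index_def)
      then show ?thesis using mod_eq_dvd_iff[of "?g $ i" "2 ^ q" "k $ i"] by simp
    qed
    then show ?thesis unfolding proj_in_dcube_iff[OF L] by (auto simp: index_mod_def vec_eq_iff)
  qed
  then have "(\<Sum>k\<in>cube_index q. cube_mask q k z) = (\<Sum>k\<in>cube_index q. if k = index_mod (2 ^ q) ?g then 1 else 0)"
    by (intro sum.cong) (auto simp: indicator_def)
  also have "\<dots> = 1" using index_mod_in_box[of "2 ^ q"] by (simp add: cube_index_eq)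
  finally show ?thesis .
qed

text \<open>The cubes partition the torus, and the mollifier has integral one after rescaling.\<close>

lemma sum_cube_cutoff:
  assumes \<eta>: "mollifier \<eta>"
  shows "(\<Sum>k\<in>cube_index q. cube_cutoff \<eta> L q k x) = 1"
proof -
  have b: "bump \<eta>" using \<eta> by (simp add: mollifier_def bump_def)
  note [measurable] = bump_borel[OF b]
  have "(\<Sum>k\<in>cube_index q. cube_cutoff \<eta> L q k x)
    = 1 / L ^ 3 * (\<Sum>k\<in>cube_index q. (LINT z | lborel. cutoff_kernel \<eta> q k x z))"
    by (simp add: cube_cutoff_lborel[OF b] sum_distrib_left)
  also have "(\<Sum>k\<in>cube_index q. (LINT z | lborel. cutoff_kernel \<eta> q k x z))
    = (LINT z | lborel. (\<Sum>k\<in>cube_index q. cutoff_kernel \<eta> q k x z))"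
    using cutoff_integrand[OF b] by (subst Bochner_Integration.integral_sum) auto
  also have "\<dots> = (LINT z | lborel. 2 ^ (3 * q) * \<eta> (lam L q *\<^sub>R (x - z)))"
    by (simp add: sum_cube_mask flip: sum_distrib_right)
  also have "\<dots> = (LINT z | lborel. 2 ^ (3 * q) * \<eta> (lam L q *\<^sub>R z))"
    by (rule lborel_integral_reflect) measurable
  also have "\<dots> = 2 ^ (3 * q) * (1 / lam L q ^ 3)"
  proof -
    have "(LINT y | lborel. \<eta> y) = 1" using \<eta> by (simp add: mollifier_def integral_completion)
    then show ?thesis using lborel_integral_scale[of \<eta> "lam L q"] L by simp
  qed
  finally show ?thesis using L by (simp flip: lam_cube)
qed

end

section \<open>Measurability of Lipschitz functions of finitely many coordinates\<close>

text \<open>A function of finitely many coordinates that is Lipschitz is continuous on the countable power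
\<open>nat \<Rightarrow> 'b\<close>, where measurability can be tested coordinatewise; the coordinates in \<open>F\<close> are
therefore numbered first.\<close>

lemma borel_measurable_finitely_lipschitz:
  fixes \<Phi> :: "('k \<Rightarrow> 'b :: {real_normed_vector, second_countable_topology}) \<Rightarrow> real"
  assumes F: "finite F"
    and lip: "\<And>c d. \<bar>\<Phi> c - \<Phi> d\<bar> \<le> K * (\<Sum>k\<in>F. norm (c k - d k))"
    and meas: "\<And>k. k \<in> F \<Longrightarrow> (\<lambda>t. c t k) \<in> borel_measurable M"
  shows "(\<lambda>t. \<Phi> (c t)) \<in> borel_measurable M"
proof -
  obtain f where f: "bij_betw f {..<card F} F" using ex_bij_betw_nat_finite[OF F] by (auto simp: atLeast0LessThan)
  define r where "r = the_inv_into {..<card F} f"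
  have fr: "r k < card F" "f (r k) = k" if "k \<in> F" for k
    using f that the_inv_into_into[of f "{..<card F}" k "{..<card F}"] f_the_inv_into_f[of f "{..<card F}" k]
    by (auto simp: r_def bij_betw_def)
  define \<Psi> where "\<Psi> a = \<Phi> (\<lambda>k. a (r k))" for a :: "nat \<Rightarrow> 'b"
  have "continuous_on UNIV \<Psi>"
    unfolding continuous_on_def
  proof
    fix a
    have "((\<lambda>b. \<Psi> b - \<Psi> a) \<longlongrightarrow> 0) (at a)"
    proof (rule Lim_null_comparison)
      show "\<forall>\<^sub>F b in at a. norm (\<Psi> b - \<Psi> a) \<le> K * (\<Sum>k\<in>F. norm (b (r k) - a (r k)))"
        using lip by (auto simp: \<Psi>_def intro!: always_eventually)
      have "continuous_on UNIV (\<lambda>b :: nat \<Rightarrow> 'b. K * (\<Sum>k\<in>F. norm (b (r k) - a (r k))))"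
        by (intro continuous_intros continuous_on_product_coordinates)
      then have "((\<lambda>b. K * (\<Sum>k\<in>F. norm (b (r k) - a (r k)))) \<longlongrightarrow> K * (\<Sum>k\<in>F. norm (a (r k) - a (r k)))) (at a)"
        unfolding continuous_on_def by blast
      then show "((\<lambda>b. K * (\<Sum>k\<in>F. norm (b (r k) - a (r k)))) \<longlongrightarrow> 0) (at a)" by simp
    qed
    then show "(\<Psi> \<longlongrightarrow> \<Psi> a) (at a within UNIV)" by (simp add: LIM_zero_iff)
  qed
  then have "\<Psi> \<in> borel_measurable borel" by (rule borel_measurable_continuous_onI)
  moreover have "(\<lambda>t j. if j < card F then c t (f j) else 0) \<in> borel_measurable M"
  proof (rule measurable_coordinatewise_then_product)
    fix j show "(\<lambda>t. if j < card F then c t (f j) else 0) \<in> borel_measurable M"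
      using f meas[of "f j"] by (cases "j < card F") (auto simp: bij_betw_def)
  qed
  ultimately have "(\<lambda>t. \<Psi> (\<lambda>j. if j < card F then c t (f j) else 0)) \<in> borel_measurable M"
    by (rule measurable_compose[rotated])
  moreover have "\<Psi> (\<lambda>j. if j < card F then c t (f j) else 0) = \<Phi> (c t)" for t
  proof -
    have "\<bar>\<Phi> (\<lambda>k. if r k < card F then c t (f (r k)) else 0) - \<Phi> (c t)\<bar>
        \<le> K * (\<Sum>k\<in>F. norm ((if r k < card F then c t (f (r k)) else 0) - c t k))" by (rule lip)
    also have "\<dots> = 0" by (simp add: fr)
    finally show ?thesis by (simp add: \<Psi>_def)
  qed
  ultimately show ?thesis by simp
qed

section \<open>Littlewood-Paley blocks as trigonometric polynomials\<close>

definition lp_coef :: "(real ^ 3 \<Rightarrow> real) \<Rightarrow> real \<Rightarrow> nat \<Rightarrow> (real ^ 3 \<Rightarrow> real ^ 3) \<Rightarrow> real ^ 3 \<Rightarrow> complex ^ 3" where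
  "lp_coef chi L q v k = of_real (lp_symbol chi L q k) *s fourier_coeff L v k"

abbreviation "lp_freqs L q \<equiv> torus_freqs L (2 ^ (q + 1))"

abbreviation "lp_poly L q \<equiv> trig_poly (lp_freqs L q)"

abbreviation "coef_sum L q c \<equiv> (\<Sum>\<kappa>\<in>lp_freqs L q. norm (c \<kappa>))"

lemma lp_cutoff_support: "lp_cutoff chi \<Longrightarrow> norm \<xi> \<ge> 1 \<Longrightarrow> chi \<xi> = 0"
proof (rule ccontr)
  assume chi: "lp_cutoff chi" "norm \<xi> \<ge> 1" "chi \<xi> \<noteq> 0"
  have "\<xi> \<in> closure {\<xi>. chi \<xi> \<noteq> 0}" by (rule subsetD[OF closure_subset]) (simp add: chi(3))
  moreover have "closure {\<xi>. chi \<xi> \<noteq> 0} \<subseteq> ball 0 1" using chi(1) unfolding lp_cutoff_def by (elim conjE)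
  ultimately have "\<xi> \<in> ball 0 1" by (rule rev_subsetD)
  then show False using chi(2) by simp
qed

lemma lp_symbol_support:
  assumes chi: "lp_cutoff chi" and L: "L > 0" and k: "k \<in> freq_lattice L" "lp_symbol chi L q k \<noteq> 0"
  shows "k \<in> lp_freqs L q"
proof -
  let ?\<zeta> = "(L / 2 ^ q) *\<^sub>R k"
  have "norm ?\<zeta> < 2"
  proof (rule ccontr)
    assume "\<not> norm ?\<zeta> < 2"
    moreover have "norm ((1 / 2) *\<^sub>R z) \<ge> 1 \<and> norm z \<ge> 1" if "\<not> norm z < 2" for z :: "real ^ 3" using that by simp
    ultimately have "norm ((1 / 2) *\<^sub>R ?\<zeta>) \<ge> 1" "norm ?\<zeta> \<ge> 1" by blast+
    then have "chi ((1 / 2) *\<^sub>R ?\<zeta>) = 0" "chi ?\<zeta> = 0" using lp_cutoff_support[OF chi] by blast+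
    then show False using k(2) by (simp add: lp_symbol_def)
  qed
  then have "\<bar>?\<zeta> $ i\<bar> < 2" for i using component_le_norm_cart[of ?\<zeta> i] by linarith
  then have b: "\<bar>L * k $ i\<bar> < 2 * 2 ^ q" for i using L by (simp add: field_simps abs_mult)
  show ?thesis unfolding torus_freqs_def
  proof (intro CollectI allI)
    fix i
    obtain a :: int where a: "L * k $ i = of_int a" using k(1) by (auto simp: freq_lattice_def Ints_def)
    have "real_of_int \<bar>a\<bar> < real_of_int (2 ^ (q + 1))" using b[of i] unfolding a by simp
    then have "\<bar>a\<bar> \<le> int (2 ^ (q + 1))" unfolding of_int_less_iff by simp
    then show "\<exists>a. L * k $ i = of_int a \<and> \<bar>a\<bar> \<le> int (2 ^ (q + 1))" using a by blast
  qed
qed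

text \<open>The symbol vanishes unless \<open>|L \<xi> / 2^q| < 2\<close>, which bounds each coordinate of \<open>L \<xi>\<close> by \<open>2^{q+1}\<close>.\<close>

lemma lp_block_eq_trig_poly:
  assumes chi: "lp_cutoff chi" and L: "L > 0"
  shows "lp_block chi L q v = lp_poly L q (lp_coef chi L q v)"
proof
  fix x
  have "lp_freqs L q \<subseteq> freq_lattice L"
    unfolding torus_freqs_def freq_lattice_def by (auto simp: Ints_def)
  moreover have "lp_symbol chi L q k = 0" if "k \<in> freq_lattice L - lp_freqs L q" for k
    using lp_symbol_support[OF chi L] that by blast
  ultimately have "lp_block chi L q v x = (\<Sum>\<^sub>\<infinity>k\<in>lp_freqs L q.
     (complex_of_real (lp_symbol chi L q k) * exp (2 * pi * \<i> * complex_of_real (k \<bullet> x))) *s fourier_coeff L v k)"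
    unfolding lp_block_def by (intro infsum_cong_neutral) auto
  also have "\<dots> = lp_poly L q (lp_coef chi L q v) x"
    unfolding infsum_finite[OF finite_torus_freqs[OF L]] trig_poly_def lp_coef_def
    by (intro sum.cong refl) (simp add: vec_eq_iff cis_conv_exp mult_ac)
  finally show "lp_block chi L q v x = lp_poly L q (lp_coef chi L q v) x" .
qed

section \<open>The size of an atom as a function of the Fourier coefficients\<close>

text \<open>The atom \<open>b\<^sub>q\<^sub>k\<close> as a function of the Fourier coefficients of the block.\<close>

definition cut_poly :: "(real ^ 3 \<Rightarrow> real) \<Rightarrow> real \<Rightarrow> nat \<Rightarrow> int ^ 3 \<Rightarrow> (real ^ 3 \<Rightarrow> complex ^ 3) \<Rightarrow> real ^ 3 \<Rightarrow> complex ^ 3" where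
  "cut_poly \<eta> L q k c = (\<lambda>x. cube_cutoff \<eta> L q k x *\<^sub>R lp_poly L q c x)"

abbreviation "scaled_deriv \<eta> L q k c \<beta> x \<equiv> norm (multi_deriv \<beta> (cut_poly \<eta> L q k c) x) / lam L q ^ mi_order \<beta>"

text \<open>The number \<open>s\<^sub>q\<^sub>k\<close> as a function of the Fourier coefficients of the block.\<close>

definition atom_size :: "(real ^ 3 \<Rightarrow> real) \<Rightarrow> nat \<Rightarrow> real \<Rightarrow> nat \<Rightarrow> int ^ 3 \<Rightarrow> (real ^ 3 \<Rightarrow> complex ^ 3) \<Rightarrow> real" where
  "atom_size \<eta> M L q k c =
     Max ((\<lambda>\<beta>. sup_norm L (multi_deriv \<beta> (cut_poly \<eta> L q k c)) / lam L q ^ mi_order \<beta>) ` {\<beta>. mi_order \<beta> \<le> M})"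

lemma atom_s_eq_atom_size:
  assumes "lp_cutoff chi" "L > 0"
  shows "atom_s chi \<eta> M L u q k t = atom_size \<eta> M L q k (lp_coef chi L q (u t))"
proof -
  have "atom_b chi \<eta> L u q k t = cut_poly \<eta> L q k (lp_coef chi L q (u t))"
    by (simp add: fun_eq_iff atom_b_def cut_poly_def lp_block_eq_trig_poly[OF assms])
  then show ?thesis by (simp add: atom_s_def atom_size_def)
qed

lemma finite_multi_indices: "finite {\<beta>. mi_order \<beta> \<le> M}"
proof (rule finite_subset)
  show "{\<beta>. mi_order \<beta> \<le> M} \<subseteq> {\<beta>. \<forall>i. \<beta> $ i \<in> {..M}}"
  proof (intro subsetI CollectI allI)
    fix \<beta> :: "nat ^ 3" and i assume "\<beta> \<in> {\<beta>. mi_order \<beta> \<le> M}"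
    then have "mi_order \<beta> \<le> M" by simp
    moreover have "\<beta> $ i \<le> (\<Sum>i\<in>UNIV. \<beta> $ i)" by (rule member_le_sum) auto
    ultimately show "\<beta> $ i \<in> {..M}" by (simp add: mi_order_def)
  qed
qed (simp only: finite_vec_componentwise finite_atMost)

lemma mi_order_zero: "mi_order 0 = 0"
  by (simp add: mi_order_def)

definition short_lists :: "nat \<Rightarrow> 3 list set" where
  "short_lists M = {B. length B \<le> M}"

lemma finite_short_lists [simp]: "finite (short_lists M)"
  using finite_lists_length_le[of "UNIV :: 3 set" M] by (simp add: short_lists_def)

lemma foldr_deriv_coef_diff:
  "foldr deriv_coef B (\<lambda>k. c k - d k) = (\<lambda>k. foldr deriv_coef B c k - foldr deriv_coef B d k)"
  by (induction B) (auto simp: deriv_coef_def fun_eq_iff vec_eq_iff right_diff_distrib)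

lemma trig_poly_diff: "trig_poly F (\<lambda>k. c k - d k) x = trig_poly F c x - trig_poly F d x"
proof -
  have "a *s (v - w) = a *s v - a *s (w :: complex ^ 3)" for a v w
    by (simp add: vec_eq_iff right_diff_distrib)
  then show ?thesis by (simp add: trig_poly_def sum_subtractf)
qed

lemma norm_trig_poly_le: "norm (trig_poly F c x) \<le> (\<Sum>k\<in>F. norm (c k))"
  unfolding trig_poly_def by (rule order_trans[OF norm_sum]) (simp add: norm_vector_scalar_mult)

lemma norm_foldr_deriv_coef:
  "norm (foldr deriv_coef B c k) \<le> (2 * pi * norm k) ^ length B * norm (c k)"
proof (induction B)
  case (Cons i B)
  have "norm (foldr deriv_coef (i # B) c k) = 2 * pi * \<bar>k $ i\<bar> * norm (foldr deriv_coef B c k)"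
    by (simp add: deriv_coef_def norm_vector_scalar_mult norm_mult)
  also have "\<dots> \<le> 2 * pi * norm k * ((2 * pi * norm k) ^ length B * norm (c k))"
    using component_le_norm_cart[of k i] by (intro mult_mono Cons.IH) auto
  finally show ?case by (simp add: mult_ac)
qed simp

lemma multi_deriv_cut_poly:
  assumes "L > 0" "bump \<eta>"
  shows "multi_deriv \<beta> (cut_poly \<eta> L q k c) x =
    (\<Sum>(A, B)\<leftarrow>splits (replicate (\<beta> $ 1) 1 @ replicate (\<beta> $ 2) 2 @ replicate (\<beta> $ 3) 3).
      (lam L q ^ length A * cube_cutoff (foldr partial_deriv A \<eta>) L q k x) *\<^sub>R
        lp_poly L q (foldr deriv_coef B c) x)"
  unfolding multi_deriv_foldr cut_poly_def
    leibniz_rule[OF directionally_smooth_cube_cutoff[OF assms] directionally_smooth_trig_poly]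
    foldr_partial_deriv_cube_cutoff[OF assms] foldr_partial_deriv_trig_poly ..

lemma multi_deriv_cut_poly_diff:
  assumes "L > 0" "bump \<eta>"
  shows "multi_deriv \<beta> (cut_poly \<eta> L q k (\<lambda>k. c k - d k)) x
    = multi_deriv \<beta> (cut_poly \<eta> L q k c) x - multi_deriv \<beta> (cut_poly \<eta> L q k d) x"
  unfolding multi_deriv_cut_poly[OF assms] foldr_deriv_coef_diff trig_poly_diff scaleR_right_diff_distrib
  by (simp add: case_prod_unfold sum_list_subtractf)

lemma multi_deriv_cut_poly_support:
  assumes L: "L > 0" and \<eta>: "bump \<eta>" and nz: "multi_deriv \<beta> (cut_poly \<eta> L q k c) x \<noteq> 0"
  obtains d :: "int ^ 3" where "\<And>i. \<bar>d $ i\<bar> \<le> 1" "\<And>i. 2 ^ q dvd \<lfloor>x $ i / ell L q\<rfloor> - (k $ i + d $ i)"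
proof -
  have "\<exists>A. cube_cutoff (foldr partial_deriv A \<eta>) L q k x \<noteq> 0"
  proof (rule ccontr)
    assume "\<nexists>A. cube_cutoff (foldr partial_deriv A \<eta>) L q k x \<noteq> 0"
    then have "cube_cutoff (foldr partial_deriv A \<eta>) L q k x = 0" for A by blast
    then show False using nz unfolding multi_deriv_cut_poly[OF L \<eta>] by (simp add: case_prod_unfold)
  qed
  then obtain A where "cube_cutoff (foldr partial_deriv A \<eta>) L q k x \<noteq> 0" by blast
  from cube_cutoff_support[OF L bump_foldr_partial_deriv[OF \<eta>] this] show ?thesis using that by blast
qed

lemma norm_sum_list_le: "norm (\<Sum>p\<leftarrow>ps. f p) \<le> (\<Sum>p\<leftarrow>ps. norm (f p))"
  by (induction ps) (auto intro: norm_triangle_le)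

text \<open>In the Leibniz rule a derivative of order \<open>j\<close> of the cutoff is bounded by a constant times \<open>\<lambda>^j\<close>.  The
normalisation by \<open>\<lambda>^{|\<beta>|}\<close> then leaves exactly the power that belongs to the derivatives of the
polynomial, and the constant depends on the kernel and on \<open>M\<close> alone.\<close>

lemma multi_deriv_cut_poly_bound:
  assumes \<eta>: "bump \<eta>"
  shows "\<exists>C>0. \<forall>L q k c \<beta> x. L > 0 \<longrightarrow> mi_order \<beta> \<le> M \<longrightarrow>
    scaled_deriv \<eta> L q k c \<beta> x
      \<le> C * (\<Sum>B\<in>short_lists M. norm (lp_poly L q (foldr deriv_coef B c) x) / lam L q ^ length B)"
proof -
  have "\<exists>K. K > 0 \<and> (\<forall>y. \<bar>foldr partial_deriv A \<eta> y\<bar> \<le> K)" for A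
    using bump_bounded[OF bump_foldr_partial_deriv[OF \<eta>]] by metis
  then obtain K where K: "\<And>A. K A > 0" "\<And>A y. \<bar>foldr partial_deriv A \<eta> y\<bar> \<le> K A" by metis
  define C0 where "C0 = 8 * (\<Sum>A\<in>short_lists M. K A)"
  have "[] \<in> short_lists M" by (simp add: short_lists_def)
  then have C0: "C0 > 0" unfolding C0_def using K(1) by (intro mult_pos_pos sum_pos) auto
  show ?thesis
  proof (intro exI[of _ "2 ^ M * C0"] conjI allI impI)
    show "2 ^ M * C0 > 0" using C0 by simp
    fix L :: real and q k c \<beta> x assume L: "L > 0" and \<beta>: "mi_order \<beta> \<le> M"
    let ?is = "replicate (\<beta> $ 1) (1::3) @ replicate (\<beta> $ 2) 2 @ replicate (\<beta> $ 3) 3"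
    let ?l = "lam L q"
    have l: "?l > 0" using L by simp
    let ?T = "\<lambda>B. norm (lp_poly L q (foldr deriv_coef B c) x) / ?l ^ length B"
    let ?S = "\<Sum>B\<in>short_lists M. ?T B"
    have T0: "?T B \<ge> 0" for B using l by simp
    have summand: "norm ((?l ^ length A * cube_cutoff (foldr partial_deriv A \<eta>) L q k x) *\<^sub>R
        lp_poly L q (foldr deriv_coef B c) x) \<le> ?l ^ mi_order \<beta> * (C0 * ?S)"
      if AB: "(A, B) \<in> set (splits ?is)" for A B
    proof -
      have len: "length A + length B = mi_order \<beta>"
        using splits_length[OF AB] unfolding multi_deriv_length .
      then have sh: "A \<in> short_lists M" "B \<in> short_lists M" using \<beta> by (auto simp: short_lists_def)
      have "\<bar>cube_cutoff (foldr partial_deriv A \<eta>) L q k x\<bar> \<le> 8 * K A"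
        by (intro cube_cutoff_bound L bump_foldr_partial_deriv \<eta> K)
      also have "\<dots> \<le> C0" unfolding C0_def using K(1) sh by (intro mult_left_mono member_le_sum) (auto intro: less_imp_le)
      finally have X: "\<bar>cube_cutoff (foldr partial_deriv A \<eta>) L q k x\<bar> \<le> C0" .
      have "norm (lp_poly L q (foldr deriv_coef B c) x) = ?l ^ length B * ?T B" using l by simp
      also have "\<dots> \<le> ?l ^ length B * ?S" using l sh T0 by (intro mult_left_mono member_le_sum) auto
      finally have "norm ((?l ^ length A * cube_cutoff (foldr partial_deriv A \<eta>) L q k x) *\<^sub>R
        lp_poly L q (foldr deriv_coef B c) x) \<le> (?l ^ length A * C0) * (?l ^ length B * ?S)"
        using X l C0 by (auto simp: abs_mult intro!: mult_mono mult_nonneg_nonneg)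
      also have "\<dots> = ?l ^ mi_order \<beta> * (C0 * ?S)" by (simp add: len[symmetric] power_add mult_ac)
      finally show ?thesis .
    qed
    have "norm (multi_deriv \<beta> (cut_poly \<eta> L q k c) x) \<le> (\<Sum>(A, B)\<leftarrow>splits ?is. norm ((?l ^ length A * cube_cutoff (foldr partial_deriv A \<eta>) L q k x) *\<^sub>R
        lp_poly L q (foldr deriv_coef B c) x))"
      unfolding multi_deriv_cut_poly[OF L \<eta>]
      by (rule order_trans[OF norm_sum_list_le]) (simp add: case_prod_unfold comp_def)
    also have "\<dots> \<le> (\<Sum>(A, B)\<leftarrow>splits ?is. ?l ^ mi_order \<beta> * (C0 * ?S))"
      using summand by (intro sum_list_mono) auto
    also have "\<dots> = 2 ^ mi_order \<beta> * (?l ^ mi_order \<beta> * (C0 * ?S))"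
      by (simp add: case_prod_unfold sum_list_triv length_splits multi_deriv_length[unfolded length_append] mi_order_def sum_3)
    also have "\<dots> \<le> 2 ^ M * (?l ^ mi_order \<beta> * (C0 * ?S))"
      using \<beta> l C0 T0 by (intro mult_right_mono power_increasing mult_nonneg_nonneg sum_nonneg) auto
    finally show "norm (multi_deriv \<beta> (cut_poly \<eta> L q k c) x) / ?l ^ mi_order \<beta> \<le> 2 ^ M * C0 * ?S"
      using l by (simp add: field_simps)
  qed
qed

lemma torus_nonempty: "L > 0 \<Longrightarrow> 0 \<in> torus L"
  by (simp add: torus_def)

text \<open>A crude bound whose constant may depend on everything except the coefficients.  It makes the suprema
in the atom sizes finite and the atom sizes Lipschitz.\<close>

lemma multi_deriv_cut_poly_coef_bound:
  assumes L: "L > 0" and \<eta>: "bump \<eta>"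
  shows "\<exists>K\<ge>0. \<forall>k c \<beta> x. mi_order \<beta> \<le> M \<longrightarrow>
    scaled_deriv \<eta> L q k c \<beta> x \<le> K * coef_sum L q c"
proof -
  let ?F = "lp_freqs L q"
  have finF: "finite ?F" by (rule finite_torus_freqs[OF L])
  obtain C where C: "C > 0" "\<forall>L q k c \<beta> x. L > 0 \<longrightarrow> mi_order \<beta> \<le> M \<longrightarrow>
    scaled_deriv \<eta> L q k c \<beta> x
      \<le> C * (\<Sum>B\<in>short_lists M. norm (lp_poly L q (foldr deriv_coef B c) x) / lam L q ^ length B)"
    using multi_deriv_cut_poly_bound[OF \<eta>, of M] by blast
  define w where "w B = (\<Sum>\<kappa>\<in>?F. (2 * pi * norm \<kappa>) ^ length B)" for B :: "3 list"
  have w0: "w B \<ge> 0" for B by (simp add: w_def sum_nonneg)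
  have tp: "norm (trig_poly ?F (foldr deriv_coef B c) x) \<le> w B * (\<Sum>\<kappa>\<in>?F. norm (c \<kappa>))" for B c x
  proof -
    have "norm (trig_poly ?F (foldr deriv_coef B c) x) \<le> (\<Sum>\<kappa>\<in>?F. (2 * pi * norm \<kappa>) ^ length B * norm (c \<kappa>))"
      by (rule order_trans[OF norm_trig_poly_le]) (intro sum_mono norm_foldr_deriv_coef)
    also have "\<dots> \<le> (\<Sum>\<kappa>\<in>?F. (2 * pi * norm \<kappa>) ^ length B * (\<Sum>\<kappa>\<in>?F. norm (c \<kappa>)))"
      using finF by (intro sum_mono mult_left_mono member_le_sum) auto
    finally show ?thesis by (simp add: w_def sum_distrib_right)
  qed
  show ?thesis
  proof (intro exI[of _ "C * (\<Sum>B\<in>short_lists M. w B / lam L q ^ length B)"] conjI allI impI)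
    show "0 \<le> C * (\<Sum>B\<in>short_lists M. w B / lam L q ^ length B)"
      using C(1) L w0 by (intro mult_nonneg_nonneg sum_nonneg) (auto simp: less_imp_le)
    fix k c \<beta> x assume \<beta>: "mi_order \<beta> \<le> M"
    have "scaled_deriv \<eta> L q k c \<beta> x
      \<le> C * (\<Sum>B\<in>short_lists M. norm (trig_poly ?F (foldr deriv_coef B c) x) / lam L q ^ length B)"
      by (rule C(2)[rule_format, OF L \<beta>])
    also have "\<dots> \<le> C * (\<Sum>B\<in>short_lists M. w B * (\<Sum>\<kappa>\<in>?F. norm (c \<kappa>)) / lam L q ^ length B)"
      using C(1) L by (intro mult_left_mono sum_mono divide_right_mono tp) (auto simp: less_imp_le)
    finally show "scaled_deriv \<eta> L q k c \<beta> x
      \<le> C * (\<Sum>B\<in>short_lists M. w B / lam L q ^ length B) * (\<Sum>\<kappa>\<in>?F. norm (c \<kappa>))"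
      by (simp add: sum_distrib_right mult.assoc)
  qed
qed

lemma multi_deriv_le_atom_size:
  assumes L: "L > 0" and \<eta>: "bump \<eta>" and \<beta>: "mi_order \<beta> \<le> M" and x: "x \<in> torus L"
  shows "scaled_deriv \<eta> L q k c \<beta> x \<le> atom_size \<eta> M L q k c"
proof -
  obtain K where K: "K \<ge> 0" "\<forall>k c \<beta> x. mi_order \<beta> \<le> M \<longrightarrow>
    scaled_deriv \<eta> L q k c \<beta> x \<le> K * coef_sum L q c"
    using multi_deriv_cut_poly_coef_bound[OF L \<eta>, of M q] by blast
  have "bdd_above ((\<lambda>x. norm (multi_deriv \<beta> (cut_poly \<eta> L q k c) x)) ` torus L)"
    using K(2)[rule_format, OF \<beta>, of k c] L
    by (intro bdd_aboveI[of _ "K * coef_sum L q c * lam L q ^ mi_order \<beta>"])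
       (auto simp: pos_divide_le_eq)
  then have "norm (multi_deriv \<beta> (cut_poly \<eta> L q k c) x) \<le> sup_norm L (multi_deriv \<beta> (cut_poly \<eta> L q k c))"
    unfolding sup_norm_def by (intro cSUP_upper x)
  then have "scaled_deriv \<eta> L q k c \<beta> x
     \<le> sup_norm L (multi_deriv \<beta> (cut_poly \<eta> L q k c)) / lam L q ^ mi_order \<beta>"
    using L by (intro divide_right_mono) (auto simp: less_imp_le)
  also have "\<dots> \<le> atom_size \<eta> M L q k c"
    unfolding atom_size_def using \<beta> by (intro Max_ge finite_imageI finite_multi_indices) auto
  finally show ?thesis .
qed

lemma atom_size_least:
  assumes L: "L > 0"
    and b: "\<And>\<beta> x. mi_order \<beta> \<le> M \<Longrightarrow> x \<in> torus L \<Longrightarrow> scaled_deriv \<eta> L q k c \<beta> x \<le> a"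
  shows "atom_size \<eta> M L q k c \<le> a"
proof -
  have "sup_norm L (multi_deriv \<beta> (cut_poly \<eta> L q k c)) / lam L q ^ mi_order \<beta> \<le> a" if \<beta>: "mi_order \<beta> \<le> M" for \<beta>
  proof -
    have "sup_norm L (multi_deriv \<beta> (cut_poly \<eta> L q k c)) \<le> a * lam L q ^ mi_order \<beta>"
      unfolding sup_norm_def using b[OF \<beta>] L torus_nonempty[OF L] by (intro cSUP_least) (auto simp: pos_divide_le_eq)
    then show ?thesis using L by (simp add: pos_divide_le_eq)
  qed
  then show ?thesis
    unfolding atom_size_def using finite_multi_indices mi_order_zero
    by (subst Max_le_iff) (auto intro!: exI[of _ 0])
qed

lemma atom_size_nonneg:
  assumes "L > 0" "bump \<eta>"
  shows "0 \<le> atom_size \<eta> M L q k c"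
  using multi_deriv_le_atom_size[OF assms, of 0 M 0 q k c] torus_nonempty[OF assms(1)]
  by (auto simp: mi_order_zero intro: order_trans[OF norm_ge_zero])

lemma cut_poly_le_atom_size:
  assumes "L > 0" "bump \<eta>" "x \<in> torus L"
  shows "norm (cut_poly \<eta> L q k c x) \<le> atom_size \<eta> M L q k c"
  using multi_deriv_le_atom_size[OF assms(1,2) _ assms(3), of 0 M q k c]
  by (simp add: mi_order_zero multi_deriv_def)

text \<open>Atom sizes are seminorms of the coefficient vector.\<close>

lemma atom_size_lipschitz:
  assumes L: "L > 0" and \<eta>: "bump \<eta>"
  shows "\<exists>K. \<forall>k c d. \<bar>atom_size \<eta> M L q k c - atom_size \<eta> M L q k d\<bar> \<le> K * coef_sum L q (\<lambda>k. c k - d k)"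
proof -
  obtain K where K: "K \<ge> 0" "\<forall>k c \<beta> x. mi_order \<beta> \<le> M \<longrightarrow>
    scaled_deriv \<eta> L q k c \<beta> x \<le> K * coef_sum L q c"
    using multi_deriv_cut_poly_coef_bound[OF L \<eta>, of M q] by blast
  have one: "atom_size \<eta> M L q k c \<le> atom_size \<eta> M L q k d + K * coef_sum L q (\<lambda>k. c k - d k)" for k c d
  proof (rule atom_size_least[OF L])
    fix \<beta> x assume \<beta>: "mi_order \<beta> \<le> M" and x: "x \<in> torus L"
    let ?D = "\<lambda>c. multi_deriv \<beta> (cut_poly \<eta> L q k c) x"
    have "?D c = ?D d + ?D (\<lambda>k. c k - d k)" by (simp add: multi_deriv_cut_poly_diff[OF L \<eta>])
    then have "norm (?D c) \<le> norm (?D d) + norm (?D (\<lambda>k. c k - d k))" by (simp only: norm_triangle_ineq)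
    then have "norm (?D c) / lam L q ^ mi_order \<beta> \<le> norm (?D d) / lam L q ^ mi_order \<beta> + norm (?D (\<lambda>k. c k - d k)) / lam L q ^ mi_order \<beta>"
      unfolding add_divide_distrib[symmetric] using L by (intro divide_right_mono) (auto simp: less_imp_le)
    also have "\<dots> \<le> atom_size \<eta> M L q k d + K * coef_sum L q (\<lambda>k. c k - d k)"
      by (intro add_mono multi_deriv_le_atom_size[OF L \<eta> \<beta> x] K(2)[rule_format, OF \<beta>])
    finally show "norm (?D c) / lam L q ^ mi_order \<beta> \<le> atom_size \<eta> M L q k d + K * coef_sum L q (\<lambda>k. c k - d k)" .
  qed
  show ?thesis
  proof (intro exI[of _ K] allI)
    fix k and c d :: "real ^ 3 \<Rightarrow> complex ^ 3"
    show "\<bar>atom_size \<eta> M L q k c - atom_size \<eta> M L q k d\<bar> \<le> K * coef_sum L q (\<lambda>k. c k - d k)"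
      using one[of k c d] one[of k d c] by (simp add: norm_minus_commute abs_le_iff)
  qed
qed

lemma atom_size_measurable:
  assumes L: "L > 0" and \<eta>: "bump \<eta>" and c: "\<And>\<kappa>. \<kappa> \<in> lp_freqs L q \<Longrightarrow> (\<lambda>t. c t \<kappa>) \<in> borel_measurable N"
  shows "(\<lambda>t. atom_size \<eta> M L q k (c t)) \<in> borel_measurable N"
proof -
  obtain K where K: "\<forall>k c d. \<bar>atom_size \<eta> M L q k c - atom_size \<eta> M L q k d\<bar> \<le> K * coef_sum L q (\<lambda>k. c k - d k)"
    using atom_size_lipschitz[OF L \<eta>, of M q] by blast
  show ?thesis
    by (rule borel_measurable_finitely_lipschitz[OF finite_torus_freqs[OF L] K[rule_format, of k]]) (rule c)
qed

section \<open>The cubes of all atom sizes at one time\<close>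

definition adjacent_offsets :: "(int ^ 3) set" where "adjacent_offsets = {d. \<forall>i. \<bar>d $ i\<bar> \<le> 1}"

lemma finite_adjacent_offsets [simp]: "finite adjacent_offsets"
proof -
  have "adjacent_offsets = {d. \<forall>i. d $ i \<in> {-1..1}}" by (auto simp: adjacent_offsets_def abs_le_iff)
  moreover have "finite {d :: int ^ 3. \<forall>i. d $ i \<in> {-1..1}}" by (rule finite_vec_componentwise) simp
  ultimately show ?thesis by (simp only:)
qed

text \<open>Bounded overlap: the offset determines the cube modulo the period.\<close>

lemma card_adjacent_cubes:
  "card {k \<in> cube_index q. \<exists>d\<in>adjacent_offsets. \<forall>i. 2 ^ q dvd a i - (k $ i + d $ i)} \<le> card adjacent_offsets"
proof -
  let ?K = "{k \<in> cube_index q. \<exists>d\<in>adjacent_offsets. \<forall>i. 2 ^ q dvd a i - (k $ i + d $ i)}"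
  have sub: "?K \<subseteq> (\<lambda>d. index_mod (2 ^ q) (\<chi> i. a i - d $ i)) ` adjacent_offsets"
  proof
    fix k assume "k \<in> ?K"
    then obtain d where k: "k \<in> cube_index q" and d: "d \<in> adjacent_offsets" "\<And>i. 2 ^ q dvd a i - (k $ i + d $ i)" by blast
    have "k $ i = (a i - d $ i) mod 2 ^ q" for i
    proof -
      have "2 ^ q dvd (a i - d $ i) - k $ i" using d(2)[of i] by (simp add: algebra_simps)
      then have "(a i - d $ i) mod 2 ^ q = k $ i mod 2 ^ q" by (simp add: mod_eq_dvd_iff)
      then show ?thesis using k by (simp add: cube_index_def)
    qed
    then have "k = index_mod (2 ^ q) (\<chi> i. a i - d $ i)" by (simp add: index_mod_def vec_eq_iff)
    then show "k \<in> (\<lambda>d. index_mod (2 ^ q) (\<chi> i. a i - d $ i)) ` adjacent_offsets" using d(1) by blast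
  qed
  show "card ?K \<le> card adjacent_offsets" using card_mono[OF finite_imageI[OF finite_adjacent_offsets] sub] card_image_le[OF finite_adjacent_offsets] by (rule order_trans)
qed

text \<open>Write \<open>P\<close> for the polynomial with coefficients \<open>c\<close>.  Every normalised derivative of an atom is
dominated near a point \<open>x\<close> by suprema of derivatives \<open>\<partial>^B P\<close> over the grid cell of \<open>x\<close>, and it vanishes
unless that cell lies in a cube adjacent to \<open>k\<close>.  So \<open>s\<^sub>q\<^sub>k^3\<close> is bounded by a sum over these cells, each
cell is counted a bounded number of times as \<open>k\<close> varies, and Bernstein's inequality followed by
\<open>cell_cubes_le_integral\<close> bounds the sum over all cells.\<close>

theorem sum_atom_size_cubes:
  assumes \<eta>: "bump \<eta>"
  shows "\<exists>C>0. \<forall>L q c. L > 0 \<longrightarrow>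
    (\<Sum>k\<in>cube_index q. atom_size \<eta> M L q k c ^ 3)
      \<le> C * lam L q ^ 3 * cubes_integral L (lp_poly L q c)"
proof -
  obtain C where C: "C > 0" "\<forall>L q k c \<beta> x. L > 0 \<longrightarrow> mi_order \<beta> \<le> M \<longrightarrow>
    scaled_deriv \<eta> L q k c \<beta> x
      \<le> C * (\<Sum>B\<in>short_lists M. norm (lp_poly L q (foldr deriv_coef B c) x) / lam L q ^ length B)"
    using multi_deriv_cut_poly_bound[OF \<eta>, of M] by blast
  define m where "m = real (card (short_lists M))"
  define C2 where "C2 = (\<Sum>B\<in>short_lists M. (8 * pi) ^ (3 * length B))"
  have C2: "C2 \<ge> 0" by (simp add: C2_def sum_nonneg)
  define Cf where "Cf = C ^ 3 * m\<^sup>2 * real (card adjacent_offsets) * C2 * (32 * 256 ^ 3)"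
  have Cf0: "Cf \<ge> 0" using C(1) C2 by (simp add: Cf_def)
  have main: "(\<Sum>k\<in>cube_index q. atom_size \<eta> M L q k c ^ 3)
      \<le> Cf * lam L q ^ 3 * cubes_integral L (lp_poly L q c)" if L: "L > 0" for L q c
  proof -
    \<comment> \<open>The grid has \<open>128\<close> nodes per unit of degree and \<open>256\<close> cells along each side of a dyadic cube.\<close>
    let ?F = "lp_freqs L q" and ?n = "2 ^ (q + 1) :: nat" and ?N = "2 ^ (q + 8) :: nat" and ?l = "lam L q"
    have l: "?l > 0" using L by simp
    let ?P = "\<lambda>B. trig_poly ?F (foldr deriv_coef B c)"
    let ?I = "cubes_integral L (trig_poly ?F c)" and ?S = "cell_cubes L ?N (trig_poly ?F c)"
    define W where "W g = (\<Sum>B\<in>short_lists M. (cell_sup L ?N (?P B) g / ?l ^ length B) ^ 3)" for g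
    have S0: "0 \<le> cell_sup L ?N (?P B) g" for B g by (intro cell_sup_nonneg continuous_on_trig_poly)
    have W0: "W g \<ge> 0" for g unfolding W_def using S0 l by (intro sum_nonneg zero_le_power divide_nonneg_pos) auto
    \<comment> \<open>The grid cells inside the cubes adjacent to \<open>k\<close>.\<close>
    define G where "G k = {g \<in> index_box ?N. \<exists>d\<in>adjacent_offsets. \<forall>i. 2 ^ q dvd g $ i div 256 - (k $ i + d $ i)}" for k :: "int ^ 3"
    have finG: "finite (G k)" for k by (simp add: G_def)
    define R where "R k = C ^ 3 * m\<^sup>2 * (\<Sum>g\<in>G k. W g)" for k
    have R0: "R k \<ge> 0" for k using C(1) W0 by (simp add: R_def sum_nonneg)
    have size: "atom_size \<eta> M L q k c ^ 3 \<le> R k" for k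
    proof -
      have "atom_size \<eta> M L q k c \<le> root 3 (R k)"
      proof (rule atom_size_least[OF L])
        fix \<beta> x assume \<beta>: "mi_order \<beta> \<le> M" and x: "x \<in> torus L"
        let ?v = "norm (multi_deriv \<beta> (cut_poly \<eta> L q k c) x) / ?l ^ mi_order \<beta>"
        show "?v \<le> root 3 (R k)"
        proof (cases "multi_deriv \<beta> (cut_poly \<eta> L q k c) x = 0")
          case True
          then show ?thesis using R0 by simp
        next
          case False
          obtain d where d: "\<And>i. \<bar>d $ i\<bar> \<le> 1" "\<And>i. 2 ^ q dvd \<lfloor>x $ i / ell L q\<rfloor> - (k $ i + d $ i)"
            using multi_deriv_cut_poly_support[OF L \<eta> False] by blast
          define g where "g = ((\<chi> i. \<lfloor>x $ i * real ?N / L\<rfloor>) :: int ^ 3)"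
          have gdiv: "g $ i div 256 = \<lfloor>x $ i / ell L q\<rfloor>" for i
          proof -
            have "x $ i / ell L q = x $ i * real ?N / L / real_of_int 256" by (simp add: ell_def power_add)
            then show ?thesis using floor_divide_real_eq_div[of 256 "x $ i * real ?N / L"] by (simp add: g_def)
          qed
          have "g \<in> index_box ?N"
            using x L by (auto simp: g_def index_box_def torus_def floor_less_iff field_simps)
          then have gG: "g \<in> G k" unfolding G_def mem_Collect_eq gdiv adjacent_offsets_def using d by blast
          have "x \<in> half_box (cell_point L ?N g 0) (L / real ?N)"
            unfolding floor_cell[OF L zero_less_power[OF zero_less_numeral]] by (simp add: g_def)
          then obtain h where h: "h \<in> cbox 0 1" "x = cell_point L ?N g h"
            using half_box_cell_point[OF L] by (metis zero_less_numeral zero_less_power)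
          have val: "norm (?P B x) \<le> cell_sup L ?N (?P B) g" for B
            unfolding h(2) by (rule cell_sup_upper[OF continuous_on_trig_poly h(1)])
          let ?a = "\<lambda>B. cell_sup L ?N (?P B) g / ?l ^ length B"
          have a0: "?a B \<ge> 0" for B using S0 l by simp
          have "?v \<le> C * (\<Sum>B\<in>short_lists M. norm (?P B x) / ?l ^ length B)" by (rule C(2)[rule_format, OF L \<beta>])
          also have "\<dots> \<le> C * (\<Sum>B\<in>short_lists M. ?a B)"
            using C(1) val l by (intro mult_left_mono sum_mono divide_right_mono) auto
          finally have "?v ^ 3 \<le> (C * (\<Sum>B\<in>short_lists M. ?a B)) ^ 3" using l by (intro power_mono) auto
          also have "\<dots> = C ^ 3 * (\<Sum>B\<in>short_lists M. 1 * ?a B) ^ 3" by (simp add: power_mult_distrib)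
          also have "\<dots> \<le> C ^ 3 * ((\<Sum>B\<in>short_lists M. 1)\<^sup>2 * (\<Sum>B\<in>short_lists M. 1 * ?a B ^ 3))"
            using C(1) a0 by (intro mult_left_mono weighted_cube_mean) auto
          also have "\<dots> = C ^ 3 * m\<^sup>2 * W g" by (simp add: m_def W_def)
          also have "\<dots> \<le> R k" unfolding R_def using C(1) gG finG W0 by (intro mult_left_mono member_le_sum) auto
          finally have "root 3 (?v ^ 3) \<le> root 3 (R k)" by simp
          then show ?thesis using l by (simp add: real_root_power_cancel)
        qed
      qed
      then have "atom_size \<eta> M L q k c ^ 3 \<le> root 3 (R k) ^ 3"
        using atom_size_nonneg[OF L \<eta>] by (intro power_mono)
      then show ?thesis using R0 by simp
    qed
    have "(\<Sum>k\<in>cube_index q. \<Sum>g\<in>G k. W g) = (\<Sum>g\<in>index_box ?N. \<Sum>k\<in>{k \<in> cube_index q. \<exists>d\<in>adjacent_offsets. \<forall>i. 2 ^ q dvd g $ i div 256 - (k $ i + d $ i)}. W g)"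
      unfolding G_def using L by (intro sum.swap_restrict) (auto simp: cube_index_eq)
    also have "\<dots> \<le> (\<Sum>g\<in>index_box ?N. real (card adjacent_offsets) * W g)"
      unfolding sum_constant using W0 card_adjacent_cubes by (intro sum_mono mult_right_mono of_nat_mono) auto
    also have "\<dots> = real (card adjacent_offsets) * (\<Sum>B\<in>short_lists M. cell_cubes L ?N (?P B) / ?l ^ (3 * length B))"
      unfolding W_def sum_distrib_left[symmetric] cell_cubes_def
      by (subst sum.swap) (simp add: power_divide sum_divide_distrib power_mult[symmetric] mult.commute)
    also have "\<dots> \<le> real (card adjacent_offsets) * (\<Sum>B\<in>short_lists M. (8 * pi) ^ (3 * length B) * ?S)"
    proof (intro mult_left_mono sum_mono)
      fix B :: "3 list"
      have "cell_cubes L ?N (?P B) \<le> (4 * pi * real ?n / L) ^ (3 * length B) * ?S"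
        by (rule bernstein_cell_cubes_iterated[OF L]) (auto simp: power_add)
      also have "4 * pi * real ?n / L = 8 * pi * ?l" by (simp add: lam_def)
      finally have "cell_cubes L ?N (?P B) / ?l ^ (3 * length B) \<le> (8 * pi * ?l) ^ (3 * length B) * ?S / ?l ^ (3 * length B)"
        using l by (intro divide_right_mono) auto
      then show "cell_cubes L ?N (?P B) / ?l ^ (3 * length B) \<le> (8 * pi) ^ (3 * length B) * ?S"
        using l by (simp add: power_mult_distrib)
    qed simp
    also have "\<dots> = real (card adjacent_offsets) * C2 * ?S"
      by (simp add: C2_def sum_distrib_right)
    also have "\<dots> \<le> real (card adjacent_offsets) * C2 * (32 * 256 ^ 3 * ?l ^ 3 * ?I)"
    proof (intro mult_left_mono)
      have "(L / real ?N) ^ 3 * ?S \<le> 32 * ?I"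
        by (rule cell_cubes_le_integral[OF L, where n = ?n]) (auto simp: power_add)
      then have scaled: "(256 * ?l) ^ 3 * ((L / real ?N) ^ 3 * ?S) \<le> (256 * ?l) ^ 3 * (32 * ?I)"
        using l by (intro mult_left_mono) auto
      have "(256 * ?l) ^ 3 * ((L / real ?N) ^ 3 * a) = a" for a
      proof -
        have "256 * ?l * (L / real ?N) = 1" using L by (simp add: lam_def power_add)
        then have "(256 * ?l) ^ 3 * (L / real ?N) ^ 3 = 1" by (metis power_mult_distrib power_one)
        then show ?thesis by (simp only: mult.assoc[symmetric] mult_1_left)
      qed
      with scaled have "?S \<le> (256 * ?l) ^ 3 * (32 * ?I)"
        by (simp only:)
      then show "?S \<le> 32 * 256 ^ 3 * ?l ^ 3 * ?I"
        by (simp only: power_mult_distrib mult_ac)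
    qed (simp add: C2)
    finally have total: "(\<Sum>k\<in>cube_index q. \<Sum>g\<in>G k. W g)
      \<le> real (card adjacent_offsets) * C2 * (32 * 256 ^ 3 * ?l ^ 3 * ?I)" .
    have "(\<Sum>k\<in>cube_index q. atom_size \<eta> M L q k c ^ 3) \<le> (\<Sum>k\<in>cube_index q. R k)" by (intro sum_mono size)
    also have "\<dots> = C ^ 3 * m\<^sup>2 * (\<Sum>k\<in>cube_index q. \<Sum>g\<in>G k. W g)" by (simp add: R_def sum_distrib_left)
    also have "\<dots> \<le> C ^ 3 * m\<^sup>2 * (real (card adjacent_offsets) * C2 * (32 * 256 ^ 3 * ?l ^ 3 * ?I))"
      using C(1) by (intro mult_left_mono total) auto
    finally show ?thesis by (simp only: Cf_def mult_ac)
  qed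
  show ?thesis
  proof (intro exI[of _ "Cf + 1"] conjI allI impI)
    fix L q c assume L: "(L :: real) > 0"
    have "0 \<le> cubes_integral L (lp_poly L q c)"
      unfolding set_lebesgue_integral_def by (intro Bochner_Integration.integral_nonneg) auto
    then have "Cf * lam L q ^ 3 * cubes_integral L (lp_poly L q c)
       \<le> (Cf + 1) * lam L q ^ 3 * cubes_integral L (lp_poly L q c)"
      using L by (intro mult_right_mono) (auto simp: less_imp_le)
    with main[OF L, of q c] show "(\<Sum>k\<in>cube_index q. atom_size \<eta> M L q k c ^ 3)
       \<le> (Cf + 1) * lam L q ^ 3 * cubes_integral L (lp_poly L q c)" by linarith
  qed (use Cf0 in simp)
qed

section \<open>Borel versions of the time-dependent coefficients\<close>

lemma Omega_borel: "Omega L T \<in> sets borel"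
  unfolding Omega_def torus_eq_half_box by (simp add: borel_prod[symmetric])

lemma vec_lambda_measurable:
  fixes f :: "3 \<Rightarrow> 'a \<Rightarrow> complex"
  assumes "\<And>i. f i \<in> borel_measurable N"
  shows "(\<lambda>t. \<chi> i. f i t) \<in> borel_measurable N"
proof -
  let ?e = "\<lambda>i a. \<chi> j :: 3. if j = i then a else (0 :: complex)"
  have "continuous_on UNIV (\<lambda>a. if j = i then a else (0 :: complex))" for i j :: 3
    by (cases "j = i") simp_all
  then have "?e i \<in> borel_measurable borel" for i
    by (intro borel_measurable_continuous_onI continuous_on_vec_lambda)
  then have "(\<lambda>t. \<Sum>i\<in>UNIV. ?e i (f i t)) \<in> borel_measurable N"
    using assms by (intro borel_measurable_sum measurable_compose[of "f i" N borel "?e i" for i])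
  moreover have "(\<Sum>i\<in>UNIV. ?e i (f i t)) = (\<chi> i. f i t)" for t
    by (simp add: vec_eq_iff)
  ultimately show ?thesis by simp
qed

text \<open>A Lebesgue measurable field on space-time is a Borel field almost everywhere, and by Fubini the two
agree almost everywhere in space for almost all times.  The Fourier coefficients of a Borel field
depend on time in a Borel way.  One null set serves all frequencies.\<close>

lemma fourier_coeff_borel_version:
  assumes u: "(\<lambda>(t, x). u t x) \<in> borel_measurable (lebesgue_on (Omega L T))"
  obtains c N where "\<And>k. c k \<in> borel_measurable (borel :: real measure)" "N \<in> null_sets lborel"
    "\<And>t k. t \<in> {0..T} \<Longrightarrow> t \<notin> N \<Longrightarrow> fourier_coeff L (u t) k = c k t"
proof -
  define g where "g i z = indicator (Omega L T) z * (u (fst z) (snd z) $ i)" for i z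
  have "g i \<in> borel_measurable lebesgue" for i
  proof -
    have m: "(\<lambda>z. indicator (Omega L T) z *\<^sub>R (case z of (t, x) \<Rightarrow> u t x)) \<in> borel_measurable lebesgue"
      using u Omega_borel[of L T] by (subst (asm) borel_measurable_restrict_space_iff) auto
    have eq: "g i = (\<lambda>z. (indicator (Omega L T) z *\<^sub>R (case z of (t, x) \<Rightarrow> u t x)) $ i)"
      by (auto simp: g_def fun_eq_iff)
    show ?thesis unfolding eq by (rule measurable_compose[OF m vec_nth_measurable])
  qed
  then have "\<forall>i. \<exists>g'. g' \<in> borel_measurable lborel \<and> (AE z in lborel. g i z = g' z)"
    using completion_ex_borel_measurable_real[of "g i" lborel for i] by blast
  from choice[OF this] obtain g' where "\<forall>i. g' i \<in> borel_measurable lborel \<and> (AE z in lborel. g i z = g' i z)" ..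
  then have g': "\<And>i. g' i \<in> borel_measurable lborel" "\<And>i. AE z in lborel. g i z = g' i z"
    by blast+
  have g'm [measurable]: "g' i \<in> borel_measurable (lborel \<Otimes>\<^sub>M lborel)" for i
    using g'(1) by (simp add: lborel_prod)
  have "AE t in lborel. AE x in lborel. \<forall>i. g i (t, x) = g' i (t, x)"
  proof (rule lborel_pair.AE_pair)
    show "AE z in lborel \<Otimes>\<^sub>M lborel. \<forall>i. g i z = g' i z"
      unfolding lborel_prod AE_all_countable using g'(2) by blast
  qed
  then obtain N where N: "N \<in> null_sets lborel" "\<And>t. t \<notin> N \<Longrightarrow> AE x in lborel. \<forall>i. g i (t, x) = g' i (t, x)"
    by (elim AE_E) (auto simp: null_sets_def)
  define e where "e k x = exp (- 2 * pi * \<i> * complex_of_real (k \<bullet> x))" for k x :: "real ^ 3"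
  have e [measurable]: "e k \<in> borel_measurable borel" for k
    unfolding e_def by (intro borel_measurable_continuous_onI continuous_intros)
  define c where "c k t = (\<chi> i. complex_of_real (1 / L ^ 3) * (LINT x | lborel. complex_of_real (g' i (t, x)) * e k x))" for k t
  show ?thesis
  proof (rule that[of c N])
    show "c k \<in> borel_measurable borel" for k
    proof -
      have "(\<lambda>t. LINT x | lborel. complex_of_real (g' i (t, x)) * e k x) \<in> borel_measurable lborel" for i
        by (rule lborel.borel_measurable_lebesgue_integral) measurable
      then show ?thesis
        unfolding c_def measurable_lborel1 by (intro vec_lambda_measurable borel_measurable_times borel_measurable_const) auto
    qed
    fix t k assume t: "t \<in> {0..T}" "t \<notin> N"
    have "(LINT x : torus L | lebesgue. complex_of_real (u t x $ i) * e k x) = (LINT x | lborel. complex_of_real (g' i (t, x)) * e k x)" for i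
    proof -
      have bor: "(\<lambda>x. complex_of_real (g' i (t, x)) * e k x) \<in> borel_measurable borel"
        by measurable
      have ae: "AE x in lebesgue. complex_of_real (g' i (t, x)) * e k x = indicator (torus L) x *\<^sub>R (complex_of_real (u t x $ i) * e k x)"
      proof (rule AE_mp[OF AE_completion[OF N(2)[OF t(2)]]], rule AE_I2, rule impI)
        fix x assume "\<forall>i. g i (t, x) = g' i (t, x)"
        then have "g' i (t, x) = g i (t, x)" by simp
        also have "\<dots> = indicator (torus L) x * (u t x $ i)"
          using t(1) by (simp add: g_def Omega_def indicator_def)
        finally show "complex_of_real (g' i (t, x)) * e k x = indicator (torus L) x *\<^sub>R (complex_of_real (u t x $ i) * e k x)"
          by (simp add: scaleR_conv_of_real)
      qed
      have bl: "(\<lambda>x. complex_of_real (g' i (t, x)) * e k x) \<in> borel_measurable lborel" using bor by simp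
      note bc = measurable_completion[OF bl]
      have "(LINT x : torus L | lebesgue. complex_of_real (u t x $ i) * e k x) = (LINT x | lebesgue. complex_of_real (g' i (t, x)) * e k x)"
        unfolding set_lebesgue_integral_def
        by (rule integral_cong_AE[OF bc borel_measurable_AE[OF bc ae] ae, symmetric])
      then show ?thesis by (simp only: integral_completion[OF bl])
    qed
    then show "fourier_coeff L (u t) k = c k t"
      by (simp add: fourier_coeff_def c_def e_def)
  qed (rule N)
qed

text \<open>The offsets that define the enlarged cubes \<open>Q^*\<close>.\<close>

definition star_offsets :: "(int ^ 3) set" where "star_offsets = {d. norm (int_vec d) < 3}"

lemma finite_star_offsets: "finite star_offsets"
proof (rule finite_subset)
  show "star_offsets \<subseteq> {d. \<forall>i. d $ i \<in> {-3..3}}"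
  proof (intro subsetI CollectI allI)
    fix d i assume "d \<in> star_offsets"
    then have "\<bar>real_of_int (d $ i)\<bar> < 3"
      using component_le_norm_cart[of "int_vec d" i] by (simp add: star_offsets_def)
    then show "d $ i \<in> {-3..3}" by auto
  qed
  show "finite {d :: int ^ 3. \<forall>i. d $ i \<in> {-3..3}}" by (rule finite_vec_componentwise) simp
qed

section \<open>Active times at one frequency\<close>

text \<open>A field together with Borel versions \<open>c\<close> of its Fourier coefficients, valid for the times in \<open>[0, T]\<close>
outside the null set \<open>N\<close>, and the constant \<open>C\<close> of the inequality for the cubes of the atom
sizes.\<close>

locale active_setting =
  fixes chi \<eta> :: "real ^ 3 \<Rightarrow> real" and M :: nat and C L T :: real and \<sigma> :: "nat \<Rightarrow> real" and u :: "real \<Rightarrow> real ^ 3 \<Rightarrow> real ^ 3"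
    and c :: "real ^ 3 \<Rightarrow> real \<Rightarrow> complex ^ 3" and N :: "real set"
  assumes chi: "lp_cutoff chi" and \<eta>: "mollifier \<eta>" and L: "L > 0" and T: "T > 0"
    and \<sigma>: "\<And>q. \<sigma> q > 0"
    and cubes_integrable: "\<And>q. integrable (lebesgue_on (Omega L T)) (lp_norm_pow chi L u q 3)"
    and c_borel: "\<And>k. c k \<in> borel_measurable borel" and N: "N \<in> null_sets lborel"
    and c: "\<And>t k. t \<in> {0..T} \<Longrightarrow> t \<notin> N \<Longrightarrow> fourier_coeff L (u t) k = c k t"
    and C0: "C > 0" and C: "\<And>q c. (\<Sum>k\<in>cube_index q. atom_size \<eta> M L q k c ^ 3)
      \<le> C * lam L q ^ 3 * cubes_integral L (lp_poly L q c)"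
begin

abbreviation "vol q \<equiv> active_volume chi L T u q"
abbreviation "region q \<equiv> active_region chi \<eta> M L T \<sigma> u q"
abbreviation "limit_slice t \<equiv> limsup_slice chi \<eta> M L T \<sigma> u t"
abbreviation "block_pow p q \<equiv> lp_norm_pow chi L u q p"

lemma bump_eta: "bump \<eta>"
  using \<eta> by (simp add: mollifier_def bump_def)

text \<open>The unnormalised integrals over space-time; \<open>avg\<close> is this divided by \<open>T L^3\<close>.\<close>

definition moment where "moment p q = (LINT z : Omega L T | lebesgue. block_pow p q z)"

definition coef where "coef q t k = complex_of_real (lp_symbol chi L q k) *s c k t"

lemma coef_borel [measurable]: "(\<lambda>t. coef q t k) \<in> borel_measurable borel"
proof -
  have "linear (\<lambda>v :: complex ^ 3. a *s v)" for a
    by (intro linearI) (auto simp: vec_eq_iff algebra_simps scaleR_conv_of_real)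
  then have "bounded_linear (\<lambda>v :: complex ^ 3. a *s v)" for a by (simp add: linear_conv_bounded_linear)
  then show ?thesis
    unfolding coef_def
    by (intro measurable_compose[OF c_borel borel_measurable_continuous_onI[OF linear_continuous_on]])
qed

lemma coef_eq: "t \<in> {0..T} \<Longrightarrow> t \<notin> N \<Longrightarrow> coef q t = lp_coef chi L q (u t)"
  by (simp add: fun_eq_iff coef_def lp_coef_def c)

abbreviation "block_poly q t \<equiv> lp_poly L q (coef q t)"

lemma block_poly_borel [measurable]: "(\<lambda>z. block_poly q (fst z) (snd z)) \<in> borel_measurable (borel \<Otimes>\<^sub>M borel)"
proof -
  have 1: "continuous_on UNIV (\<lambda>z :: complex \<times> (complex ^ 3). fst z *s snd z)"
    unfolding vector_scalar_mult_def by (intro continuous_on_vec_lambda continuous_intros)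
  have "(\<lambda>z. (cis (2 * pi * (k \<bullet> snd z)), coef q (fst z) k)) \<in> borel \<Otimes>\<^sub>M borel \<rightarrow>\<^sub>M borel \<Otimes>\<^sub>M borel" for k
  proof -
    have "(\<lambda>x. cis (2 * pi * (k \<bullet> x))) \<in> borel_measurable borel"
      by (intro borel_measurable_continuous_onI) (auto intro!: continuous_intros simp: cis_conv_exp)
    note [measurable] = this
    show ?thesis by measurable
  qed
  then have "(\<lambda>z. (cis (2 * pi * (k \<bullet> snd z)), coef q (fst z) k)) \<in> borel \<Otimes>\<^sub>M borel \<rightarrow>\<^sub>M borel" for k
    by (simp add: borel_prod)
  from measurable_compose[OF this borel_measurable_continuous_onI[OF 1]]
  show ?thesis unfolding trig_poly_def by (intro borel_measurable_sum) simp
qed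

definition slice_cubes where "slice_cubes q t = cubes_integral L (block_poly q t)"

lemma slice_cubes_nn_integral:
  "ennreal (slice_cubes q t) = (\<integral>\<^sup>+ x. ennreal (indicator (torus L) x * norm (block_poly q t x) ^ 3) \<partial>lborel)"
  unfolding slice_cubes_def set_lebesgue_integral_def real_scaleR_def
proof (rule nn_integral_eq_integral[symmetric])
  have "continuous_on UNIV (\<lambda>x. norm (block_poly q t x) ^ 3)" by (intro continuous_intros)
  from set_integrable_torus[OF this] show "integrable lborel (\<lambda>x. indicator (torus L) x * norm (block_poly q t x) ^ 3)"
    by (simp add: set_integrable_def)
qed auto

lemma moment_lborel:
  shows "integrable lborel (\<lambda>z. indicator (Omega L T) z * norm (block_poly q (fst z) (snd z)) ^ 3)"
    and "moment 3 q = (LINT z | lborel. indicator (Omega L T) z * norm (block_poly q (fst z) (snd z)) ^ 3)"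
proof -
  let ?f = "\<lambda>z. indicator (Omega L T) z *\<^sub>R block_pow 3 q z"
  let ?g = "\<lambda>z. indicator (Omega L T) z * norm (block_poly q (fst z) (snd z)) ^ 3"
  have g: "?g \<in> borel_measurable borel"
    using Omega_borel[of L T] block_poly_borel[of q] by (intro borel_measurable_times borel_measurable_indicator borel_measurable_power borel_measurable_norm) (auto simp: borel_prod)
  have int: "integrable lebesgue ?f"
    using cubes_integrable[of q] Omega_borel[of L T] by (subst (asm) integrable_restrict_space) auto
  have "N \<times> (UNIV :: (real ^ 3) set) \<in> null_sets lborel"
    using lborel.times_in_null_sets1[OF N, of UNIV] by (simp add: lborel_prod)
  then have "AE z in lborel. z \<notin> N \<times> (UNIV :: (real ^ 3) set)" by (rule AE_not_in)
  then have ae: "AE z in lebesgue. ?f z = ?g z"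
  proof (intro AE_completion, elim AE_mp, intro AE_I2 impI)
    fix z assume "z \<notin> N \<times> (UNIV :: (real ^ 3) set)"
    moreover obtain t x where "z = (t, x)" by force
    ultimately show "?f z = ?g z"
      by (auto simp: lp_norm_pow_def lp_block_eq_trig_poly[OF chi L] coef_eq Omega_def indicator_def split: prod.splits)
  qed
  have g1: "?g \<in> borel_measurable lborel" using g by simp
  have g2: "?g \<in> borel_measurable lebesgue" by (rule measurable_completion[OF g1])
  have "integrable lebesgue ?g"
    by (rule Bochner_Integration.integrable_cong_AE_imp[OF int g2]) (rule ae)
  then show "integrable lborel ?g" by (simp only: integrable_completion[OF g1])
  have "moment 3 q = (LINT z | lebesgue. ?g z)"
    unfolding moment_def set_lebesgue_integral_def
    by (rule integral_cong_AE[OF borel_measurable_integrable[OF int] g2 ae])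
  then show "moment 3 q = (LINT z | lborel. ?g z)" by (simp only: integral_completion[OF g1])
qed

lemma nn_integral_slice_cubes: "(\<integral>\<^sup>+ t. indicator {0..T} t * ennreal (slice_cubes q t) \<partial>lborel) = ennreal (moment 3 q)"
  and slice_cubes_borel: "(\<lambda>t. indicator {0..T} t * ennreal (slice_cubes q t)) \<in> borel_measurable borel"
proof -
  let ?g = "\<lambda>z. ennreal (indicator (Omega L T) z * norm (block_poly q (fst z) (snd z)) ^ 3)"
  have g: "?g \<in> borel_measurable (lborel \<Otimes>\<^sub>M lborel)"
    using borel_measurable_integrable[OF moment_lborel(1), of q] by (simp add: lborel_prod)
  have inner: "indicator {0..T} t * ennreal (slice_cubes q t) = (\<integral>\<^sup>+ x. ?g (t, x) \<partial>lborel)" for t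
    unfolding slice_cubes_nn_integral by (cases "t \<in> {0..T}") (auto simp: Omega_def indicator_def intro!: nn_integral_cong)
  show "(\<lambda>t. indicator {0..T} t * ennreal (slice_cubes q t)) \<in> borel_measurable borel"
    unfolding inner using lborel.borel_measurable_nn_integral_fst[OF g] by simp
  have "(\<integral>\<^sup>+ t. indicator {0..T} t * ennreal (slice_cubes q t) \<partial>lborel) = (\<integral>\<^sup>+ z. ?g z \<partial>(lborel \<Otimes>\<^sub>M lborel))"
    unfolding inner by (rule lborel.nn_integral_fst[OF g])
  also have "\<dots> = (\<integral>\<^sup>+ z. ?g z \<partial>lborel)" by (simp add: lborel_prod)
  also have "\<dots> = ennreal (moment 3 q)"
    unfolding moment_lborel(2) by (rule nn_integral_eq_integral[OF moment_lborel(1)]) auto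
  finally show "(\<integral>\<^sup>+ t. indicator {0..T} t * ennreal (slice_cubes q t) \<partial>lborel) = ennreal (moment 3 q)" .
qed

abbreviation "level_size q k t \<equiv> atom_size \<eta> M L q k (coef q t)"

lemma size_borel: "(\<lambda>t. level_size q k t) \<in> borel_measurable borel"
  by (rule atom_size_measurable[OF L bump_eta coef_borel])

text \<open>Chebyshev's inequality in time for each cube, then \<open>sum_atom_size_cubes\<close> under the time integral.\<close>

lemma sum_level_sets:
  assumes \<theta>: "\<theta> > 0"
  shows "(\<Sum>k\<in>cube_index q. emeasure lborel {t \<in> {0..T}. level_size q k t > \<theta>}) \<le> ennreal (C * lam L q ^ 3 * moment 3 q / \<theta> ^ 3)"
proof -
  let ?E = "\<lambda>k. {t \<in> {0..T}. level_size q k t > \<theta>}"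
  have E: "?E k \<in> sets lborel" for k
    using size_borel[of q k] by measurable
  have nn: "level_size q k t \<ge> 0" for k t by (rule atom_size_nonneg[OF L bump_eta])
  have I0: "moment 3 q \<ge> 0" unfolding moment_lborel(2) by (intro Bochner_Integration.integral_nonneg) auto
  have K0: "C * lam L q ^ 3 \<ge> 0"
    by (rule less_imp_le[OF mult_pos_pos[OF C0 zero_less_power[OF lam_pos[OF L]]]])
  have J0: "slice_cubes q t \<ge> 0" for t unfolding slice_cubes_def set_lebesgue_integral_def by (intro Bochner_Integration.integral_nonneg) auto
  have "ennreal (\<theta> ^ 3) * (\<Sum>k\<in>cube_index q. emeasure lborel (?E k)) = (\<Sum>k\<in>cube_index q. \<integral>\<^sup>+ t. ennreal (\<theta> ^ 3) * indicator (?E k) t \<partial>lborel)"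
    using E by (simp add: sum_distrib_left nn_integral_cmult_indicator)
  also have "\<dots> = (\<integral>\<^sup>+ t. (\<Sum>k\<in>cube_index q. ennreal (\<theta> ^ 3) * indicator (?E k) t) \<partial>lborel)"
    using E by (intro nn_integral_sum[symmetric]) auto
  also have "\<dots> \<le> (\<integral>\<^sup>+ t. ennreal (C * lam L q ^ 3) * (indicator {0..T} t * ennreal (slice_cubes q t)) \<partial>lborel)"
  proof (rule nn_integral_mono)
    fix t
    show "(\<Sum>k\<in>cube_index q. ennreal (\<theta> ^ 3) * indicator (?E k) t) \<le> ennreal (C * lam L q ^ 3) * (indicator {0..T} t * ennreal (slice_cubes q t))"
    proof (cases "t \<in> {0..T}")
      case True
      have "(\<Sum>k\<in>cube_index q. ennreal (\<theta> ^ 3) * indicator (?E k) t) \<le> (\<Sum>k\<in>cube_index q. ennreal (level_size q k t ^ 3))"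
        using \<theta> by (intro sum_mono) (auto simp: indicator_def intro!: ennreal_leI power_mono)
      also have "\<dots> = ennreal (\<Sum>k\<in>cube_index q. level_size q k t ^ 3)" using nn by (intro sum_ennreal) auto
      also have "\<dots> \<le> ennreal (C * lam L q ^ 3 * slice_cubes q t)" unfolding slice_cubes_def by (intro ennreal_leI C)
      finally show ?thesis using True K0 J0 by (simp add: ennreal_mult)
    qed auto
  qed
  also have "\<dots> = ennreal (C * lam L q ^ 3 * moment 3 q)"
    using slice_cubes_borel[of q] K0 I0 by (subst nn_integral_cmult) (auto simp: nn_integral_slice_cubes ennreal_mult)
  finally have *: "ennreal (\<theta> ^ 3) * (\<Sum>k\<in>cube_index q. emeasure lborel (?E k)) \<le> ennreal (C * lam L q ^ 3 * moment 3 q)" .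
  have "(\<Sum>k\<in>cube_index q. emeasure lborel (?E k)) = ennreal (1 / \<theta> ^ 3) * (ennreal (\<theta> ^ 3) * (\<Sum>k\<in>cube_index q. emeasure lborel (?E k)))"
    using \<theta> by (simp add: mult.assoc[symmetric] ennreal_mult[symmetric])
  also have "\<dots> \<le> ennreal (1 / \<theta> ^ 3) * ennreal (C * lam L q ^ 3 * moment 3 q)" by (intro mult_left_mono *) simp
  also have "\<dots> = ennreal (C * lam L q ^ 3 * moment 3 q / \<theta> ^ 3)" using \<theta> K0 I0 by (subst ennreal_mult[symmetric]) auto
  finally show ?thesis .
qed

lemma integral_lebesgue_on_Omega: "integral\<^sup>L (lebesgue_on (Omega L T)) f = (LINT z : Omega L T | lebesgue. f z)" for f :: "real \<times> (real ^ 3) \<Rightarrow> real"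
  using Omega_borel[of L T] unfolding set_lebesgue_integral_def by (subst integral_restrict_space) auto

lemma Omega_finite: "emeasure lebesgue (Omega L T) < \<infinity>"
proof -
  have "emeasure lborel (Omega L T) = emeasure lborel {0..T} * emeasure lborel (torus L)"
    unfolding Omega_def lborel_prod[symmetric] torus_eq_half_box by (rule lborel.emeasure_pair_measure_Times) auto
  also have "\<dots> < \<infinity>" using T L by (simp add: torus_eq_half_box emeasure_half_box ennreal_mult_less_top)
  finally show ?thesis using Omega_borel[of L T] by simp
qed

text \<open>On a set of finite measure \<open>r^2 \<le> 1 + r^3\<close> is integrable with \<open>r^3\<close>.\<close>

lemma squares_integrable: "integrable (lebesgue_on (Omega L T)) (block_pow 2 q)"
proof -
  let ?n = "\<lambda>z. norm (lp_block chi L q (u (fst z)) (snd z))"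
  have eq: "block_pow p q = (\<lambda>z. ?n z ^ p)" for p by (auto simp: lp_norm_pow_def)
  have "(\<lambda>z. (root 3 (block_pow 3 q z))\<^sup>2) \<in> borel_measurable (lebesgue_on (Omega L T))"
    using borel_measurable_integrable[OF cubes_integrable[of q]] by measurable
  then have meas: "block_pow 2 q \<in> borel_measurable (lebesgue_on (Omega L T))"
    by (simp add: eq real_root_power_cancel)
  have "integrable (lebesgue_on (Omega L T)) (\<lambda>z. 1 + block_pow 3 q z)"
    using cubes_integrable[of q] Omega_finite Omega_borel[of L T]
    by (intro Bochner_Integration.integrable_add) (auto simp: integrable_restrict_space integrable_indicator_iff)
  then show ?thesis
  proof (rule Bochner_Integration.integrable_bound[OF _ meas])
    have "r\<^sup>2 \<le> 1 + r ^ 3" if "r \<ge> 0" for r :: real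
    proof (cases "r \<le> 1")
      case True then show ?thesis using that by (simp add: power_le_one add_increasing2)
    next
      case False then show ?thesis using power_increasing[of 2 3 r] by linarith
    qed
    then show "AE z in lebesgue_on (Omega L T). norm (block_pow 2 q z) \<le> norm (1 + block_pow 3 q z)"
      by (auto simp: eq)
  qed
qed

lemma moment_pos:
  assumes "\<not> lp_vanishes chi L T u q" "p = 2 \<or> p = 3"
  shows "moment p q > 0"
proof -
  have int: "integrable (lebesgue_on (Omega L T)) (block_pow p q)"
    using assms(2) cubes_integrable squares_integrable by auto
  have nn: "block_pow p q z \<ge> 0" for z by (cases z) (simp add: lp_norm_pow_def)
  have "moment p q = integral\<^sup>L (lebesgue_on (Omega L T)) (block_pow p q)"
    unfolding moment_def integral_lebesgue_on_Omega ..
  moreover have "integral\<^sup>L (lebesgue_on (Omega L T)) (block_pow p q) \<noteq> 0"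
  proof
    assume "integral\<^sup>L (lebesgue_on (Omega L T)) (block_pow p q) = 0"
    then have "AE z in lebesgue_on (Omega L T). block_pow p q z = 0"
      using integral_nonneg_eq_0_iff_AE[OF int] nn by simp
    then have "lp_vanishes chi L T u q"
      unfolding lp_vanishes_def using assms(2) by (auto elim!: AE_mp simp: lp_norm_pow_def)
    then show False using assms(1) by simp
  qed
  ultimately show ?thesis using nn Bochner_Integration.integral_nonneg[of "lebesgue_on (Omega L T)"] by (metis less_eq_real_def)
qed

lemma avg_eq: "avg L T (block_pow p q) = moment p q / (T * L ^ 3)"
  by (simp add: avg_def moment_def)

definition threshold where "threshold q = \<sigma> q * moment 3 q / moment 2 q"

lemma threshold_eq: "\<sigma> q * avg L T (block_pow 3 q) / avg L T (block_pow 2 q) = threshold q"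
  using L T by (simp add: avg_eq threshold_def)

text \<open>The times at which a cube is active, for the Borel version of the field.\<close>

definition level where
  "level q k = (if lp_vanishes chi L T u q then {} else {t \<in> {0..T}. level_size q k t > threshold q})"

lemma level_borel: "level q k \<in> sets borel"
  using size_borel[of q k] unfolding level_def by (cases "lp_vanishes chi L T u q"; simp; measurable)

lemma active_slice_eq:
  assumes "t \<in> {0..T}" "t \<notin> N"
  shows "active_slice chi \<eta> M L T \<sigma> u q t = \<Union> (dcube_star L q ` {k \<in> cube_index q. t \<in> level q k})"
  using assms atom_size_nonneg[OF L bump_eta]
  by (auto simp: active_slice_def level_def threshold_eq atom_s_eq_atom_size[OF chi L] coef_eq)

lemma active_volume_eq:
  "\<not> lp_vanishes chi L T u q \<Longrightarrow> vol q = moment 2 q ^ 3 / (moment 3 q ^ 2 * T)"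
  using L T by (simp add: active_volume_def avg_eq field_simps power2_eq_square power3_eq_cube)

lemma active_volume_nonneg: "vol q \<ge> 0"
  using T moment_pos[of q 2] by (cases "lp_vanishes chi L T u q") (auto simp: active_volume_eq, simp add: active_volume_def)

text \<open>With \<open>\<theta> = \<sigma>\<^sub>q I\<^sub>3 / I\<^sub>2\<close> the bound \<open>I\<^sub>3 / \<theta>^3\<close> equals \<open>\<sigma>\<^sub>q^{-3} I\<^sub>2^3 / I\<^sub>3^2 = \<sigma>\<^sub>q^{-3} V\<^sub>q T\<close>,
where \<open>I\<^sub>p\<close> denotes the integral of \<open>|u\<^sub>q|^p\<close>.\<close>

lemma sum_level_measure:
  shows "(\<Sum>k\<in>cube_index q. emeasure lborel (level q k)) \<le> ennreal (C * lam L q ^ 3 * (1 / \<sigma> q ^ 3) * vol q * T)"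
proof (cases "lp_vanishes chi L T u q")
  case False
  have I: "moment 3 q > 0" "moment 2 q > 0" using moment_pos[OF False] by auto
  have "(\<Sum>k\<in>cube_index q. emeasure lborel (level q k)) \<le> ennreal (C * lam L q ^ 3 * moment 3 q / threshold q ^ 3)"
    using False sum_level_sets[of "threshold q" q] I \<sigma>[of q] by (simp add: level_def threshold_def)
  also have "C * lam L q ^ 3 * moment 3 q / threshold q ^ 3 = C * lam L q ^ 3 * (1 / \<sigma> q ^ 3) * vol q * T"
    unfolding active_volume_eq[OF False] using I \<sigma>[of q] T
    by (simp add: threshold_def field_simps power2_eq_square power3_eq_cube)
  finally show ?thesis .
qed (simp add: level_def)

section \<open>Volume of the active regions\<close>

lemma dcube_star_eq: "dcube_star L q k = (\<Union>d\<in>star_offsets. dcube L q (k + d))"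
proof -
  have "{k' :: int ^ 3. norm ((\<chi> i. of_int (k' $ i - k $ i)) :: real ^ 3) < 3} = (\<lambda>d. k + d) ` star_offsets"
    by (auto simp: star_offsets_def image_iff intro!: exI[of _ "_ - k"])
  then show ?thesis by (simp add: dcube_star_def)
qed

lemma dcube_star_borel: "dcube_star L q k \<in> sets borel"
  unfolding dcube_star_eq using finite_star_offsets dcube_borel[OF L] by auto

lemma dcube_star_subset_torus: "dcube_star L q k \<subseteq> torus L"
  by (auto simp: dcube_star_eq dcube_iff[OF L])

lemma emeasure_dcube_star: "emeasure lborel (dcube_star L q k) \<le> ennreal (real (card star_offsets) * ell L q ^ 3)"
proof -
  have "emeasure lborel (dcube_star L q k) \<le> (\<Sum>d\<in>star_offsets. emeasure lborel (dcube L q (k + d)))"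
    unfolding dcube_star_eq using finite_star_offsets dcube_borel[OF L] by (intro emeasure_subadditive_finite) auto
  also have "\<dots> \<le> (\<Sum>d\<in>star_offsets. ennreal (ell L q ^ 3))" by (intro sum_mono emeasure_dcube_le[OF L])
  also have "\<dots> = ennreal (real (card star_offsets) * ell L q ^ 3)" using ell_pos[OF L, of q] by (simp add: ennreal_mult less_imp_le ennreal_of_nat_eq_real_of_nat)
  finally show ?thesis .
qed

text \<open>Up to the null set of exceptional times the region is a finite union of products of a set of
active times with a cube \<open>Q^*\<close>.  This gives measurability, by completeness of Lebesgue measure, and
the volume.\<close>

lemma active_region_volume:
  shows "region q \<in> sets lebesgue"
    and "emeasure lebesgue (region q) \<le> ennreal (card star_offsets * C * (1 / \<sigma> q ^ 3) * vol q * T)"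
proof -
  let ?A = "region q"
  define A' where "A' = (\<Union>k\<in>cube_index q. level q k \<times> dcube_star L q k)"
  define Z where "Z = N \<times> (UNIV :: (real ^ 3) set)"
  have Z: "Z \<in> null_sets lborel"
    unfolding Z_def using lborel.times_in_null_sets1[OF N, of UNIV] by (simp add: lborel_prod)
  have piece: "level q k \<times> dcube_star L q k \<in> sets borel" for k
    using level_borel dcube_star_borel by (simp add: borel_prod[symmetric])
  have A': "A' \<in> sets borel" unfolding A'_def using piece by (intro sets.finite_UN) auto
  have lev: "level q k \<subseteq> {0..T}" for k by (auto simp: level_def)
  have eq: "?A - Z = A' - Z"
    using dcube_star_subset_torus lev
    by (fastforce simp: active_region_def A'_def Z_def Omega_def active_slice_eq)
  have "?A \<inter> Z \<in> sets lebesgue" using Z by (intro null_setsD2) (auto simp: null_sets_completion_iff2)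
  moreover have "A' - Z \<in> sets lebesgue" using A' Z by auto
  moreover have "?A = (A' - Z) \<union> (?A \<inter> Z)" using eq by blast
  ultimately show "?A \<in> sets lebesgue" by (metis sets.Un)
  have "emeasure lebesgue ?A \<le> emeasure lebesgue (A' \<union> Z)"
    using eq A' Z by (intro emeasure_mono) auto
  also have "\<dots> = emeasure lborel (A' \<union> Z)" using A' Z by auto
  also have "\<dots> = emeasure lborel A'" using Z A' by (intro emeasure_Un_null_set) auto
  also have "\<dots> \<le> (\<Sum>k\<in>cube_index q. emeasure lborel (level q k \<times> dcube_star L q k))"
    unfolding A'_def using piece by (intro emeasure_subadditive_finite) auto
  also have "\<dots> = (\<Sum>k\<in>cube_index q. emeasure lborel (level q k) * emeasure lborel (dcube_star L q k))"
    using level_borel dcube_star_borel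
    by (intro sum.cong refl) (simp add: lborel_prod[symmetric] lborel.emeasure_pair_measure_Times)
  also have "\<dots> \<le> (\<Sum>k\<in>cube_index q. emeasure lborel (level q k) * ennreal (real (card star_offsets) * ell L q ^ 3))"
    by (intro sum_mono mult_left_mono emeasure_dcube_star) auto
  also have "\<dots> = (\<Sum>k\<in>cube_index q. emeasure lborel (level q k)) * ennreal (real (card star_offsets) * ell L q ^ 3)"
    by (simp add: sum_distrib_right)
  also have "\<dots> \<le> ennreal (C * lam L q ^ 3 * (1 / \<sigma> q ^ 3) * vol q * T) * ennreal (real (card star_offsets) * ell L q ^ 3)"
    by (intro mult_right_mono sum_level_measure) auto
  also have "\<dots> = ennreal (C * lam L q ^ 3 * (1 / \<sigma> q ^ 3) * vol q * T * (real (card star_offsets) * ell L q ^ 3))"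
    using C0 T \<sigma>[of q] active_volume_nonneg[of q] less_imp_le[OF lam_pos[OF L, of q]] less_imp_le[OF ell_pos[OF L, of q]]
    by (intro ennreal_mult[symmetric] mult_nonneg_nonneg) auto
  also have "C * lam L q ^ 3 * (1 / \<sigma> q ^ 3) * vol q * T * (real (card star_offsets) * ell L q ^ 3)
    = card star_offsets * C * (1 / \<sigma> q ^ 3) * vol q * T * (ell L q * lam L q) ^ 3"
    by (simp add: power_mult_distrib)
  finally show "emeasure lebesgue ?A \<le> ennreal (card star_offsets * C * (1 / \<sigma> q ^ 3) * vol q * T)"
    by (simp add: ell_lam[OF L])
qed

section \<open>Concentration on the active regions\<close>

text \<open>The cutoffs sum to one, so the block is the sum of its atoms.  An atom that does not vanish at \<open>x\<close>
belongs to a cube whose enlargement contains \<open>x\<close>; that cube is inactive, and the atom is bounded by its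
size, that is by the threshold.\<close>

lemma block_small_off_active:
  assumes nv: "\<not> lp_vanishes chi L T u q" and x: "x \<in> torus L" "x \<notin> active_slice chi \<eta> M L T \<sigma> u q t"
  shows "norm (lp_block chi L q (u t) x) \<le> card adjacent_offsets * threshold q"
proof -
  let ?c = "lp_coef chi L q (u t)" and ?P = "lp_block chi L q (u t) x"
  let ?K = "{k \<in> cube_index q. \<exists>d\<in>adjacent_offsets. \<forall>i. 2 ^ q dvd \<lfloor>x $ i / ell L q\<rfloor> - (k $ i + d $ i)}"
  have P: "?P = lp_poly L q ?c x" by (simp add: lp_block_eq_trig_poly[OF chi L])
  have th: "threshold q > 0" using moment_pos[OF nv] \<sigma>[of q] by (simp add: threshold_def)
  have cut: "norm (cut_poly \<eta> L q k ?c x) \<le> (if k \<in> ?K then threshold q else 0)" if k: "k \<in> cube_index q" for k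
  proof (cases "cut_poly \<eta> L q k ?c x = 0")
    case True then show ?thesis using th by simp
  next
    case False
    then have "multi_deriv 0 (cut_poly \<eta> L q k ?c) x \<noteq> 0" by (simp add: multi_deriv_def)
    from multi_deriv_cut_poly_support[OF L bump_eta this] obtain d :: "int ^ 3"
      where d: "\<And>i. \<bar>d $ i\<bar> \<le> 1" "\<And>i. 2 ^ q dvd \<lfloor>x $ i / ell L q\<rfloor> - (k $ i + d $ i)" by blast
    have "norm (int_vec d) < 3"
    proof -
      have "(norm (int_vec d))\<^sup>2 = (\<Sum>i\<in>UNIV. (of_int (d $ i))\<^sup>2)"
        by (simp add: norm_vec_def L2_set_def sum_nonneg)
      also have "\<dots> \<le> (\<Sum>i\<in>(UNIV :: 3 set). 1)"
      proof (intro sum_mono)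
        fix i
        have "\<bar>real_of_int (d $ i)\<bar> \<le> 1" using d(1)[of i] by linarith
        then show "(real_of_int (d $ i))\<^sup>2 \<le> 1" by (simp add: abs_square_le_1)
      qed
      also have "\<dots> < 3\<^sup>2" by simp
      finally show ?thesis by (rule power2_less_imp_less) simp
    qed
    then have "d \<in> star_offsets" by (simp add: star_offsets_def)
    moreover have "x \<in> dcube L q (k + d)" using x(1) d(2) by (simp add: dcube_iff[OF L])
    ultimately have star: "x \<in> dcube_star L q k" unfolding dcube_star_eq by blast
    have "\<not> \<bar>atom_s chi \<eta> M L u q k t\<bar> > threshold q"
    proof
      assume "\<bar>atom_s chi \<eta> M L u q k t\<bar> > threshold q"
      then have "x \<in> active_slice chi \<eta> M L T \<sigma> u q t"
        using nv k star unfolding active_slice_def threshold_eq by auto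
      then show False using x(2) by simp
    qed
    then have "atom_size \<eta> M L q k ?c \<le> threshold q"
      by (simp add: atom_s_eq_atom_size[OF chi L])
    then have "norm (cut_poly \<eta> L q k ?c x) \<le> threshold q"
      using cut_poly_le_atom_size[OF L bump_eta x(1), of q k ?c M] by linarith
    moreover have "k \<in> ?K" using k d by (auto simp: adjacent_offsets_def intro!: exI[of _ d])
    ultimately show ?thesis by simp
  qed
  have "?P = (\<Sum>k\<in>cube_index q. cube_cutoff \<eta> L q k x) *\<^sub>R ?P" by (simp add: sum_cube_cutoff[OF L \<eta>])
  also have "\<dots> = (\<Sum>k\<in>cube_index q. cut_poly \<eta> L q k ?c x)"
    by (simp add: scaleR_left.sum cut_poly_def P)
  finally have "norm ?P \<le> (\<Sum>k\<in>cube_index q. norm (cut_poly \<eta> L q k ?c x))" by (metis norm_sum)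
  also have "\<dots> \<le> (\<Sum>k\<in>cube_index q. if k \<in> ?K then threshold q else 0)" by (intro sum_mono cut)
  also have "\<dots> = (\<Sum>k\<in>?K. threshold q)"
    by (intro sum.mono_neutral_cong_right) auto
  also have "\<dots> = real (card ?K) * threshold q" by simp
  also have "\<dots> \<le> card adjacent_offsets * threshold q"
    using th card_adjacent_cubes[of q "\<lambda>i. \<lfloor>x $ i / ell L q\<rfloor>"] by (intro mult_right_mono) auto
  finally show ?thesis .
qed

text \<open>Off the region one factor of \<open>|u\<^sub>q|^3\<close> is at most a constant times the threshold, and the threshold times
\<open>\<integral> |u\<^sub>q|^2\<close> is \<open>\<sigma>\<^sub>q \<integral> |u\<^sub>q|^3\<close>.\<close>

lemma active_region_integrals:
  assumes A: "region q \<in> sets lebesgue"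
  shows "(1 - card adjacent_offsets * \<sigma> q) * moment 3 q \<le> (LINT z : region q | lebesgue. block_pow 3 q z)"
    and "(LINT z : region q | lebesgue. block_pow 3 q z) \<le> moment 3 q"
proof -
  let ?A = "region q" and ?f = "\<lambda>p z. block_pow p q z"
  have sub: "?A \<subseteq> Omega L T" by (auto simp: active_region_def)
  have intO: "integrable lebesgue (\<lambda>z. indicator (Omega L T) z * ?f p z)" if "p = 2 \<or> p = 3" for p
    using that cubes_integrable[of q] squares_integrable[of q] Omega_borel[of L T]
    by (auto simp: integrable_restrict_space)
  have intA: "integrable lebesgue (\<lambda>z. indicator ?A z * ?f 3 z)"
    using set_integrable_subset[of lebesgue "Omega L T" "?f 3" ?A] intO[of 3] A sub by (simp add: set_integrable_def)
  have nn: "?f p z \<ge> 0" for p z by (cases z) (simp add: lp_norm_pow_def)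
  show "(LINT z : ?A | lebesgue. ?f 3 z) \<le> moment 3 q"
    unfolding moment_def set_lebesgue_integral_def real_scaleR_def
    using sub nn by (intro integral_mono intA intO) (auto simp: indicator_def)
  show "(1 - card adjacent_offsets * \<sigma> q) * moment 3 q \<le> (LINT z : ?A | lebesgue. ?f 3 z)"
  proof (cases "lp_vanishes chi L T u q")
    case True
    have "AE z in lebesgue_on (Omega L T). ?f 3 z = 0"
      using True unfolding lp_vanishes_def by (auto elim!: AE_mp simp: lp_norm_pow_def)
    then have "moment 3 q = 0" unfolding moment_def integral_lebesgue_on_Omega[symmetric] by (rule integral_eq_zero_AE)
    moreover have "?A = {}" using True by (auto simp: active_region_def active_slice_def)
    ultimately show ?thesis by (simp add: set_lebesgue_integral_def)
  next
    case False
    have I: "moment 3 q > 0" "moment 2 q > 0" using moment_pos[OF False] by auto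
    have "moment 3 q - (LINT z : ?A | lebesgue. ?f 3 z) = (LINT z | lebesgue. indicator (Omega L T) z * ?f 3 z - indicator ?A z * ?f 3 z)"
      unfolding moment_def set_lebesgue_integral_def real_scaleR_def using intA intO[of 3] by simp
    also have "\<dots> \<le> (LINT z | lebesgue. (card adjacent_offsets * threshold q) * (indicator (Omega L T) z * ?f 2 z))"
    proof (rule integral_mono)
      fix z
      show "indicator (Omega L T) z * ?f 3 z - indicator ?A z * ?f 3 z \<le> (card adjacent_offsets * threshold q) * (indicator (Omega L T) z * ?f 2 z)"
      proof (cases "z \<in> Omega L T - ?A")
        case True
        obtain t x where z: "z = (t, x)" by force
        have x: "x \<in> torus L" "x \<notin> active_slice chi \<eta> M L T \<sigma> u q t"
          using True by (auto simp: z Omega_def active_region_def)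
        have "norm (lp_block chi L q (u t) x) * (norm (lp_block chi L q (u t) x))\<^sup>2 \<le> card adjacent_offsets * threshold q * (norm (lp_block chi L q (u t) x))\<^sup>2"
          by (intro mult_right_mono block_small_off_active False x) auto
        then show ?thesis using True by (simp add: z lp_norm_pow_def power3_eq_cube power2_eq_square mult.assoc)
      next
        case False': False
        have "threshold q > 0" using I \<sigma>[of q] by (simp add: threshold_def)
        then show ?thesis using False' nn[of 2 z] nn[of 3 z] sub by (auto simp: indicator_def)
      qed
    qed (use intA intO[of 3] intO[of 2] in auto)
    also have "\<dots> = card adjacent_offsets * threshold q * moment 2 q"
      by (simp add: moment_def set_lebesgue_integral_def)
    also have "\<dots> = card adjacent_offsets * \<sigma> q * moment 3 q" using I by (simp add: threshold_def)
    finally show ?thesis by (simp add: algebra_simps)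
  qed
qed

end

section \<open>Hausdorff measure of an upper limit set\<close>

lemma torus_dist_le: "torus_dist L x y \<le> norm (x - y + L *\<^sub>R int_vec m)"
  unfolding torus_dist_def by (rule cINF_lower) (auto intro: bdd_belowI[of _ 0])

lemma torus_dist_nonneg: "0 \<le> torus_dist L x y"
  unfolding torus_dist_def by (rule cINF_greatest) auto

lemma diam_pow_le:
  assumes d: "\<And>x y. 0 \<le> d x y" and r: "\<And>x y. x \<in> U \<Longrightarrow> y \<in> U \<Longrightarrow> d x y \<le> r" and "0 < r" "0 \<le> s"
  shows "diam_pow d s U \<le> r powr s"
proof (cases "U = {} \<or> s = 0")
  case False
  then have "diam_wrt d U \<le> r" unfolding diam_wrt_def using r by (auto intro!: cSUP_least)
  moreover have "0 \<le> diam_wrt d U"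
  proof -
    obtain x where "x \<in> U" using False by blast
    then have "d x x \<le> (SUP (x, y) \<in> U \<times> U. d x y)"
      using r by (intro cSUP_upper2[where x = "(x, x)"]) (auto intro!: bdd_aboveI2[of _ _ r])
    then show ?thesis using d[of x x] False by (simp add: diam_wrt_def)
  qed
  ultimately show ?thesis using False assms(4) by (auto simp: diam_pow_def intro!: powr_mono2)
qed (use assms(3) in \<open>auto simp: diam_pow_def\<close>)

lemma diam_pow_empty: "diam_pow d s {} = 0"
  by (simp add: diam_pow_def)

text \<open>The convergence half of the Borel-Cantelli argument: the sets of index beyond \<open>p\<close> cover \<open>A\<close>, their
diameters become small, and their total weight is a tail of a convergent series.\<close>

lemma hausdorff_measure_limsup_zero:
  fixes K :: "nat \<Rightarrow> 'k set" and W :: "nat \<Rightarrow> 'k \<Rightarrow> 'a set"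
  assumes fin: "\<And>q. finite (K q)"
    and cover: "\<And>x p. x \<in> A \<Longrightarrow> \<exists>q>p. \<exists>k\<in>K q. x \<in> W q k"
    and diam: "\<And>q k x y. k \<in> K q \<Longrightarrow> x \<in> W q k \<Longrightarrow> y \<in> W q k \<Longrightarrow> d x y \<le> r q" and r: "r \<longlonglongrightarrow> 0"
    and w: "\<And>q k. k \<in> K q \<Longrightarrow> diam_pow d s (W q k) \<le> w q"
    and sum: "summable (\<lambda>q. real (card (K q)) * w q)" and w0: "\<And>q. 0 \<le> w q"
  shows "hausdorff_measure d s A = 0"
proof -
  have "hausdorff_premeasure d s \<delta> A \<le> ennreal \<epsilon>" if \<delta>: "\<delta> > 0" and \<epsilon>: "\<epsilon> > 0" for \<delta> \<epsilon> :: real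
  proof -
    let ?a = "\<lambda>q. real (card (K q)) * w q"
    obtain p1 where p1: "\<And>q. q \<ge> p1 \<Longrightarrow> r q < \<delta>"
      using order_tendstoD(2)[OF r \<delta>] by (auto simp: eventually_sequentially)
    obtain p2 where p2: "\<And>n. n \<ge> p2 \<Longrightarrow> norm (\<Sum>i. ?a (i + n)) < \<epsilon>"
      using suminf_exist_split[OF \<epsilon> sum] by blast
    define p where "p = max p1 p2"
    have "\<forall>q. \<exists>f. bij_betw f {..<card (K q)} (K q)"
      using ex_bij_betw_nat_finite[OF fin] by (auto simp: atLeast0LessThan)
    then obtain f where f: "\<And>q. bij_betw (f q) {..<card (K q)} (K q)" by metis
    \<comment> \<open>A doubly indexed cover, padded with empty sets, which the pairing function turns into a sequence.\<close>
    define V where "V = (\<lambda>(q, j). if q \<ge> p \<and> j < card (K q) then W q (f q j) else {})"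
    have V: "V (q, j) = (if q \<ge> p \<and> j < card (K q) then W q (f q j) else {})" for q j by (simp add: V_def)
    have fK: "j < card (K q) \<Longrightarrow> f q j \<in> K q" for q j using f[of q] by (auto simp: bij_betw_def)
    have "A \<subseteq> (\<Union>n. V (prod_decode n))"
    proof
      fix x assume "x \<in> A"
      then obtain q k where q: "q > p" "k \<in> K q" "x \<in> W q k" using cover by blast
      obtain j where "j < card (K q)" "f q j = k" using f[of q] q(2) unfolding bij_betw_def by (metis imageE lessThan_iff)
      then have "x \<in> V (prod_decode (prod_encode (q, j)))" using q by (simp add: V)
      then show "x \<in> (\<Union>n. V (prod_decode n))" by blast
    qed
    moreover have "d x y \<le> \<delta>" if "x \<in> V z" "y \<in> V z" for x y z
    proof -
      obtain q j where z: "z = (q, j)" by force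
      have "q \<ge> p" "j < card (K q)" "x \<in> W q (f q j)" "y \<in> W q (f q j)"
        using that by (auto simp: z V split: if_splits)
      then show ?thesis using diam[OF fK, of j q x y] p1[of q] by (simp add: p_def)
    qed
    ultimately have "hausdorff_premeasure d s \<delta> A \<le> (\<Sum>n. ennreal (diam_pow d s (V (prod_decode n))))"
      unfolding hausdorff_premeasure_def by (intro INF_lower2[of "\<lambda>n. V (prod_decode n)"]) auto
    also have "\<dots> = (\<Sum>q. \<Sum>j. ennreal (diam_pow d s (V (q, j))))"
      by (rule suminf_ennreal_2dimen[where f = "\<lambda>z. ennreal (diam_pow d s (V z))"]) simp
    also have "\<dots> \<le> (\<Sum>q. ennreal (if q \<ge> p then ?a q else 0))"
    proof (intro suminf_le summableI)
      fix q
      have "(\<Sum>j. ennreal (diam_pow d s (V (q, j)))) = (\<Sum>j<card (K q). ennreal (diam_pow d s (V (q, j))))"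
        by (rule suminf_finite) (auto simp: V diam_pow_def)
      also have "\<dots> \<le> (\<Sum>j<card (K q). ennreal (if q \<ge> p then w q else 0))"
        using w[OF fK] by (intro sum_mono ennreal_leI) (auto simp: V diam_pow_empty)
      also have "\<dots> = ennreal (if q \<ge> p then ?a q else 0)"
        using w0[of q] by (simp add: ennreal_mult ennreal_of_nat_eq_real_of_nat)
      finally show "(\<Sum>j. ennreal (diam_pow d s (V (q, j)))) \<le> ennreal (if q \<ge> p then ?a q else 0)" .
    qed
    also have "\<dots> = (\<Sum>q. ennreal (if q + p \<ge> p then ?a (q + p) else 0)) + (\<Sum>q<p. ennreal (if q \<ge> p then ?a q else 0))"
      by (rule suminf_offset) simp
    also have "\<dots> = (\<Sum>q. ennreal (?a (q + p)))" by simp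
    also have "\<dots> = ennreal (\<Sum>q. ?a (q + p))"
      using w0 sum by (intro suminf_ennreal2) (auto simp: summable_iff_shift[of ?a])
    also have "\<dots> \<le> ennreal \<epsilon>" using p2[of p] by (intro ennreal_leI) (auto simp: p_def)
    finally show ?thesis .
  qed
  then have "hausdorff_premeasure d s \<delta> A = 0" if "\<delta> > 0" for \<delta>
    using that ennreal_le_epsilon[of 0 "hausdorff_premeasure d s \<delta> A"] by auto
  then show ?thesis unfolding hausdorff_measure_def by (auto intro!: antisym SUP_least)
qed

lemma hausdorff_dim_le: "0 \<le> s \<Longrightarrow> hausdorff_measure d s A = 0 \<Longrightarrow> hausdorff_dim d A \<le> ereal s"
  by (auto simp: hausdorff_dim_def intro!: Inf_lower)

section \<open>Dimension of the upper limit of the active regions\<close>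

context active_setting
begin

text \<open>Lift both points to the cubes before periodisation.  Their coordinates differ from those of the
corner of the cube \<open>k\<close> by at most \<open>4 \<ell>\<close>, hence from each other by at most \<open>8 \<ell>\<close>, and there are three coordinates.\<close>

lemma dcube_star_diam:
  assumes "x \<in> dcube_star L q k" "y \<in> dcube_star L q k"
  shows "torus_dist L x y \<le> 24 * ell L q"
proof -
  have rep: "\<exists>x' m. (\<forall>i. \<bar>x' $ i - ell L q * of_int (k $ i)\<bar> \<le> 4 * ell L q) \<and> x = x' + L *\<^sub>R int_vec m"
    if x: "x \<in> dcube_star L q k" for x
  proof -
    obtain d where d: "d \<in> star_offsets" "x \<in> dcube L q (k + d)" using x unfolding dcube_star_eq by blast
    obtain x' where x': "x = torus_proj L x'"
      "\<And>i. ell L q * of_int ((k + d) $ i) \<le> x' $ i \<and> x' $ i < ell L q * (of_int ((k + d) $ i) + 1)"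
      using d(2) by (auto simp: dcube_def)
    obtain m where m: "torus_proj L x' = x' + L *\<^sub>R int_vec m" using torus_proj_diff[OF L] .
    have "\<bar>x' $ i - ell L q * of_int (k $ i)\<bar> \<le> 4 * ell L q" for i
    proof -
      have d3: "\<bar>real_of_int (d $ i)\<bar> \<le> 3"
        using component_le_norm_cart[of "int_vec d" i] d(1) by (simp add: star_offsets_def)
      then have "ell L q * \<bar>real_of_int (d $ i)\<bar> \<le> ell L q * 3" using L by (intro mult_left_mono) (auto simp: less_imp_le)
      then have "\<bar>ell L q * real_of_int (d $ i)\<bar> \<le> 3 * ell L q" using ell_pos[OF L, of q] by (simp add: abs_mult)
      then show ?thesis using x'(2)[of i] by (simp add: algebra_simps) linarith
    qed
    then show ?thesis using m x'(1) by (intro exI[of _ x'] exI[of _ m]) simp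
  qed
  obtain x' m where x': "\<And>i. \<bar>x' $ i - ell L q * of_int (k $ i)\<bar> \<le> 4 * ell L q" "x = x' + L *\<^sub>R int_vec m"
    using rep[OF assms(1)] by blast
  obtain y' m' where y': "\<And>i. \<bar>y' $ i - ell L q * of_int (k $ i)\<bar> \<le> 4 * ell L q" "y = y' + L *\<^sub>R int_vec m'"
    using rep[OF assms(2)] by blast
  have "torus_dist L x y \<le> norm (x - y + L *\<^sub>R int_vec (m' - m))" by (rule torus_dist_le)
  also have "x - y + L *\<^sub>R int_vec (m' - m) = x' - y'"
    by (simp add: x'(2) y'(2) vec_eq_iff algebra_simps)
  also have "norm (x' - y') \<le> (\<Sum>i\<in>UNIV. \<bar>(x' - y') $ i\<bar>)" by (rule norm_le_l1_cart)
  also have "\<dots> \<le> (\<Sum>i\<in>(UNIV :: 3 set). 8 * ell L q)"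
  proof (intro sum_mono)
    fix i show "\<bar>(x' - y') $ i\<bar> \<le> 8 * ell L q" using x'(1)[of i] y'(1)[of i] by simp
  qed
  finally show ?thesis by simp
qed

definition active_count where "active_count q t = card {k \<in> cube_index q. t \<in> level q k}"

text \<open>The expected value over time of the covering sum is finite.  For large \<open>q\<close> its \<open>q\<close>-th term is at
most a constant times \<open>\<sigma>\<^sub>q^{-3} 2^{-q(s-s')}\<close>, where \<open>s'\<close> lies strictly between the intermittency dimension
and \<open>s\<close>.\<close>

lemma active_count_summable:
  assumes subexp: "(\<lambda>q. ln (\<sigma> q) / real q) \<longlonglongrightarrow> 0"
    and s: "0 \<le> s" "intermittency_dim chi L T u < ereal s"
  shows "AE t in lborel. summable (\<lambda>q. real (active_count q t) * (24 * ell L q) powr s)"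
proof -
  obtain s' where s': "intermittency_dim chi L T u < ereal s'" "s' < s"
    using ereal_dense2[OF s(2)] by auto
  have ev: "\<forall>\<^sub>F q in sequentially. dim_q chi L T u q < ereal s'"
    using s'(1) unfolding intermittency_dim_def by (rule Limsup_lessD)
  \<comment> \<open>Half of the geometric decay \<open>2^{-q(s-s')} = exp(-6 \<epsilon> q)\<close> is spent on \<open>\<sigma>\<^sub>q^{-3} \<le> exp(3 \<epsilon> q)\<close>.\<close>
  define \<epsilon> where "\<epsilon> = (s - s') * ln 2 / 6"
  have \<epsilon>: "\<epsilon> > 0" using s'(2) by (simp add: \<epsilon>_def)
  have ev2: "\<forall>\<^sub>F q in sequentially. - \<epsilon> < ln (\<sigma> q) / real q"
    using \<epsilon> by (intro order_tendstoD(1)[OF subexp]) simp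
  let ?w = "\<lambda>q. (24 * ell L q) powr s"
  define B where "B q = ?w q * (C * lam L q ^ 3 * (1 / \<sigma> q ^ 3) * vol q * T)" for q
  have B0: "B q \<ge> 0" for q
    unfolding B_def using C0 T \<sigma>[of q] active_volume_nonneg[of q] less_imp_le[OF lam_pos[OF L, of q]]
    by (intro mult_nonneg_nonneg) auto
  have "summable B"
  proof (rule summable_comparison_test_ev)
    show "summable (\<lambda>q. (24 * L) powr s * C * T * exp (- 3 * \<epsilon>) ^ q)"
      using \<epsilon> by (intro summable_mult summable_geometric) auto
    show "\<forall>\<^sub>F q in sequentially. norm (B q) \<le> (24 * L) powr s * C * T * exp (- 3 * \<epsilon>) ^ q"
      using ev ev2 eventually_gt_at_top[of 0]
    proof eventually_elim
      case (elim q)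
      have V: "vol q \<le> L ^ 3 * 2 powr (- (real q * (3 - s')))"
      proof (cases "lp_vanishes chi L T u q")
        case True
        then show ?thesis using L by (simp add: active_volume_def)
      next
        case False
        have V0: "vol q > 0"
          unfolding active_volume_eq[OF False] using moment_pos[OF False, of 2] moment_pos[OF False, of 3] T by simp
        have "3 - log 2 (L ^ 3 / vol q) / real q < s'"
          using elim(1) False by (simp add: dim_q_def)
        then have "real q * (3 - s') < log 2 (L ^ 3 / vol q)"
          using elim(3) by (simp add: field_simps)
        then have "2 powr (real q * (3 - s')) < L ^ 3 / vol q"
          using L V0 by (simp add: less_log_iff)
        then have "vol q * 2 powr (real q * (3 - s')) < L ^ 3"
          using V0 by (simp add: pos_less_divide_eq mult.commute)
        then have "vol q \<le> L ^ 3 / 2 powr (real q * (3 - s'))"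
          by (subst pos_le_divide_eq) auto
        then show ?thesis by (simp only: powr_minus divide_inverse)
      qed
      have ls: "- (\<epsilon> * real q) < ln (\<sigma> q)" using elim(2,3) by (simp add: field_simps)
      have "1 / \<sigma> q ^ 3 = exp (- 3 * ln (\<sigma> q))"
        using \<sigma>[of q] by (simp add: exp_minus exp_of_nat_mult[of 3, simplified] field_simps)
      also have "\<dots> \<le> exp (3 * (\<epsilon> * real q))" using ls by simp
      finally have S: "1 / \<sigma> q ^ 3 \<le> exp (3 * (\<epsilon> * real q))" .
      have W: "?w q = (24 * L) powr s * 2 powr (- (real q * s))"
      proof -
        have "24 * ell L q = 24 * L * 2 powr (- real q)"
          by (simp add: ell_def powr_minus powr_realpow divide_inverse)
        then show ?thesis using L by (simp add: powr_mult powr_powr)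
      qed
      have "norm (B q) = B q" using B0[of q] by simp
      also have "\<dots> \<le> ?w q * (C * lam L q ^ 3 * exp (3 * (\<epsilon> * real q)) * (L ^ 3 * 2 powr (- (real q * (3 - s')))) * T)"
        unfolding B_def using S V C0 T active_volume_nonneg[of q] \<sigma>[of q] less_imp_le[OF lam_pos[OF L, of q]]
        by (intro mult_left_mono mult_right_mono mult_mono mult_nonneg_nonneg) auto
      also have "\<dots> = (24 * L) powr s * C * T * (2 powr (- (real q * s)) * 2 powr (3 * real q) * 2 powr (- (real q * (3 - s'))) * exp (3 * (\<epsilon> * real q)))"
      proof -
        have "lam L q ^ 3 * L ^ 3 = 2 powr (3 * real q)"
          using L by (simp add: lam_def power_divide powr_realpow[symmetric] powr_powr power_mult[symmetric] mult.commute flip: powr_numeral)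
        then show ?thesis unfolding W by (simp add: mult_ac)
      qed
      also have "2 powr (- (real q * s)) * 2 powr (3 * real q) * 2 powr (- (real q * (3 - s'))) * exp (3 * (\<epsilon> * real q)) = exp (- 3 * \<epsilon>) ^ q"
        unfolding powr_def exp_of_nat_mult[symmetric] by (simp add: exp_add[symmetric] \<epsilon>_def field_simps)
      finally show ?case .
    qed
  qed
  have lm: "(\<lambda>t. indicator (level q k) t :: ennreal) \<in> borel_measurable lborel" for q k
    using level_borel[of q k] by simp
  have cnt: "ennreal (real (active_count q t) * ?w q) = ennreal (?w q) * (\<Sum>k\<in>cube_index q. indicator (level q k) t)" for q t
  proof -
    have "(\<Sum>k\<in>cube_index q. indicator (level q k) t :: ennreal) = of_nat (active_count q t)"
      by (simp add: indicator_def sum.If_cases active_count_def Int_def)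
    then show ?thesis by (simp add: ennreal_mult ennreal_of_nat_eq_real_of_nat mult.commute)
  qed
  have meas: "(\<lambda>t. ennreal (real (active_count q t) * ?w q)) \<in> borel_measurable lborel" for q
  proof -
    note [measurable] = level_borel
    show ?thesis unfolding cnt by measurable
  qed
  have "(\<integral>\<^sup>+ t. (\<Sum>q. ennreal (real (active_count q t) * ?w q)) \<partial>lborel) = (\<Sum>q. \<integral>\<^sup>+ t. ennreal (real (active_count q t) * ?w q) \<partial>lborel)"
    by (rule nn_integral_suminf[OF meas])
  also have "\<dots> \<le> (\<Sum>q. ennreal (B q))"
  proof (intro suminf_le summableI)
    fix q
    have "(\<integral>\<^sup>+ t. ennreal (real (active_count q t) * ?w q) \<partial>lborel) = ennreal (?w q) * (\<Sum>k\<in>cube_index q. emeasure lborel (level q k))"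
      unfolding cnt using lm level_borel by (simp add: nn_integral_cmult nn_integral_sum)
    also have "\<dots> \<le> ennreal (?w q) * ennreal (C * lam L q ^ 3 * (1 / \<sigma> q ^ 3) * vol q * T)"
      by (intro mult_left_mono sum_level_measure) auto
    also have "\<dots> = ennreal (B q)"
      unfolding B_def using C0 T \<sigma>[of q] active_volume_nonneg[of q] less_imp_le[OF lam_pos[OF L, of q]]
      by (intro ennreal_mult[symmetric] mult_nonneg_nonneg) auto
    finally show "(\<integral>\<^sup>+ t. ennreal (real (active_count q t) * ?w q) \<partial>lborel) \<le> ennreal (B q)" .
  qed
  also have "\<dots> = ennreal (\<Sum>q. B q)" by (rule suminf_ennreal2[OF B0 \<open>summable B\<close>])
  finally have "(\<integral>\<^sup>+ t. (\<Sum>q. ennreal (real (active_count q t) * ?w q)) \<partial>lborel) \<noteq> \<infinity>"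
    by (auto simp: top_unique)
  then have "AE t in lborel. (\<Sum>q. ennreal (real (active_count q t) * ?w q)) \<noteq> \<infinity>"
    by (rule nn_integral_PInf_AE[rotated]) (rule borel_measurable_suminf_order[OF meas])
  then show ?thesis
  proof (rule AE_mp, intro AE_I2 impI)
    fix t assume "(\<Sum>q. ennreal (real (active_count q t) * ?w q)) \<noteq> \<infinity>"
    then show "summable (\<lambda>q. real (active_count q t) * ?w q)"
      by (intro summable_suminf_not_top) (simp_all only: infinity_ennreal_def zero_le_mult_iff of_nat_0_le_iff powr_ge_zero simp_thms)
  qed
qed

lemma limsup_slice_cover:
  assumes t: "t \<in> {0..T}" "t \<notin> N" and x: "x \<in> limit_slice t"
  shows "\<exists>q>p. \<exists>k\<in>{k \<in> cube_index q. t \<in> level q k}. x \<in> dcube_star L q k"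
proof -
  have "(t, x) \<in> (\<Union>q\<in>{max p 1<..}. region q)"
    using x unfolding limsup_slice_def limsup_region_def by auto
  then obtain q where q: "q > p" "x \<in> active_slice chi \<eta> M L T \<sigma> u q t"
    by (auto simp: active_region_def)
  then show ?thesis unfolding active_slice_eq[OF t] by blast
qed

lemma limsup_slice_hausdorff_zero:
  assumes t: "t \<in> {0..T}" "t \<notin> N" and s: "0 \<le> s"
    and sum: "summable (\<lambda>q. real (active_count q t) * (24 * ell L q) powr s)"
  shows "hausdorff_measure (torus_dist L) s (limit_slice t) = 0"
proof (rule hausdorff_measure_limsup_zero[where K = "\<lambda>q. {k \<in> cube_index q. t \<in> level q k}" and W = "dcube_star L"
      and r = "\<lambda>q. 24 * ell L q" and w = "\<lambda>q. (24 * ell L q) powr s"])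
  show "(\<lambda>q. 24 * ell L q) \<longlonglongrightarrow> 0"
  proof -
    have "(\<lambda>q. 24 * L * (1 / 2) ^ q) \<longlonglongrightarrow> 24 * L * 0"
      by (intro tendsto_mult tendsto_const LIMSEQ_power_zero) simp
    then show ?thesis by (simp add: ell_def power_divide)
  qed
  show "summable (\<lambda>q. real (card {k \<in> cube_index q. t \<in> level q k}) * (24 * ell L q) powr s)"
    using sum by (simp add: active_count_def)
  show "diam_pow (torus_dist L) s (dcube_star L q k) \<le> (24 * ell L q) powr s" for q k
    using L s by (intro diam_pow_le torus_dist_nonneg dcube_star_diam) auto
qed (use limsup_slice_cover[OF t] dcube_star_diam in auto)

text \<open>For \<open>s = 0\<close> the covering sum counts cubes, and a convergent series of integers has only finitely
many nonzero terms.\<close>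

lemma limsup_slice_empty:
  assumes t: "t \<in> {0..T}" "t \<notin> N"
    and sum: "summable (\<lambda>q. real (active_count q t) * (24 * ell L q) powr 0)"
  shows "limit_slice t = {}"
proof (rule ccontr)
  assume "limit_slice t \<noteq> {}"
  then obtain x where x: "x \<in> limit_slice t" by blast
  have "summable (\<lambda>q. real (active_count q t))" using sum L by (simp add: ell_def)
  then have "(\<lambda>q. real (active_count q t)) \<longlonglongrightarrow> 0" by (rule summable_LIMSEQ_zero)
  then have "\<forall>\<^sub>F q in sequentially. real (active_count q t) < 1" by (rule order_tendstoD) simp
  then obtain p where p: "\<And>q. q \<ge> p \<Longrightarrow> active_count q t = 0" by (auto simp: eventually_sequentially)
  obtain q k where "q > p" "k \<in> cube_index q" "t \<in> level q k" using limsup_slice_cover[OF t x, of p] by blast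
  then show False using p[of q] by (auto simp: active_count_def)
qed

end

lemma AE_on_interval:
  fixes T :: real
  assumes "N \<in> null_sets lborel" "AE t in lborel. P t" "\<And>t. t \<in> {0..T} \<Longrightarrow> t \<notin> N \<Longrightarrow> P t \<Longrightarrow> R t"
  shows "AE t in lebesgue_on {0..T}. R t"
proof -
  have "AE t in lebesgue. t \<notin> N \<and> P t"
    using AE_not_in[OF assms(1)] assms(2) by (intro AE_completion AE_conjI)
  then have "AE t in lebesgue. t \<in> {0..T} \<longrightarrow> R t" using assms(3) by (auto elim: AE_mp)
  then show ?thesis by (subst AE_restrict_space_iff) auto
qed

section \<open>Volume, concentration and dimension of the active regions\<close>

theorem theorem3p2:
  fixes chi \<eta> :: "real ^ 3 \<Rightarrow> real" and M :: nat
  assumes "lp_cutoff chi" and "mollifier \<eta>" and "M > 1"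
  shows "\<exists>c::real. c > 0 \<and>
    (\<forall>(L::real) (T::real) (\<sigma> :: nat \<Rightarrow> real) (u :: real \<Rightarrow> real ^ 3 \<Rightarrow> real ^ 3).
       L > 0 \<longrightarrow> T > 0 \<longrightarrow> threshold_seq \<sigma> \<longrightarrow> L2_field L T u \<longrightarrow>
       (\<forall>q. integrable (lebesgue_on (Omega L T)) (lp_norm_pow chi L u q 3)) \<longrightarrow>
       (\<forall>q. active_region chi \<eta> M L T \<sigma> u q \<in> sets lebesgue \<and>
            emeasure lebesgue (active_region chi \<eta> M L T \<sigma> u q)
              \<le> ennreal (c * (1 / \<sigma> q ^ 3) * active_volume chi L T u q * T) \<and>
            (1 - c * \<sigma> q) * (LINT z : Omega L T | lebesgue. lp_norm_pow chi L u q 3 z)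
              \<le> (LINT z : active_region chi \<eta> M L T \<sigma> u q | lebesgue. lp_norm_pow chi L u q 3 z) \<and>
            (LINT z : active_region chi \<eta> M L T \<sigma> u q | lebesgue. lp_norm_pow chi L u q 3 z)
              \<le> (LINT z : Omega L T | lebesgue. lp_norm_pow chi L u q 3 z)) \<and>
       (AE t in lebesgue_on {0..T}.
          hausdorff_dim (torus_dist L) (limsup_slice chi \<eta> M L T \<sigma> u t) \<le> intermittency_dim chi L T u) \<and>
       (intermittency_dim chi L T u < 0 \<longrightarrow>
          (AE t in lebesgue_on {0..T}. limsup_slice chi \<eta> M L T \<sigma> u t = {})))"
proof -
  have "bump \<eta>" using assms(2) by (simp add: mollifier_def bump_def)
  from sum_atom_size_cubes[OF this, of M] obtain C where C0: "C > 0" and C: "\<forall>L q c. L > 0 \<longrightarrow>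
    (\<Sum>k\<in>cube_index q. atom_size \<eta> M L q k c ^ 3)
      \<le> C * lam L q ^ 3 * cubes_integral L (lp_poly L q c)" by blast
  \<comment> \<open>The first summand serves the volume bound, the second the concentration.\<close>
  define c0 where "c0 = real (card star_offsets) * C + real (card adjacent_offsets) + 1"
  show ?thesis
  proof (intro exI[of _ c0] conjI allI impI)
    show "c0 > 0" using C0 by (simp add: c0_def add_nonneg_pos)
    fix L T :: real and \<sigma> :: "nat \<Rightarrow> real" and u :: "real \<Rightarrow> real ^ 3 \<Rightarrow> real ^ 3"
    assume L: "L > 0" and T: "T > 0" and thr: "threshold_seq \<sigma>" and u: "L2_field L T u"
      and int: "\<forall>q. integrable (lebesgue_on (Omega L T)) (lp_norm_pow chi L u q 3)"
    obtain c N where cN: "\<And>k. c k \<in> borel_measurable (borel :: real measure)" "N \<in> null_sets lborel"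
      "\<And>t k. t \<in> {0..T} \<Longrightarrow> t \<notin> N \<Longrightarrow> fourier_coeff L (u t) k = c k t"
      using fourier_coeff_borel_version[of u L T] u by (auto simp: L2_field_def)
    interpret active_setting chi \<eta> M C L T \<sigma> u c N
      by unfold_locales (use assms(1,2) L T thr int cN C0 C[rule_format, OF L] in \<open>auto simp: threshold_seq_def\<close>)
    let ?A = limit_slice and ?D = "intermittency_dim chi L T u"
    have subexp: "(\<lambda>q. ln (\<sigma> q) / real q) \<longlonglongrightarrow> 0" using thr by (simp add: threshold_seq_def)
    {
      fix q
      show "region q \<in> sets lebesgue"
        by (rule active_region_volume(1))
      have "emeasure lebesgue (region q) \<le> ennreal (real (card star_offsets) * C * (1 / \<sigma> q ^ 3) * vol q * T)"
        by (rule active_region_volume(2))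
      also have "\<dots> \<le> ennreal (c0 * (1 / \<sigma> q ^ 3) * vol q * T)"
        using T active_volume_nonneg[of q] \<sigma>[of q] by (intro ennreal_leI mult_right_mono) (auto simp: c0_def)
      finally show "emeasure lebesgue (region q) \<le> ennreal (c0 * (1 / \<sigma> q ^ 3) * vol q * T)" .
      have I0: "0 \<le> moment 3 q" unfolding moment_lborel(2) by (intro Bochner_Integration.integral_nonneg) auto
      have "(1 - c0 * \<sigma> q) * moment 3 q \<le> (1 - real (card adjacent_offsets) * \<sigma> q) * moment 3 q"
        using C0 \<sigma>[of q] I0 by (intro mult_right_mono) (auto simp: c0_def algebra_simps)
      also have "\<dots> \<le> (LINT z : region q | lebesgue. block_pow 3 q z)"
        by (rule active_region_integrals(1)[OF active_region_volume(1)])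
      finally show "(1 - c0 * \<sigma> q) * (LINT z : Omega L T | lebesgue. block_pow 3 q z)
              \<le> (LINT z : region q | lebesgue. block_pow 3 q z)"
        by (simp only: moment_def)
      show "(LINT z : region q | lebesgue. block_pow 3 q z)
              \<le> (LINT z : Omega L T | lebesgue. block_pow 3 q z)"
        using active_region_integrals(2)[OF active_region_volume(1)] by (simp only: moment_def)
    }
    have empty: "AE t in lebesgue_on {0..T}. ?A t = {}" if "?D < 0"
      using that by (intro AE_on_interval[OF N active_count_summable[OF subexp, of 0] limsup_slice_empty])
        (auto simp: zero_ereal_def)
    then show "?D < 0 \<Longrightarrow> AE t in lebesgue_on {0..T}. ?A t = {}" .
    show "AE t in lebesgue_on {0..T}. hausdorff_dim (torus_dist L) (?A t) \<le> ?D"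
    proof (cases "?D < 0")
      case True
      show ?thesis using empty[OF True] by (rule AE_mp) (auto simp: hausdorff_dim_def)
    next
      case False
      show ?thesis
      proof (cases "?D = \<infinity>")
        case True
        then show ?thesis by simp
      next
        case fin: False
        then obtain r where r: "?D = ereal r" using False by (cases ?D) auto
        have r0: "r \<ge> 0" using False by (simp add: r)
        have "AE t in lebesgue_on {0..T}. hausdorff_dim (torus_dist L) (?A t) \<le> ereal (r + 1 / real (Suc n))" for n
          using r0 by (intro AE_on_interval[OF N active_count_summable[OF subexp, of "r + 1 / real (Suc n)"]
              hausdorff_dim_le[OF _ limsup_slice_hausdorff_zero]]) (auto simp: r)
        then have "AE t in lebesgue_on {0..T}. \<forall>n. hausdorff_dim (torus_dist L) (?A t) \<le> ereal (r + 1 / real (Suc n))"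
          by (simp add: AE_all_countable)
        then show ?thesis
        proof (rule AE_mp, intro AE_I2 impI)
          fix t assume b: "\<forall>n. hausdorff_dim (torus_dist L) (?A t) \<le> ereal (r + 1 / real (Suc n))"
          have "(\<lambda>n. r + 1 / real (Suc n)) \<longlonglongrightarrow> r + 0" by (intro tendsto_add tendsto_const LIMSEQ_inverse_real_of_nat[unfolded inverse_eq_divide])
          then have "(\<lambda>n. ereal (r + 1 / real (Suc n))) \<longlonglongrightarrow> ereal r" by simp
          then show "hausdorff_dim (torus_dist L) (?A t) \<le> ?D"
            unfolding r by (rule LIMSEQ_le_const) (use b in auto)
        qed
      qed
    qed
  qed
qed

end
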